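(* Let $1 \le p \le \infty$ and let $C = (c_{i,j})_{i,j=1}^{\infty}$ be a positive operator on the space $l^p$ such that $\sum_{i=1}^{\infty} \sum_{j=1}^{\infty} \sqrt{c_{i,j}} < \infty$. Then the following assertions are equivalent: (a) $C = AB - BA$ for a diagonal positive operator $A$ on $l^p$ and a quasinilpotent compact positive operator $B$ on $l^p$; (b) $C = AB - BA$ for some positive operators $A$ and $B$ on $l^p$ with at least one of them compact; (c) $C$ is a quasinilpotent operator.
   Context: Writing $C = (c_{i,j})_{i,j=1}^\infty$ for an operator on $l^p$ means that $C$ is the bounded operator given by this infinite matrix, $(Cx)_i = \sum_{j} c_{i,j} x_j$; positivity means $c_{i,j} \ge 0$ for all $i,j$. A diagonal operator is one given by a diagonal matrix. An operator is quasinilpotent if its spectral radius is $0$. Positive operators on $l^p$ are positive with respect to the coordinatewise order. *)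

theory Defs
  imports "HOL-Analysis.Analysis"
begin

text \<open>
  The scalars are complex, so that the spectrum has its usual meaning. The coordinatewise order
  lives on the real sequences, and its positive cone consists of the sequences with entries in
  \<open>\<real>\<^sub>\<ge>\<^sub>0\<close>. Sequences are indexed from 0.
\<close>

definition lp :: "ennreal \<Rightarrow> (nat \<Rightarrow> complex) set" where
  "lp p = {x. if p = \<infinity> then bounded (range x)
              else summable (\<lambda>i. cmod (x i) powr enn2real p)}"

text \<open>
  The value 0 off \<open>lp p\<close> makes the norm nonnegative everywhere, as the locale
  \<^locale>\<open>Metric_space\<close> demands of a distance.
\<close>

definition lp_norm :: "ennreal \<Rightarrow> (nat \<Rightarrow> complex) \<Rightarrow> real" where
  "lp_norm p x =
     (if x \<notin> lp p then 0
      else if p = \<infinity> then (SUP i. cmod (x i))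
      else (\<Sum>i. cmod (x i) powr enn2real p) powr (1 / enn2real p))"

definition lp_dist :: "ennreal \<Rightarrow> (nat \<Rightarrow> complex) \<Rightarrow> (nat \<Rightarrow> complex) \<Rightarrow> real" where
  "lp_dist p x y = lp_norm p (x - y)"

lemma enn2real_ge_1: assumes "1 \<le> p" "p \<noteq> \<infinity>" shows "1 \<le> enn2real p"
  using assms enn2real_mono[of 1 p] by (simp add: less_top)

lemma powr_convex_comb:
  fixes s t u v P :: real
  assumes "1 \<le> P" "0 \<le> s" "0 \<le> t" "0 < u" "0 < v" "u + v = 1"
  shows "(u * s + v * t) powr P \<le> u * s powr P + v * t powr P"
proof -
  have le: "w powr P \<le> w" if "0 < w" "w \<le> 1" for w
    using powr_mono'[of 1 P w] that assms(1) by simp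
  consider "s = 0" | "t = 0" | "0 < s" "0 < t" using assms by linarith
  then show ?thesis
  proof cases
    case 1
    then show ?thesis using assms le[of v] by (simp add: powr_mult mult_right_mono)
  next
    case 2
    then show ?thesis using assms le[of u] by (simp add: powr_mult mult_right_mono)
  next
    case 3
    then show ?thesis
      using powr_convex[OF assms(1)] assms unfolding convex_on_def by auto
  qed
qed

lemma lp_norm_nonneg: "0 \<le> lp_norm p x"
proof -
  have "0 \<le> (SUP i. cmod (x i))" if "bounded (range x)"
  proof -
    have "bdd_above (range (\<lambda>i. cmod (x i)))"
      using that by (auto simp: bounded_iff bdd_above_def)
    then show ?thesis by (rule cSUP_upper2[of _ _ 0]) auto
  qed
  then show ?thesis by (auto simp: lp_norm_def lp_def)
qed

lemma lp_norm_eq_0: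
  assumes "1 \<le> p" "x \<in> lp p"
  shows "lp_norm p x = 0 \<longleftrightarrow> x = (\<lambda>i. 0)"
proof (cases "p = \<infinity>")
  case True
  have bdd: "bdd_above (range (\<lambda>i. cmod (x i)))"
    using assms True by (auto simp: lp_def bounded_iff bdd_above_def)
  show ?thesis
  proof
    assume "lp_norm p x = 0"
    then have "(SUP i. cmod (x i)) = 0" using True assms by (simp add: lp_norm_def)
    then have "cmod (x i) \<le> 0" for i using cSUP_upper[OF _ bdd, of i] by simp
    then show "x = (\<lambda>i. 0)" by auto
  qed (use True assms in \<open>simp add: lp_norm_def\<close>)
next
  case False
  then have P: "1 \<le> enn2real p" using assms enn2real_ge_1 by blast
  show ?thesis
    using False assms P suminf_eq_zero_iff[of "\<lambda>i. cmod (x i) powr enn2real p"]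
    by (auto simp: lp_norm_def lp_def fun_eq_iff)
qed

lemma lp_minkowski:
  assumes p: "1 \<le> p" and x: "x \<in> lp p" and y: "y \<in> lp p"
  shows "(\<lambda>i. x i + y i) \<in> lp p"
    and "lp_norm p (\<lambda>i. x i + y i) \<le> lp_norm p x + lp_norm p y"
proof -
  have "(\<lambda>i. x i + y i) \<in> lp p \<and> lp_norm p (\<lambda>i. x i + y i) \<le> lp_norm p x + lp_norm p y"
  proof (cases "p = \<infinity>")
    case True
    have bx: "bdd_above (range (\<lambda>i. cmod (x i)))" and b_y: "bdd_above (range (\<lambda>i. cmod (y i)))"
      using x y True by (auto simp: lp_def bounded_iff bdd_above_def)
    have le: "cmod (x i + y i) \<le> (SUP i. cmod (x i)) + (SUP i. cmod (y i))" for i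
      using norm_triangle_ineq[of "x i" "y i"] cSUP_upper[OF _ bx, of i] cSUP_upper[OF _ b_y, of i]
      by simp
    then have m: "(\<lambda>i. x i + y i) \<in> lp p" using True by (auto simp: lp_def bounded_iff)
    show ?thesis using m True x y le by (auto simp: lp_norm_def intro!: cSUP_least)
  next
    case False
    define P where "P = enn2real p"
    have P: "1 \<le> P" using False p enn2real_ge_1 by (simp add: P_def)
    have sx: "summable (\<lambda>i. cmod (x i) powr P)" and sy: "summable (\<lambda>i. cmod (y i) powr P)"
      using x y False by (auto simp: lp_def P_def)
    show ?thesis
    proof (cases "lp_norm p x = 0 \<or> lp_norm p y = 0")
      case True
      then show ?thesis using lp_norm_eq_0[OF p x] lp_norm_eq_0[OF p y] x y lp_norm_nonneg by auto
    next
      case nz: False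
      define a b where "a = lp_norm p x" and "b = lp_norm p y"
      have ab: "0 < a" "0 < b" using nz lp_norm_nonneg[of p x] lp_norm_nonneg[of p y]
        by (auto simp: a_def b_def)
      have aP: "a powr P = (\<Sum>i. cmod (x i) powr P)"
        using P x False suminf_nonneg[OF sx] by (simp add: a_def lp_norm_def powr_powr flip: P_def)
      have bP: "b powr P = (\<Sum>i. cmod (y i) powr P)"
        using P y False suminf_nonneg[OF sy] by (simp add: b_def lp_norm_def powr_powr flip: P_def)
      define F where "F i = (a + b) powr P * (a / (a + b) * (cmod (x i) powr P / a powr P)
          + b / (a + b) * (cmod (y i) powr P / b powr P))" for i
      have F: "cmod (x i + y i) powr P \<le> F i" for i
      proof -
        have "cmod (x i + y i) powr P \<le> (cmod (x i) + cmod (y i)) powr P"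
          using P norm_triangle_ineq by (intro powr_mono2) auto
        also have "\<dots> = ((a + b) * (a / (a + b) * (cmod (x i) / a) + b / (a + b) * (cmod (y i) / b))) powr P"
          using ab add_pos_pos[OF ab] by (simp add: distrib_left)
        also have "\<dots> = (a + b) powr P * (a / (a + b) * (cmod (x i) / a) + b / (a + b) * (cmod (y i) / b)) powr P"
          using ab by (subst powr_mult) auto
        also have "\<dots> \<le> (a + b) powr P * (a / (a + b) * (cmod (x i) / a) powr P + b / (a + b) * (cmod (y i) / b) powr P)"
          using P ab by (intro mult_left_mono powr_convex_comb) (auto simp flip: add_divide_distrib)
        also have "\<dots> = F i" using ab by (simp add: F_def powr_divide)
        finally show ?thesis .
      qed
      have "F sums ((a + b) powr P * (a / (a + b) * ((\<Sum>i. cmod (x i) powr P) / a powr P)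
          + b / (a + b) * ((\<Sum>i. cmod (y i) powr P) / b powr P)))"
        unfolding F_def using sx sy by (intro sums_mult sums_add sums_divide summable_sums)
      moreover have "(a + b) powr P * (a / (a + b) * ((\<Sum>i. cmod (x i) powr P) / a powr P)
          + b / (a + b) * ((\<Sum>i. cmod (y i) powr P) / b powr P)) = (a + b) powr P"
        using ab unfolding aP[symmetric] bP[symmetric] by (simp flip: add_divide_distrib)
      ultimately have Fs: "F sums ((a + b) powr P)" by (simp only:)
      have s: "summable (\<lambda>i. cmod (x i + y i) powr P)"
        using F by (intro summable_comparison_test'[OF sums_summable[OF Fs], of 0]) auto
      then have m: "(\<lambda>i. x i + y i) \<in> lp p" using False by (simp add: lp_def P_def)
      have "(\<Sum>i. cmod (x i + y i) powr P) \<le> (a + b) powr P"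
        using suminf_le[OF F s sums_summable[OF Fs]] sums_unique[OF Fs] by simp
      then have "(\<Sum>i. cmod (x i + y i) powr P) powr (1 / P) \<le> ((a + b) powr P) powr (1 / P)"
        using P suminf_nonneg[OF s] by (intro powr_mono2) auto
      also have "\<dots> = a + b" using P ab by (simp add: powr_powr)
      finally show ?thesis using m False by (simp add: lp_norm_def a_def b_def P_def)
    qed
  qed
  then show "(\<lambda>i. x i + y i) \<in> lp p"
    and "lp_norm p (\<lambda>i. x i + y i) \<le> lp_norm p x + lp_norm p y" by auto
qed

lemma Metric_space_lp:
  assumes p: "1 \<le> p"
  shows "Metric_space (lp p) (lp_dist p)"
proof -
  have neg: "- x \<in> lp p \<longleftrightarrow> x \<in> lp p" for x :: "nat \<Rightarrow> complex"
    by (simp add: lp_def bounded_iff)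
  have diff: "x - y \<in> lp p" if "x \<in> lp p" "y \<in> lp p" for x y
    using lp_minkowski(1)[OF p that(1), of "- y"] that neg by (simp add: fun_diff_def)
  show ?thesis
  proof
    show "0 \<le> lp_dist p x y" for x y by (simp add: lp_dist_def lp_norm_nonneg)
    show "lp_dist p x y = lp_dist p y x" for x y
    proof -
      have "x - y = - (y - x)" by (simp add: fun_eq_iff)
      then have "x - y \<in> lp p \<longleftrightarrow> y - x \<in> lp p" using neg by metis
      then show ?thesis by (simp add: lp_dist_def lp_norm_def norm_minus_commute)
    qed
    show "lp_dist p x y = 0 \<longleftrightarrow> x = y" if "x \<in> lp p" "y \<in> lp p" for x y
      using lp_norm_eq_0[OF p diff[OF that]] by (simp add: lp_dist_def fun_eq_iff)
    show "lp_dist p x z \<le> lp_dist p x y + lp_dist p y z"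
      if "x \<in> lp p" "y \<in> lp p" "z \<in> lp p" for x y z
      using lp_minkowski(2)[OF p diff[OF that(1,2)] diff[OF that(2,3)]]
      by (simp add: lp_dist_def fun_diff_def)
  qed
qed

text \<open>
  An operator is represented by a total function of which only the values on \<open>lp p\<close> matter;
  accordingly identities between operators are required on \<open>lp p\<close> only.
\<close>

definition bounded_operator ::
    "ennreal \<Rightarrow> ((nat \<Rightarrow> complex) \<Rightarrow> (nat \<Rightarrow> complex)) \<Rightarrow> bool" where
  "bounded_operator p T \<longleftrightarrow>
     (\<forall>x\<in>lp p. T x \<in> lp p) \<and>
     (\<forall>x\<in>lp p. \<forall>y\<in>lp p. T (\<lambda>i. x i + y i) = (\<lambda>i. T x i + T y i)) \<and>
     (\<forall>a. \<forall>x\<in>lp p. T (\<lambda>i. a * x i) = (\<lambda>i. a * T x i)) \<and>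
     (\<exists>K. \<forall>x\<in>lp p. lp_norm p (T x) \<le> K * lp_norm p x)"

definition positive_operator ::
    "ennreal \<Rightarrow> ((nat \<Rightarrow> complex) \<Rightarrow> (nat \<Rightarrow> complex)) \<Rightarrow> bool" where
  "positive_operator p T \<longleftrightarrow>
     bounded_operator p T \<and>
     (\<forall>x\<in>lp p. (\<forall>i. x i \<in> \<real>\<^sub>\<ge>\<^sub>0) \<longrightarrow> (\<forall>i. T x i \<in> \<real>\<^sub>\<ge>\<^sub>0))"

text \<open>
  For \<open>p = \<infinity>\<close> not every bounded operator is given by a matrix.
\<close>

definition operator_with_matrix ::
    "ennreal \<Rightarrow> ((nat \<Rightarrow> complex) \<Rightarrow> (nat \<Rightarrow> complex)) \<Rightarrow> (nat \<Rightarrow> nat \<Rightarrow> complex) \<Rightarrow> bool" where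
  "operator_with_matrix p T t \<longleftrightarrow>
     bounded_operator p T \<and> (\<forall>x\<in>lp p. \<forall>i. (\<lambda>j. t i j * x j) sums T x i)"

definition diagonal_operator ::
    "ennreal \<Rightarrow> ((nat \<Rightarrow> complex) \<Rightarrow> (nat \<Rightarrow> complex)) \<Rightarrow> bool" where
  "diagonal_operator p T \<longleftrightarrow>
     (\<exists>t. operator_with_matrix p T t \<and> (\<forall>i j. i \<noteq> j \<longrightarrow> t i j = 0))"

definition compact_operator ::
    "ennreal \<Rightarrow> ((nat \<Rightarrow> complex) \<Rightarrow> (nat \<Rightarrow> complex)) \<Rightarrow> bool" where
  "compact_operator p T \<longleftrightarrow>
     bounded_operator p T \<and>
     compactin (Metric_space.mtopology (lp p) (lp_dist p))
       (Metric_space.mtopology (lp p) (lp_dist p) closure_of (T ` {x \<in> lp p. lp_norm p x \<le> 1}))"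

definition spectrum ::
    "ennreal \<Rightarrow> ((nat \<Rightarrow> complex) \<Rightarrow> (nat \<Rightarrow> complex)) \<Rightarrow> complex set" where
  "spectrum p T =
     {a. \<not> (\<exists>S. bounded_operator p S \<and>
           (\<forall>x\<in>lp p. S (\<lambda>i. a * x i - T x i) = x \<and> (\<lambda>i. a * S x i - T (S x) i) = x))}"

definition spectral_radius ::
    "ennreal \<Rightarrow> ((nat \<Rightarrow> complex) \<Rightarrow> (nat \<Rightarrow> complex)) \<Rightarrow> ennreal" where
  "spectral_radius p T = (SUP a\<in>spectrum p T. ennreal (cmod a))"

definition quasinilpotent ::
    "ennreal \<Rightarrow> ((nat \<Rightarrow> complex) \<Rightarrow> (nat \<Rightarrow> complex)) \<Rightarrow> bool" where
  "quasinilpotent p T \<longleftrightarrow> bounded_operator p T \<and> spectral_radius p T = 0"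

definition is_commutator ::
    "ennreal \<Rightarrow> ((nat \<Rightarrow> complex) \<Rightarrow> (nat \<Rightarrow> complex)) \<Rightarrow> ((nat \<Rightarrow> complex) \<Rightarrow> (nat \<Rightarrow> complex))
      \<Rightarrow> ((nat \<Rightarrow> complex) \<Rightarrow> (nat \<Rightarrow> complex)) \<Rightarrow> bool" where
  "is_commutator p C A B \<longleftrightarrow> (\<forall>x\<in>lp p. C x = A (B x) - B (A x))"

end

theory Submission
  imports Defs "HOL-Library.Function_Algebras"
begin

text \<open>
  Read \<open>0 < c i j\<close> as an edge from \<open>i\<close> to \<open>j\<close>. Each of the three assertions is equivalent to the
  absence of cycles in this graph. As (a) is a special case of (b), three implications remain.

  \<^bold>\<open>No cycles imply (a) and (c).\<close> Let \<open>\<rho> i\<close> be the sum of \<open>sqrt (c i j)\<close> over \<open>j\<close>, and let \<open>a i\<close> be the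
  sum of \<open>\<rho> u\<close> over all vertices \<open>u\<close> that can be reached from \<open>i\<close>. Along an edge from \<open>i\<close> to \<open>j\<close> the
  reachable set shrinks, and it loses \<open>i\<close> because there is no way back; so \<open>a\<close> drops by at least \<open>\<rho> i\<close>,
  hence by at least \<open>sqrt (c i j)\<close> (\<open>acyclic_potential\<close>). Therefore \<open>b i j = c i j / (a i - a j)\<close> is at
  most \<open>sqrt (c i j)\<close>, the matrix \<open>b\<close> has a finite sum of entries and is compact, and \<open>C = A B - B A\<close> with
  \<open>A\<close> the diagonal operator of \<open>a\<close>. The same drop gives quasinilpotence, of \<open>B\<close> and of \<open>C\<close>: conjugation
  with the diagonal operator of \<open>exp (t * a i)\<close>, which is boundedly invertible, multiplies the \<open>i\<close>-th row by
  at most \<open>exp (- t * \<rho> i)\<close> and so makes the norm on bounded sequences of order \<open>1 / t\<close>. Hence every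
  nonzero number is a regular value (\<open>acyclic_matrix.quasinilpotent\<close>).

  \<^bold>\<open>Quasinilpotence excludes cycles.\<close> A cycle makes the powers of \<open>C\<close> grow at least geometrically, with a
  sharp rate \<open>r > 0\<close>. The partial sums of the Neumann series at points slightly above \<open>r\<close> are then unbounded
  (\<open>neumann_blow_up\<close>), because otherwise their squares would show that the powers grow more slowly than \<open>r\<close>.
  So \<open>r\<close> is a nonzero point of the spectrum (\<open>quasinilpotent_acyclic\<close>).

  \<^bold>\<open>A positive commutator with a compact factor excludes cycles.\<close> For finite matrices this follows from
  traces: \<open>(A B)^n \<ge> (B A)^n + C^n\<close> and both products have the same trace. Here there is no trace, and
  the argument is of Perron--Frobenius type. Let a cycle pass through \<open>k\<close>, let \<open>e\<close> be the \<open>k\<close>-th unit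
  sequence and \<open>\<phi>\<close> the \<open>k\<close>-th coordinate. Keep only what can be reached from \<open>e\<close>, and ignore what is
  invisible to \<open>\<phi>\<close>, under all words in \<open>A\<close> and \<open>B\<close>; what remains is irreducible. As
  \<open>C^n \<le> A^n B^n\<close>, the cycle forces a positive growth rate \<open>r\<close> on the compact factor, say on \<open>B\<close>. By
  compactness there are an eigenvector \<open>x\<close> for \<open>r\<close> and positive functionals \<open>P m\<close> of norm at most 1 that are
  approximate left eigenvectors and do not die out (\<open>peripheral_eigenvectors\<close>). Since \<open>B A \<le> A B\<close>, the
  vectors \<open>A^j x\<close> satisfy \<open>B y \<le> r y\<close> and the functionals \<open>P m \<circ> A^i\<close> satisfy the opposite inequality up to
  a null sequence. Evaluating \<open>A^i (A B - B A) A^j\<close> between them cancels the eigenvalue, so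
  \<open>P m (A^i (C (A^j x)))\<close> tends to 0. The cycle and irreducibility spread this to \<open>P m z \<longlonglongrightarrow> 0\<close> for
  all \<open>z\<close>, a contradiction. If \<open>A\<close> is the compact factor, the roles of vectors and functionals are exchanged.

  All operators are seen only through their action on cones of nonnegative sequences with a seminorm. That
  makes quotients and dual spaces unnecessary, and it covers \<open>p = \<infinity>\<close>, where \<open>A\<close> and \<open>B\<close> need not be
  given by matrices.
\<close>

section \<open>Cones with a Riesz seminorm\<close>

text \<open>
  The positive cone of an ideal in a vector lattice, with a lattice seminorm. Elements of seminorm 0 play the
  role of 0 in a quotient by an ideal. Working with a cone and a seminorm, rather than with a Banach lattice
  and its quotients, allows the seminorm to be changed without changing the vectors.
\<close>
locale riesz_cone =
  fixes E :: "'a::ordered_real_vector set" and q :: "'a \<Rightarrow> real"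
  assumes nonneg: "x \<in> E \<Longrightarrow> 0 \<le> x"
    and zero_mem: "0 \<in> E"
    and add_mem: "x \<in> E \<Longrightarrow> y \<in> E \<Longrightarrow> x + y \<in> E"
    and scale_mem: "x \<in> E \<Longrightarrow> 0 \<le> t \<Longrightarrow> t *\<^sub>R x \<in> E"
    and solid: "y \<in> E \<Longrightarrow> 0 \<le> x \<Longrightarrow> x \<le> y \<Longrightarrow> x \<in> E"
    and q_nonneg: "x \<in> E \<Longrightarrow> 0 \<le> q x"
    and q_scale: "x \<in> E \<Longrightarrow> 0 \<le> t \<Longrightarrow> q (t *\<^sub>R x) = t * q x"
    and q_add: "x \<in> E \<Longrightarrow> y \<in> E \<Longrightarrow> q (x + y) \<le> q x + q y"
    and q_mono: "y \<in> E \<Longrightarrow> 0 \<le> x \<Longrightarrow> x \<le> y \<Longrightarrow> q x \<le> q y"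
begin

definition pos_map :: "('a \<Rightarrow> 'a) \<Rightarrow> bool" where
  "pos_map T \<longleftrightarrow> (\<forall>x\<in>E. T x \<in> E) \<and> (\<forall>x\<in>E. \<forall>y\<in>E. T (x + y) = T x + T y) \<and>
     (\<forall>x\<in>E. \<forall>t\<ge>0. T (t *\<^sub>R x) = t *\<^sub>R T x) \<and> (\<exists>M. \<forall>x\<in>E. q (T x) \<le> M * q x)"

definition pos_functional :: "('a \<Rightarrow> real) \<Rightarrow> bool" where
  "pos_functional f \<longleftrightarrow> (\<forall>x\<in>E. 0 \<le> f x) \<and> (\<forall>x\<in>E. \<forall>y\<in>E. f (x + y) = f x + f y) \<and>
     (\<forall>x\<in>E. \<forall>t\<ge>0. f (t *\<^sub>R x) = t * f x) \<and> (\<exists>M. \<forall>x\<in>E. f x \<le> M * q x)"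

text \<open>
  The infimum of the growth rates is the spectral radius of \<open>T\<close> with respect to \<open>q\<close>. As infimum over
  uniform bounds it is defined without any completeness of the cone.
\<close>
definition growth_rates :: "('a \<Rightarrow> 'a) \<Rightarrow> real set" where
  "growth_rates T = {\<mu>. 0 < \<mu> \<and> (\<exists>H. \<forall>n. \<forall>y\<in>E. q ((T ^^ n) y) \<le> H * \<mu> ^ n * q y)}"

definition growth :: "('a \<Rightarrow> 'a) \<Rightarrow> real" where
  "growth T = Inf (growth_rates T)"

text \<open>The partial sums of the Neumann series for the resolvent at \<open>l\<close>.\<close>
definition neumann :: "('a \<Rightarrow> 'a) \<Rightarrow> real \<Rightarrow> nat \<Rightarrow> 'a \<Rightarrow> 'a" where
  "neumann T l N y = (\<Sum>n<N. (1 / l ^ Suc n) *\<^sub>R (T ^^ n) y)"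

text \<open>
  Sequential compactness. A cone is not closed under differences, so convergence to \<open>y\<close> is expressed by order bounds with
  an error \<open>u m\<close> whose seminorm tends to 0.
\<close>
definition compact_map :: "('a \<Rightarrow> 'a) \<Rightarrow> bool" where
  "compact_map T \<longleftrightarrow> (\<forall>s. (\<forall>m. s m \<in> E \<and> q (s m) \<le> 1) \<longrightarrow>
     (\<exists>\<sigma> y u. strict_mono (\<sigma> :: nat \<Rightarrow> nat) \<and> y \<in> E \<and>
        (\<forall>m. u m \<in> E \<and> T (s (\<sigma> m)) \<le> y + u m \<and> y \<le> T (s (\<sigma> m)) + u m) \<and>
        (\<lambda>m. q (u m)) \<longlonglongrightarrow> 0))"

lemma pos_map_mem: "pos_map T \<Longrightarrow> x \<in> E \<Longrightarrow> T x \<in> E"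
  and pos_map_add: "pos_map T \<Longrightarrow> x \<in> E \<Longrightarrow> y \<in> E \<Longrightarrow> T (x + y) = T x + T y"
  and pos_map_scale: "pos_map T \<Longrightarrow> x \<in> E \<Longrightarrow> 0 \<le> t \<Longrightarrow> T (t *\<^sub>R x) = t *\<^sub>R T x"
  by (auto simp: pos_map_def)

lemma pos_map_bound:
  assumes "pos_map T"
  obtains M where "1 \<le> M" "\<And>x. x \<in> E \<Longrightarrow> q (T x) \<le> M * q x"
proof -
  obtain M where M: "\<And>x. x \<in> E \<Longrightarrow> q (T x) \<le> M * q x"
    using assms unfolding pos_map_def by blast
  have "q (T x) \<le> max 1 M * q x" if "x \<in> E" for x
    using M[OF that] mult_right_mono[of M "max 1 M" "q x"] q_nonneg[OF that] by linarith
  then show ?thesis using that[of "max 1 M"] by auto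
qed

lemma pos_map_mono:
  assumes "pos_map T" "y \<in> E" "0 \<le> x" "x \<le> y"
  shows "T x \<le> T y"
proof -
  have x: "x \<in> E" using assms solid by blast
  have d: "y - x \<in> E" using assms by (intro solid[OF assms(2)]) (auto simp: algebra_simps)
  have "T y = T x + T (y - x)" using pos_map_add[OF assms(1) x d] by simp
  moreover have "0 \<le> T (y - x)" using nonneg pos_map_mem assms d by blast
  ultimately show ?thesis by simp
qed

lemma pos_map_zero: "pos_map T \<Longrightarrow> T 0 = 0"
  using pos_map_scale[of T 0 0] zero_mem by simp

lemma pos_functional_nonneg: "pos_functional f \<Longrightarrow> x \<in> E \<Longrightarrow> 0 \<le> f x"
  and pos_functional_add: "pos_functional f \<Longrightarrow> x \<in> E \<Longrightarrow> y \<in> E \<Longrightarrow> f (x + y) = f x + f y"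
  and pos_functional_scale: "pos_functional f \<Longrightarrow> x \<in> E \<Longrightarrow> 0 \<le> t \<Longrightarrow> f (t *\<^sub>R x) = t * f x"
  by (auto simp: pos_functional_def)

lemma pos_functional_bound:
  assumes "pos_functional f"
  obtains M where "1 \<le> M" "\<And>x. x \<in> E \<Longrightarrow> f x \<le> M * q x"
proof -
  obtain M where M: "\<And>x. x \<in> E \<Longrightarrow> f x \<le> M * q x"
    using assms unfolding pos_functional_def by blast
  have "f x \<le> max 1 M * q x" if "x \<in> E" for x
    using M[OF that] mult_right_mono[of M "max 1 M" "q x"] q_nonneg[OF that] by linarith
  then show ?thesis using that[of "max 1 M"] by auto
qed

lemma pos_functional_mono:
  assumes "pos_functional f" "y \<in> E" "0 \<le> x" "x \<le> y"
  shows "f x \<le> f y"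
proof -
  have x: "x \<in> E" using assms solid by blast
  have d: "y - x \<in> E" using assms by (intro solid[OF assms(2)]) (auto simp: algebra_simps)
  have "f y = f x + f (y - x)" using pos_functional_add[OF assms(1) x d] by simp
  then show ?thesis using pos_functional_nonneg[OF assms(1) d] by simp
qed

lemma q_zero: "q 0 = 0"
  using q_scale[of 0 0] zero_mem by simp

lemma scaled_trans: "0 \<le> M \<Longrightarrow> a \<le> b \<Longrightarrow> x \<le> M * a \<Longrightarrow> x \<le> M * b" for M a b x :: real
  by (meson mult_left_mono order_trans)

lemma pos_map_id: "pos_map (\<lambda>x. x)"
  by (auto simp: pos_map_def intro!: exI[of _ 1])

lemma pos_map_const_0: "pos_map (\<lambda>x. 0)"
  by (auto simp: pos_map_def zero_mem q_zero intro!: exI[of _ 0])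

lemma pos_map_comp:
  assumes "pos_map S" "pos_map T"
  shows "pos_map (\<lambda>x. S (T x))"
proof -
  obtain M where M: "1 \<le> M" "\<And>x. x \<in> E \<Longrightarrow> q (S x) \<le> M * q x" using pos_map_bound[OF assms(1)] by metis
  obtain K where K: "1 \<le> K" "\<And>x. x \<in> E \<Longrightarrow> q (T x) \<le> K * q x" using pos_map_bound[OF assms(2)] by metis
  have "q (S (T x)) \<le> (M * K) * q x" if "x \<in> E" for x
    using M(2)[OF pos_map_mem[OF assms(2) that]] M(1) scaled_trans[OF _ K(2)[OF that], of M]
    by (simp add: mult.assoc)
  then show ?thesis using assms by (auto simp: pos_map_def)
qed

lemma pos_map_funpow: "pos_map T \<Longrightarrow> pos_map (T ^^ n)"
proof (induction n)
  case 0
  then show ?case using pos_map_id by (simp add: id_def)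
next
  case (Suc n)
  then show ?case using pos_map_comp[of T "T ^^ n"] by (simp add: o_def)
qed

lemma funpow_mem: "pos_map T \<Longrightarrow> y \<in> E \<Longrightarrow> (T ^^ n) y \<in> E"
  by (rule pos_map_mem[OF pos_map_funpow])

lemma q_funpow_le:
  assumes T: "pos_map T" and M: "0 \<le> M" "\<And>x. x \<in> E \<Longrightarrow> q (T x) \<le> M * q x" and y: "y \<in> E"
  shows "q ((T ^^ m) y) \<le> M ^ m * q y"
proof (induction m)
  case (Suc m)
  then show ?case
    using M(2)[OF funpow_mem[OF T y, of m]] M(1) scaled_trans[OF _ Suc, of M] by (simp add: mult.assoc)
qed simp

lemma pos_map_plus:
  assumes "pos_map S" "pos_map T"
  shows "pos_map (\<lambda>x. S x + T x)"
proof -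
  obtain M where M: "1 \<le> M" "\<And>x. x \<in> E \<Longrightarrow> q (S x) \<le> M * q x" using pos_map_bound[OF assms(1)] by metis
  obtain K where K: "1 \<le> K" "\<And>x. x \<in> E \<Longrightarrow> q (T x) \<le> K * q x" using pos_map_bound[OF assms(2)] by metis
  have "q (S x + T x) \<le> (M + K) * q x" if "x \<in> E" for x
    using q_add[OF pos_map_mem[OF assms(1) that] pos_map_mem[OF assms(2) that]]
      M(2)[OF that] K(2)[OF that] by (simp add: distrib_right)
  then show ?thesis using assms
    by (auto simp: pos_map_def add_mem scaleR_add_right intro!: exI[of _ "M + K"])
qed

lemma pos_map_times:
  assumes "pos_map T" "0 \<le> t"
  shows "pos_map (\<lambda>x. t *\<^sub>R T x)"
proof -
  obtain M where M: "1 \<le> M" "\<And>x. x \<in> E \<Longrightarrow> q (T x) \<le> M * q x" using pos_map_bound[OF assms(1)] by metis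
  have "q (t *\<^sub>R T x) \<le> (t * M) * q x" if "x \<in> E" for x
    using q_scale[OF pos_map_mem[OF assms(1) that] assms(2)] mult_left_mono[OF M(2)[OF that] assms(2)]
    by (simp add: mult.assoc)
  then show ?thesis using assms
    by (auto simp: pos_map_def scale_mem scaleR_add_right intro!: exI[of _ "t * M"])
qed

lemma pos_functional_comp:
  assumes "pos_functional f" "pos_map T"
  shows "pos_functional (\<lambda>x. f (T x))"
proof -
  obtain M where M: "1 \<le> M" "\<And>x. x \<in> E \<Longrightarrow> f x \<le> M * q x" using pos_functional_bound[OF assms(1)] by metis
  obtain K where K: "1 \<le> K" "\<And>x. x \<in> E \<Longrightarrow> q (T x) \<le> K * q x" using pos_map_bound[OF assms(2)] by metis
  have "f (T x) \<le> (M * K) * q x" if "x \<in> E" for x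
    using M(2)[OF pos_map_mem[OF assms(2) that]] M(1) scaled_trans[OF _ K(2)[OF that], of M]
    by (simp add: mult.assoc)
  then show ?thesis using assms by (auto simp: pos_map_def pos_functional_def)
qed

lemma pos_functional_times:
  assumes "pos_functional f" "0 \<le> t"
  shows "pos_functional (\<lambda>x. t * f x)"
proof -
  obtain M where M: "1 \<le> M" "\<And>x. x \<in> E \<Longrightarrow> f x \<le> M * q x" using pos_functional_bound[OF assms(1)] by metis
  have "t * f x \<le> (t * M) * q x" if "x \<in> E" for x
    using mult_left_mono[OF M(2)[OF that] assms(2)] by (simp add: mult.assoc)
  then show ?thesis using assms
    by (auto simp: pos_functional_def algebra_simps intro!: exI[of _ "t * M"])
qed

lemma pos_map_neumann: "pos_map T \<Longrightarrow> 0 < l \<Longrightarrow> pos_map (neumann T l N)"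
proof (induction N)
  case 0
  then show ?case using pos_map_const_0 by (simp add: neumann_def)
next
  case (Suc N)
  have "pos_map (\<lambda>x. neumann T l N x + (1 / l ^ Suc N) *\<^sub>R (T ^^ N) x)"
    using Suc by (intro pos_map_plus pos_map_times pos_map_funpow) auto
  then show ?case by (simp add: neumann_def)
qed

lemma neumann_mem: "pos_map T \<Longrightarrow> 0 < l \<Longrightarrow> y \<in> E \<Longrightarrow> neumann T l N y \<in> E"
  by (rule pos_map_mem[OF pos_map_neumann])

lemma neumann_nonneg_term:
  "pos_map T \<Longrightarrow> 0 < l \<Longrightarrow> y \<in> E \<Longrightarrow> 0 \<le> (1 / l ^ Suc n) *\<^sub>R (T ^^ n) y"
  by (intro scaleR_nonneg_nonneg nonneg[OF funpow_mem]) auto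

lemma neumann_mono:
  assumes "pos_map T" "0 < l" "y \<in> E" "N \<le> N'"
  shows "neumann T l N y \<le> neumann T l N' y"
  unfolding neumann_def using assms neumann_nonneg_term by (intro sum_mono2) auto

lemma neumann_ge_term:
  assumes "pos_map T" "0 < l" "y \<in> E" "n < N"
  shows "(1 / l ^ Suc n) *\<^sub>R (T ^^ n) y \<le> neumann T l N y"
proof -
  have "(\<Sum>i\<in>{n}. (1 / l ^ Suc i) *\<^sub>R (T ^^ i) y) \<le> neumann T l N y"
    unfolding neumann_def using assms neumann_nonneg_term by (intro sum_mono2) auto
  then show ?thesis by simp
qed

text \<open>
  The resolvent equation for a partial sum, with both sides arranged to contain no differences. It makes the
  partial sums approximate eigenvectors as soon as they are large and the last term is small.
\<close>
lemma neumann_shift: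
  assumes "0 < l"
  shows "neumann T l N (T y) + y = l *\<^sub>R neumann T l N y + (1 / l ^ N) *\<^sub>R (T ^^ N) y"
proof (induction N)
  case 0
  then show ?case by (simp add: neumann_def)
next
  case (Suc N)
  have "neumann T l (Suc N) (T y) + y = (neumann T l N (T y) + y) + (1 / l ^ Suc N) *\<^sub>R (T ^^ Suc N) y"
    by (simp add: neumann_def funpow_swap1)
  also have "\<dots> = l *\<^sub>R neumann T l N y + (1 / l ^ N) *\<^sub>R (T ^^ N) y + (1 / l ^ Suc N) *\<^sub>R (T ^^ Suc N) y"
    unfolding Suc ..
  also have "l *\<^sub>R neumann T l N y + (1 / l ^ N) *\<^sub>R (T ^^ N) y = l *\<^sub>R neumann T l (Suc N) y"
    using assms by (simp add: neumann_def scaleR_add_right)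
  finally show ?case .
qed

lemma neumann_commute:
  assumes "pos_map T" "0 < l" "y \<in> E"
  shows "T (neumann T l N y) = neumann T l N (T y)"
proof (induction N)
  case 0
  then show ?case using pos_map_zero[OF assms(1)] by (simp add: neumann_def)
next
  case (Suc N)
  have m: "neumann T l N y \<in> E" "(T ^^ N) y \<in> E"
    using assms by (auto intro: neumann_mem funpow_mem)
  have "T (neumann T l (Suc N) y) = T (neumann T l N y + (1 / l ^ Suc N) *\<^sub>R (T ^^ N) y)"
    by (simp add: neumann_def)
  also have "\<dots> = T (neumann T l N y) + (1 / l ^ Suc N) *\<^sub>R T ((T ^^ N) y)"
    using m assms by (simp add: pos_map_add pos_map_scale scale_mem)
  also have "\<dots> = neumann T l (Suc N) (T y)"
    using Suc by (simp add: neumann_def funpow_swap1)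
  finally show ?case .
qed

lemma growth_rates_bounded_below: "bdd_below (growth_rates T)"
  by (rule bdd_belowI[of _ 0]) (auto simp: growth_rates_def)

lemma growth_le: "\<mu> \<in> growth_rates T \<Longrightarrow> growth T \<le> \<mu>"
  unfolding growth_def by (rule cInf_lower[OF _ growth_rates_bounded_below])

text \<open>A bound for a single power suffices: a bounded map can do only boundedly much harm in between.\<close>
lemma growth_ratesI:
  assumes T: "pos_map T" and n: "0 < n" and \<mu>: "0 < \<mu>"
    and le: "\<And>y. y \<in> E \<Longrightarrow> q ((T ^^ n) y) \<le> \<mu> ^ n * q y"
  shows "\<mu> \<in> growth_rates T"
proof -
  obtain M where M: "1 \<le> M" "\<And>x. x \<in> E \<Longrightarrow> q (T x) \<le> M * q x" using pos_map_bound[OF T] by metis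
  define H where "H = (\<Sum>b<n. M ^ b / \<mu> ^ b)"
  have pow: "q ((T ^^ m) y) \<le> M ^ m * q y" if "y \<in> E" for m y
    using q_funpow_le[OF T _ M(2) that] M(1) by simp
  have "q ((T ^^ m) y) \<le> H * \<mu> ^ m * q y" if "y \<in> E" for m y
    using that
  proof (induction m arbitrary: y rule: less_induct)
    case (less m)
    show ?case
    proof (cases "m < n")
      case True
      have "M ^ m / \<mu> ^ m \<le> H" unfolding H_def
        using True M(1) \<mu> by (intro member_le_sum) auto
      then have "M ^ m \<le> H * \<mu> ^ m" using \<mu> by (simp add: field_simps)
      then show ?thesis
        using pow[OF less.prems, of m] q_nonneg[OF less.prems] mult_right_mono by fastforce
    next
      case False
      then have m: "m = n + (m - n)" "m - n < m" using n by auto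
      have mem: "(T ^^ (m - n)) y \<in> E" using less.prems T by (intro funpow_mem)
      have "q ((T ^^ m) y) = q ((T ^^ n) ((T ^^ (m - n)) y))"
        by (subst m(1)) (simp add: funpow_add)
      also have "\<dots> \<le> \<mu> ^ n * q ((T ^^ (m - n)) y)" using le[OF mem] .
      also have "\<dots> \<le> \<mu> ^ n * (H * \<mu> ^ (m - n) * q y)"
        using less.IH[OF m(2) less.prems] \<mu> by (intro mult_left_mono) auto
      also have "\<dots> = H * \<mu> ^ (n + (m - n)) * q y" by (simp add: power_add)
      finally show ?thesis using m(1) by simp
    qed
  qed
  then show ?thesis using \<mu> by (auto simp: growth_rates_def)
qed

text \<open>
  Above the growth the terms of the Neumann series tend to 0 uniformly, since there is room for a growth rate
  below \<open>l\<close>.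
\<close>
lemma growth_tail:
  assumes T: "pos_map T" and r: "0 < growth T" and l: "growth T < l"
  obtains N where "\<And>n v. N \<le> n \<Longrightarrow> v \<in> E \<Longrightarrow> q ((1 / l ^ n) *\<^sub>R (T ^^ n) v) \<le> q v"
proof -
  obtain M where M: "1 \<le> M" "\<And>x. x \<in> E \<Longrightarrow> q (T x) \<le> M * q x" using pos_map_bound[OF T] by metis
  have "M \<in> growth_rates T" using M by (intro growth_ratesI[OF T, of 1]) auto
  then obtain \<mu> where \<mu>: "\<mu> \<in> growth_rates T" "\<mu> < l"
    using cInf_lessD[of "growth_rates T" l] l unfolding growth_def by blast
  then obtain H where H: "0 < \<mu>" "\<And>n y. y \<in> E \<Longrightarrow> q ((T ^^ n) y) \<le> H * \<mu> ^ n * q y"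
    by (auto simp: growth_rates_def)
  have "(\<lambda>n. H * (\<mu> / l) ^ n) \<longlonglongrightarrow> H * 0"
    using H \<mu> by (intro tendsto_mult tendsto_const LIMSEQ_power_zero) auto
  then have "\<forall>\<^sub>F n in sequentially. H * (\<mu> / l) ^ n < 1" by (intro order_tendstoD) auto
  then obtain N where N: "\<And>n. N \<le> n \<Longrightarrow> H * (\<mu> / l) ^ n < 1"
    by (auto simp: eventually_sequentially)
  have "q ((1 / l ^ n) *\<^sub>R (T ^^ n) v) \<le> q v" if "N \<le> n" "v \<in> E" for n v
  proof -
    have l0: "0 < l" using r l by simp
    have "q ((1 / l ^ n) *\<^sub>R (T ^^ n) v) = (1 / l ^ n) * q ((T ^^ n) v)"
      using that T l0 by (intro q_scale funpow_mem) auto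
    also have "\<dots> \<le> (1 / l ^ n) * (H * \<mu> ^ n * q v)"
      using H(2)[OF that(2)] l0 by (intro mult_left_mono) auto
    also have "\<dots> = (H * (\<mu> / l) ^ n) * q v" using l0 by (simp add: power_divide)
    also have "\<dots> \<le> 1 * q v"
      using N[OF that(1)] q_nonneg[OF that(2)] by (intro mult_right_mono) auto
    finally show ?thesis by simp
  qed
  then show ?thesis using that by blast
qed

lemma bound_from_unit:
  assumes scale: "\<And>y t. y \<in> E \<Longrightarrow> 0 \<le> t \<Longrightarrow> h (t *\<^sub>R y) = t * h y"
    and H: "\<And>y. y \<in> E \<Longrightarrow> q y \<le> 1 \<Longrightarrow> h y \<le> H" and y: "y \<in> E"
  shows "h y \<le> H * q y"
proof -
  have "h y \<le> H * (q y + \<eta>)" if \<eta>: "0 < \<eta>" for \<eta>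
  proof -
    define t where "t = 1 / (q y + \<eta>)"
    have t: "0 < t" using q_nonneg[OF y] \<eta> by (simp add: t_def)
    have "q (t *\<^sub>R y) \<le> 1"
      using q_scale[OF y, of t] t q_nonneg[OF y] \<eta> by (simp add: t_def)
    then have "h (t *\<^sub>R y) \<le> H" using t y by (intro H scale_mem) auto
    then have "t * h y \<le> H" using scale[OF y, of t] t by simp
    then show ?thesis using q_nonneg[OF y] \<eta> by (simp add: t_def field_simps)
  qed
  then have "((\<lambda>\<eta>. H * (q y + \<eta>)) \<longlongrightarrow> H * (q y + 0)) (at_right 0)" "\<forall>\<^sub>F \<eta> in at_right 0. h y \<le> H * (q y + \<eta>)"
    by (auto intro!: tendsto_eq_intros simp: eventually_at_right_less eventually_at_filter)
  then have "h y \<le> H * (q y + 0)" by (rule tendsto_lowerbound) simp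
  then show ?thesis by simp
qed

text \<open>
  The growth is a singular point of the resolvent, seen from the right. If all partial sums near it were bounded
  by \<open>H\<close>, their squares would be bounded by \<open>H\<^sup>2\<close>; but the square of the sum of the first \<open>n + 1\<close> terms
  contains the power \<open>T ^^ n\<close> exactly \<open>n + 1\<close> times. This makes \<open>T ^^ n\<close> smaller than \<open>r ^ n\<close> by a factor of
  order \<open>1 / n\<close>, and a single \<open>n\<close> with a factor below 1 gives a growth rate below the growth \<open>r\<close>.
\<close>
lemma neumann_blow_up:
  assumes T: "pos_map T" and r: "0 < growth T" and e: "0 < \<epsilon>"
  obtains l N y where "growth T < l" "l < growth T + \<epsilon>"
    "\<And>v. v \<in> E \<Longrightarrow> q ((1 / l ^ N) *\<^sub>R (T ^^ N) v) \<le> q v"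
    "y \<in> E" "q y \<le> 1" "H < q (neumann T l N y)"
proof (rule ccontr)
  assume neg: "\<not> thesis"
  note found = that
  let ?r = "growth T"
  define H' where "H' = max 1 H"
  have bd: "q (neumann T l N y) \<le> H'" if l: "?r < l" "l < ?r + \<epsilon>" and y: "y \<in> E" "q y \<le> 1" for l N y
  proof -
    obtain N0 where N0: "\<And>n v. N0 \<le> n \<Longrightarrow> v \<in> E \<Longrightarrow> q ((1 / l ^ n) *\<^sub>R (T ^^ n) v) \<le> q v"
      using growth_tail[OF T r l(1)] by metis
    have l0: "0 < l" using r l by simp
    have "q (neumann T l (max N N0) y) \<le> H"
    proof (rule ccontr)
      assume "\<not> ?thesis"
      then have "thesis" using l y N0[of "max N N0"] by (intro found[of l "max N N0" y]) auto
      then show False using neg by contradiction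
    qed
    moreover have "q (neumann T l N y) \<le> q (neumann T l (max N N0) y)"
      using y(1) T l0 by (intro q_mono nonneg[OF neumann_mem] neumann_mem neumann_mono) auto
    ultimately show ?thesis by (simp add: H'_def)
  qed
  have pow: "q ((T ^^ n) y) \<le> (H'^2 * l ^ (n+2) / (n+1)) * q y"
    if l: "?r < l" "l < ?r + \<epsilon>" and y: "y \<in> E" for l n y
  proof -
    have l0: "0 < l" using r l by simp
    define N where "N = Suc n"
    note S = pos_map_neumann[OF T l0, of N]
    have bdS: "q (neumann T l N v) \<le> H' * q v" if "v \<in> E" for v
    proof (rule bound_from_unit[OF _ bd[OF l] that])
      show "q (neumann T l N (t *\<^sub>R y)) = t * q (neumann T l N y)" if "y \<in> E" "0 \<le> t" for y t
        using that by (simp add: pos_map_scale[OF S] q_scale pos_map_mem[OF S])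
    qed
    have mem: "(T ^^ n) y \<in> E" using y T by (intro funpow_mem)
    have "(real N / l ^ (n+2)) *\<^sub>R (T ^^ n) y = (\<Sum>i<N. (1 / l ^ (n+2)) *\<^sub>R (T ^^ n) y)"
      by (simp add: sum_constant_scaleR del: sum_constant)
    also have "\<dots> \<le> (\<Sum>i<N. (1 / l ^ Suc i) *\<^sub>R (T ^^ i) (neumann T l N y))"
    proof (rule sum_mono)
      fix i assume i: "i \<in> {..<N}"
      then have ni: "i + (n - i) = n" by (simp add: N_def)
      have "(T ^^ i) ((1 / l ^ Suc (n - i)) *\<^sub>R (T ^^ (n - i)) y) \<le> (T ^^ i) (neumann T l N y)"
        using y T l0 i S
        by (intro pos_map_mono[OF pos_map_funpow] neumann_ge_term neumann_nonneg_term neumann_mem)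
          (auto simp: N_def)
      also have "(T ^^ i) ((1 / l ^ Suc (n - i)) *\<^sub>R (T ^^ (n - i)) y)
          = (1 / l ^ Suc (n - i)) *\<^sub>R (T ^^ i) ((T ^^ (n - i)) y)"
        using y T l0 by (intro pos_map_scale[OF pos_map_funpow] funpow_mem) auto
      also have "(T ^^ i) ((T ^^ (n - i)) y) = (T ^^ n) y"
        using funpow_add[of i "n - i" T] ni by simp
      finally have "(1 / l ^ Suc i) *\<^sub>R (1 / l ^ Suc (n - i)) *\<^sub>R (T ^^ n) y
          \<le> (1 / l ^ Suc i) *\<^sub>R (T ^^ i) (neumann T l N y)"
        using l0 by (intro scaleR_left_mono) auto
      moreover have "l ^ Suc i * l ^ Suc (n - i) = l ^ (n + 2)"
        using ni by (simp flip: power_add power_Suc)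
      ultimately show "(1 / l ^ (n+2)) *\<^sub>R (T ^^ n) y \<le> (1 / l ^ Suc i) *\<^sub>R (T ^^ i) (neumann T l N y)"
        by (simp only: scaleR_scaleR times_divide_times_eq mult_1)
    qed
    also have "\<dots> = neumann T l N (neumann T l N y)" by (simp add: neumann_def)
    finally have "q ((real N / l ^ (n+2)) *\<^sub>R (T ^^ n) y) \<le> q (neumann T l N (neumann T l N y))"
      using y mem l0 T by (intro q_mono scaleR_nonneg_nonneg nonneg[OF mem] neumann_mem) auto
    also have "\<dots> \<le> H' * (H' * q y)"
      using scaled_trans[OF _ bdS[OF y] bdS[OF pos_map_mem[OF S y]]] by (simp add: H'_def)
    finally have "(real N / l ^ (n+2)) * q ((T ^^ n) y) \<le> H'^2 * q y"
      using q_scale[OF mem, of "real N / l ^ (n+2)"] l0 by (simp add: power2_eq_square mult.assoc)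
    then show ?thesis using l0 by (simp add: N_def field_simps)
  qed
  \<comment> \<open>The bounds hold to the right of the growth; they pass to the growth by continuity.\<close>
  have pow_r: "q ((T ^^ n) y) \<le> (H'^2 * ?r ^ (n+2) / (n+1)) * q y" if y: "y \<in> E" for n y
  proof (rule tendsto_lowerbound)
    show "((\<lambda>l. (H'^2 * l ^ (n+2) / (n+1)) * q y) \<longlongrightarrow> (H'^2 * ?r ^ (n+2) / (n+1)) * q y) (at_right ?r)"
      by (intro tendsto_intros) auto
    show "\<forall>\<^sub>F l in at_right ?r. q ((T ^^ n) y) \<le> (H'^2 * l ^ (n+2) / (n+1)) * q y"
      unfolding eventually_at_right_field using pow[OF _ _ y] e by (intro exI[of _ "?r + \<epsilon>"]) auto
  qed simp
  obtain n :: nat where n: "2 * H'^2 * ?r^2 < real n" using reals_Archimedean2 by blast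
  then have n0: "0 < n" using zero_le_power2[of H'] zero_le_power2[of ?r]
    by (metis gr0I mult_nonneg_nonneg of_nat_0 not_less zero_le_numeral)
  define \<mu> where "\<mu> = ?r * root n (1/2)"
  have \<mu>: "0 < \<mu>" "\<mu> ^ n = ?r ^ n / 2"
    using n0 r by (auto simp: \<mu>_def power_mult_distrib real_root_pow_pos2)
  have "\<mu> < ?r" using r n0 real_root_less_iff[OF n0, of "1/2" 1] by (simp add: \<mu>_def)
  have "\<mu> \<in> growth_rates T"
  proof (rule growth_ratesI[OF T n0 \<mu>(1)])
    fix y assume y: "y \<in> E"
    have "H'^2 * ?r ^ (n+2) / (n+1) \<le> \<mu> ^ n"
    proof -
      have "H'^2 * ?r ^ (n+2) = (2 * H'^2 * ?r^2) * (?r ^ n / 2)" by (simp add: power_add power2_eq_square)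
      also have "\<dots> \<le> (n + 1) * (?r ^ n / 2)" using n r by (intro mult_right_mono) auto
      also have "\<dots> = \<mu> ^ n * (n + 1)" by (simp add: \<mu>(2))
      finally show ?thesis by (subst pos_divide_le_eq) auto
    qed
    then show "q ((T ^^ n) y) \<le> \<mu> ^ n * q y"
      using pow_r[OF y, of n] mult_right_mono[of _ "\<mu>^n" "q y"] q_nonneg[OF y] by fastforce
  qed
  then show False using growth_le \<open>\<mu> < ?r\<close> by fastforce
qed

text \<open>The dual norm of a positive functional, and a vector on which half of it is attained.\<close>
lemma pos_functional_bound_Sup:
  assumes g: "pos_functional g" and pos: "0 < g w" "w \<in> E"
  defines "c \<equiv> Sup {g v | v. v \<in> E \<and> q v \<le> 1}"
  shows "\<And>v. v \<in> E \<Longrightarrow> g v \<le> c * q v"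
    and "0 < c"
    and "\<exists>v\<in>E. q v \<le> 1 \<and> c / 2 \<le> g v"
proof -
  obtain M where M: "1 \<le> M" "\<And>x. x \<in> E \<Longrightarrow> g x \<le> M * q x" using pos_functional_bound[OF g] by metis
  have bdd: "bdd_above {g v | v. v \<in> E \<and> q v \<le> 1}"
  proof (rule bdd_aboveI)
    fix a assume "a \<in> {g v | v. v \<in> E \<and> q v \<le> 1}"
    then obtain v where "a = g v" "v \<in> E" "q v \<le> 1" by blast
    then show "a \<le> M" using scaled_trans[of M "q v" 1 "g v"] M(2)[of v] M(1) by simp
  qed
  have up: "g v \<le> c" if "v \<in> E" "q v \<le> 1" for v
    unfolding c_def using that by (intro cSup_upper[OF _ bdd]) auto
  show le: "g v \<le> c * q v" if "v \<in> E" for v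
    using bound_from_unit[OF pos_functional_scale[OF g] up that] .
  have "0 \<le> c" using up[OF zero_mem] q_zero pos_functional_nonneg[OF g zero_mem] by simp
  then show c: "0 < c" using le[OF pos(2)] pos(1) by (cases "c = 0") auto
  have ne: "{g v | v. v \<in> E \<and> q v \<le> 1} \<noteq> {}" using zero_mem q_zero by auto
  have "c / 2 < Sup {g v | v. v \<in> E \<and> q v \<le> 1}" using c by (simp flip: c_def)
  then obtain a where "a \<in> {g v | v. v \<in> E \<and> q v \<le> 1}" "c / 2 < a"
    using less_cSupE[OF _ ne] by blast
  then show "\<exists>v\<in>E. q v \<le> 1 \<and> c / 2 \<le> g v" by (auto intro: less_imp_le)
qed

text \<open>
  The replacement for the Krein--Rutman theorem. By \<open>neumann_blow_up\<close> there are Neumann sums \<open>S m (y m)\<close> of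
  large seminorm with \<open>y m\<close> of seminorm at most 1; normalised they are approximate eigenvectors, and
  compactness provides a limit \<open>x\<close>. Let the functional \<open>f0\<close> be positive at \<open>x\<close>. Then \<open>f0 (S m (y m))\<close> tends
  to infinity as well, so that the normalised functionals \<open>f0 \<circ> S m\<close> are approximate left eigenvectors.
  Compactness is used once more to find a single \<open>z\<close> on which they stay away from 0; it takes the place
  of a weak limit of the functionals.
\<close>
lemma peripheral_eigenvectors:
  assumes T: "pos_map T" and K: "compact_map T" and r: "0 < growth T"
    and sep: "\<And>x. x \<in> E \<Longrightarrow> 0 < q x \<Longrightarrow> \<exists>f. pos_functional f \<and> 0 < f x"
  obtains x f0 P \<Lambda> \<epsilon> z c where
    "x \<in> E" "pos_functional f0" "0 < f0 x" "\<And>f. pos_functional f \<Longrightarrow> f (T x) = growth T * f x"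
    "\<And>m. pos_functional (P m)" "\<And>m y. y \<in> E \<Longrightarrow> P m y \<le> q y"
    "\<And>m. growth T \<le> \<Lambda> m" "\<Lambda> \<longlonglongrightarrow> growth T" "(\<epsilon> :: nat \<Rightarrow> real) \<longlonglongrightarrow> 0"
    "\<And>m y. y \<in> E \<Longrightarrow> \<Lambda> m * P m y \<le> P m (T y) + \<epsilon> m * q y"
    "\<And>m y. y \<in> E \<Longrightarrow> P m (T y) \<le> \<Lambda> m * P m y + \<epsilon> m * q y"
    "z \<in> E" "0 < c" "\<And>m. c \<le> P m z"
proof -
  let ?r = "growth T"
  have "\<exists>l N y. ?r < l \<and> l < ?r + inverse (real (Suc m)) \<and>
      (\<forall>v\<in>E. q ((1 / l ^ N) *\<^sub>R (T ^^ N) v) \<le> q v) \<and> y \<in> E \<and> q y \<le> 1 \<and>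
      real (Suc m) < q (neumann T l N y)" for m
    by (rule neumann_blow_up[OF T r, of "inverse (real (Suc m))" "real (Suc m)"]) auto
  then obtain l N y where l: "\<And>m. ?r < l m" "\<And>m. l m < ?r + inverse (real (Suc m))"
    and tail: "\<And>m v. v \<in> E \<Longrightarrow> q ((1 / l m ^ N m) *\<^sub>R (T ^^ N m) v) \<le> q v"
    and y: "\<And>m. y m \<in> E" "\<And>m. q (y m) \<le> 1"
    and big: "\<And>m. real (Suc m) < q (neumann T (l m) (N m) (y m))"
    by metis
  have l0: "0 < l m" for m using l(1)[of m] r by linarith
  define S where "S m = neumann T (l m) (N m)" for m
  define R where "R m v = (1 / l m ^ N m) *\<^sub>R (T ^^ N m) v" for m v
  define t where "t m = q (S m (y m))" for m
  define X where "X m = (1 / t m) *\<^sub>R S m (y m)" for m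
  have S: "pos_map (S m)" for m unfolding S_def using pos_map_neumann[OF T l0] .
  have R_mem: "R m v \<in> E" if "v \<in> E" for m v
    unfolding R_def using that T l0[of m] by (intro scale_mem funpow_mem) auto
  have qR: "q (R m v) \<le> q v" if "v \<in> E" for m v unfolding R_def using tail[OF that] .
  have t: "real (Suc m) < t m" for m using big by (simp add: t_def S_def)
  have t0: "0 < t m" for m using t[of m] by linarith
  have Sy: "S m (y m) \<in> E" for m using pos_map_mem[OF S y(1)] .
  have X: "X m \<in> E" for m unfolding X_def using Sy[of m] t0[of m] by (intro scale_mem) auto
  have qX: "q (X m) = 1" for m
    unfolding X_def using q_scale[OF Sy, of "1 / t m" m] t0[of m] by (simp add: t_def)
  have shift: "S m (T v) + v = l m *\<^sub>R S m v + R m v" for m v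
    unfolding S_def R_def by (rule neumann_shift[OF l0])
  have comm: "T (S m v) = S m (T v)" if "v \<in> E" for m v
    unfolding S_def by (rule neumann_commute[OF T l0 that])
  have TX: "T (X m) + (1 / t m) *\<^sub>R y m = l m *\<^sub>R X m + (1 / t m) *\<^sub>R R m (y m)" for m
  proof -
    have "T (X m) = (1 / t m) *\<^sub>R T (S m (y m))"
      unfolding X_def using pos_map_scale[OF T Sy, of "1 / t m" m] t0[of m] by simp
    then have "T (X m) + (1 / t m) *\<^sub>R y m = (1 / t m) *\<^sub>R (S m (T (y m)) + y m)"
      by (simp add: comm[OF y(1)] scaleR_add_right)
    also have "\<dots> = l m *\<^sub>R X m + (1 / t m) *\<^sub>R R m (y m)"
      unfolding shift X_def by (simp add: scaleR_add_right mult.commute)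
    finally show ?thesis .
  qed
  have llim: "l \<longlonglongrightarrow> ?r"
  proof (rule tendsto_sandwich[of "\<lambda>_. ?r" _ _ "\<lambda>m. ?r + inverse (real (Suc m))"])
    show "(\<lambda>m. ?r + inverse (real (Suc m))) \<longlonglongrightarrow> ?r"
      using tendsto_add[OF tendsto_const LIMSEQ_inverse_real_of_nat, of ?r] by simp
  qed (use l in \<open>auto intro: always_eventually less_imp_le\<close>)
  have tlim: "(\<lambda>m. 1 / t m) \<longlonglongrightarrow> 0"
  proof (rule tendsto_sandwich[of "\<lambda>_. 0" _ _ "\<lambda>m. inverse (real (Suc m))"])
    show "\<forall>\<^sub>F m in sequentially. 1 / t m \<le> inverse (real (Suc m))"
      using t by (intro always_eventually allI) (simp add: divide_inverse le_imp_inverse_le less_imp_le)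
    show "\<forall>\<^sub>F m in sequentially. 0 \<le> 1 / t m" using t0 by (simp add: less_imp_le)
    show "(\<lambda>m. inverse (real (Suc m))) \<longlonglongrightarrow> 0" by (rule LIMSEQ_inverse_real_of_nat)
  qed simp
  have diff: "(\<lambda>m. f (T (X m)) - l m * f (X m)) \<longlonglongrightarrow> 0" if f: "pos_functional f" for f
  proof -
    obtain M where M: "1 \<le> M" "\<And>x. x \<in> E \<Longrightarrow> f x \<le> M * q x" using pos_functional_bound[OF f] by metis
    have nb: "norm (f (T (X m)) - l m * f (X m)) \<le> M * (1 / t m)" for m
    proof -
      have fb: "0 \<le> f v \<and> f v \<le> M" if "v \<in> E" "q v \<le> 1" for v
        using scaled_trans[OF _ that(2) M(2)[OF that(1)]] M(1) pos_functional_nonneg[OF f that(1)] by simp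
      have "f (T (X m)) + (1 / t m) * f (y m) = f (T (X m) + (1 / t m) *\<^sub>R y m)"
        using f X[of m] T y(1)[of m] t0[of m]
        by (simp add: pos_functional_add pos_functional_scale pos_map_mem scale_mem)
      also have "\<dots> = l m * f (X m) + (1 / t m) * f (R m (y m))"
        unfolding TX using f X[of m] T R_mem[OF y(1)[of m], of m] t0[of m] l0[of m]
        by (simp add: pos_functional_add pos_functional_scale scale_mem)
      finally have e: "f (T (X m)) - l m * f (X m) = (f (R m (y m)) - f (y m)) * (1 / t m)"
        by (simp add: algebra_simps)
      have "\<bar>f (R m (y m)) - f (y m)\<bar> \<le> M"
        using fb[OF y] fb[OF R_mem[OF y(1)] order_trans[OF qR[OF y(1)] y(2)]] by (simp add: abs_le_iff) (smt (verit))
      then show ?thesis unfolding e using t0[of m] by (simp add: abs_mult divide_right_mono)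
    qed
    show ?thesis
      by (rule Lim_null_comparison[OF always_eventually[OF allI[OF nb]] tendsto_mult_right_zero[OF tlim]])
  qed
  obtain \<sigma> x u where \<sigma>: "strict_mono (\<sigma> :: nat \<Rightarrow> nat)" and x: "x \<in> E"
    and u: "\<And>m. u m \<in> E" "\<And>m. T (X (\<sigma> m)) \<le> x + u m" "\<And>m. x \<le> T (X (\<sigma> m)) + u m"
    and ulim: "(\<lambda>m. q (u m)) \<longlonglongrightarrow> 0"
    using K X qX unfolding compact_map_def by (metis order_refl)
  have TXmem: "T (X m) \<in> E" for m using pos_map_mem[OF T X] .
  have lims: "(\<lambda>m. f (T (X (\<sigma> m)))) \<longlonglongrightarrow> f x" if f: "pos_functional f" for f
  proof -
    obtain M where M: "1 \<le> M" "\<And>x. x \<in> E \<Longrightarrow> f x \<le> M * q x" using pos_functional_bound[OF f] by metis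
    have nb: "norm (f (T (X (\<sigma> m))) - f x) \<le> M * q (u m)" for m
    proof -
      have "f (T (X (\<sigma> m))) \<le> f (x + u m)" "f x \<le> f (T (X (\<sigma> m)) + u m)"
        using f x u TXmem by (auto intro!: pos_functional_mono add_mem nonneg)
      then show ?thesis
        using M(2)[OF u(1), of m] by (simp add: pos_functional_add[OF f] x u(1) TXmem abs_le_iff)
    qed
    have "(\<lambda>m. f (T (X (\<sigma> m))) - f x) \<longlonglongrightarrow> 0"
      by (rule Lim_null_comparison[OF always_eventually[OF allI[OF nb]] tendsto_mult_right_zero[OF ulim]])
    then show ?thesis by (simp add: LIM_zero_iff)
  qed
  have lsub: "(\<lambda>m. l (\<sigma> m)) \<longlonglongrightarrow> ?r" using LIMSEQ_subseq_LIMSEQ[OF llim \<sigma>] by (simp add: o_def)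
  have limX: "(\<lambda>m. f (X (\<sigma> m))) \<longlonglongrightarrow> f x / ?r" if f: "pos_functional f" for f
  proof -
    have "(\<lambda>m. f (T (X (\<sigma> m))) - l (\<sigma> m) * f (X (\<sigma> m))) \<longlonglongrightarrow> 0"
      using LIMSEQ_subseq_LIMSEQ[OF diff[OF f] \<sigma>] by (simp add: o_def)
    from tendsto_diff[OF lims[OF f] this]
    have "(\<lambda>m. l (\<sigma> m) * f (X (\<sigma> m))) \<longlonglongrightarrow> f x" by simp
    from tendsto_divide[OF this lsub] r
    have "(\<lambda>m. l (\<sigma> m) * f (X (\<sigma> m)) / l (\<sigma> m)) \<longlonglongrightarrow> f x / ?r" by simp
    then show ?thesis using l0 by (simp add: less_imp_neq[symmetric])
  qed
  have eig: "f (T x) = ?r * f x" if f: "pos_functional f" for f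
    using LIMSEQ_unique[OF lims[OF f] limX[OF pos_functional_comp[OF f T]]] r
    by (simp add: field_simps)
  \<comment> \<open>The limit is not null: the approximate eigenvectors have seminorm 1, and \<open>T\<close> nearly multiplies them by \<open>?r\<close>.\<close>
  have "?r \<le> q x"
  proof -
    have "l m \<le> q (T (X m)) + 1 / t m" for m
    proof -
      have "l m *\<^sub>R X m \<le> T (X m) + (1 / t m) *\<^sub>R y m"
        unfolding TX using nonneg[OF R_mem[OF y(1)]] t0[of m] by (simp add: scaleR_nonneg_nonneg)
      then have "q (l m *\<^sub>R X m) \<le> q (T (X m) + (1 / t m) *\<^sub>R y m)"
        using TXmem y(1) t0[of m] l0[of m] nonneg[OF X, of m]
        by (intro q_mono add_mem scale_mem scaleR_nonneg_nonneg) (auto simp: less_imp_le)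
      also have "\<dots> \<le> q (T (X m)) + q ((1 / t m) *\<^sub>R y m)"
        using TXmem y(1) t0[of m] by (intro q_add scale_mem) auto
      also have "q ((1 / t m) *\<^sub>R y m) \<le> 1 / t m"
        using q_scale[OF y(1), of "1 / t m" m] y(2)[of m] t0[of m] by (simp add: divide_right_mono)
      finally show ?thesis using q_scale[OF X, of "l m" m] qX[of m] l0[of m] by simp
    qed
    moreover have "q (T (X (\<sigma> m))) \<le> q x + q (u m)" for m
      using q_mono[OF add_mem[OF x u(1)] nonneg[OF TXmem] u(2), of m] q_add[OF x u(1), of m] by linarith
    ultimately have le: "l (\<sigma> m) \<le> q x + q (u m) + 1 / t (\<sigma> m)" for m
      by (meson add_mono_thms_linordered_semiring(3) order_trans)
    have "(\<lambda>m. 1 / t (\<sigma> m)) \<longlonglongrightarrow> 0"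
      using LIMSEQ_subseq_LIMSEQ[OF tlim \<sigma>] by (simp add: o_def)
    then have "(\<lambda>m. q x + q (u m) + 1 / t (\<sigma> m)) \<longlonglongrightarrow> q x + 0 + 0"
      by (intro tendsto_add ulim tendsto_const)
    then show ?thesis using LIMSEQ_le[OF lsub] le by auto
  qed
  then obtain f0 where f0: "pos_functional f0" "0 < f0 x" using sep[OF x] r by force
  define \<eta> where "\<eta> = f0 x / ?r / 2"
  have \<eta>: "0 < \<eta>" using f0 r by (simp add: \<eta>_def)
  have "\<eta> < f0 x / ?r" using f0(2) r by (simp add: \<eta>_def field_simps)
  then have "\<forall>\<^sub>F m in sequentially. \<eta> < f0 (X (\<sigma> m))"
    by (rule order_tendstoD(1)[OF limX[OF f0(1)]])
  then obtain m0 where m0: "\<And>m. m0 \<le> m \<Longrightarrow> \<eta> < f0 (X (\<sigma> m))" by (auto simp: eventually_sequentially)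
  define \<rho> where "\<rho> m = \<sigma> (m + m0)" for m
  have \<rho>: "strict_mono \<rho>" using \<sigma> by (auto simp: \<rho>_def strict_mono_def)
  define g where "g m v = f0 (S (\<rho> m) v)" for m v
  have g: "pos_functional (g m)" for m unfolding g_def by (rule pos_functional_comp[OF f0(1) S])
  have gy: "real (Suc m) * \<eta> \<le> g m (y (\<rho> m))" for m
  proof -
    have "g m (y (\<rho> m)) = t (\<rho> m) * f0 (X (\<rho> m))"
      using pos_functional_scale[OF f0(1) Sy, of "1 / t (\<rho> m)" "\<rho> m"] t0[of "\<rho> m"]
      by (simp add: g_def X_def)
    moreover have "real (Suc m) \<le> t (\<rho> m)"
      using t[of "\<rho> m"] seq_suble[OF \<rho>, of m] by linarith
    moreover have "\<eta> \<le> f0 (X (\<rho> m))" using m0[of "m + m0"] by (simp add: \<rho>_def less_imp_le)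
    ultimately show ?thesis using \<eta> t0[of "\<rho> m"] by (simp only:) (intro mult_mono; simp)
  qed
  have gy0: "0 < g m (y (\<rho> m))" for m
    using gy[of m] mult_pos_pos[OF _ \<eta>, of "real (Suc m)"] by linarith
  \<comment> \<open>The dual norms of the functionals \<open>f0 \<circ> S m\<close>, which tend to infinity.\<close>
  define c where "c m = Sup {g m v | v. v \<in> E \<and> q v \<le> 1}" for m
  have c: "\<And>m v. v \<in> E \<Longrightarrow> g m v \<le> c m * q v" "\<And>m. 0 < c m"
    "\<And>m. \<exists>v\<in>E. q v \<le> 1 \<and> c m / 2 \<le> g m v"
    unfolding c_def using pos_functional_bound_Sup[OF g gy0 y(1)] by blast+
  have c_big: "real (Suc m) * \<eta> \<le> c m" for m
    using gy[of m] c(2)[of m] scaled_trans[OF _ y(2) c(1)[OF y(1)], of m "\<rho> m"]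
    by linarith
  obtain v where v: "\<And>m. v m \<in> E" "\<And>m. q (v m) \<le> 1" "\<And>m. c m / 2 \<le> g m (v m)"
    using c(3) by metis
  define P where "P m w = (1 / c m) * g m w" for m w
  have P: "pos_functional (P m)" for m
    unfolding P_def using c(2)[of m] by (intro pos_functional_times g) auto
  have Pq: "P m w \<le> q w" if "w \<in> E" for m w
    using c(1)[OF that, of m] c(2)[of m] by (simp add: P_def field_simps)
  obtain M where M: "1 \<le> M" "\<And>x. x \<in> E \<Longrightarrow> f0 x \<le> M * q x"
    using pos_functional_bound[OF f0(1)] by metis
  define \<epsilon> where "\<epsilon> m = M / c m" for m
  have \<epsilon>: "\<epsilon> \<longlonglongrightarrow> 0"
  proof (rule tendsto_sandwich[of "\<lambda>_. 0" _ _ "\<lambda>m. (M / \<eta>) * inverse (real (Suc m))"])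
    have "\<epsilon> m \<le> (M / \<eta>) * inverse (real (Suc m))" for m
    proof -
      have "M / c m \<le> M / (real (Suc m) * \<eta>)"
        using c_big[of m] c(2)[of m] \<eta> M(1) by (intro divide_left_mono mult_pos_pos) auto
      then show ?thesis by (simp add: \<epsilon>_def divide_inverse mult.assoc mult.commute)
    qed
    then show "\<forall>\<^sub>F m in sequentially. \<epsilon> m \<le> (M / \<eta>) * inverse (real (Suc m))" by simp
    show "\<forall>\<^sub>F m in sequentially. 0 \<le> \<epsilon> m" using c(2) M(1) by (simp add: \<epsilon>_def less_imp_le)
    show "(\<lambda>m. (M / \<eta>) * inverse (real (Suc m))) \<longlonglongrightarrow> 0"
      using tendsto_mult[OF tendsto_const LIMSEQ_inverse_real_of_nat, of "M / \<eta>"] by simp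
  qed simp
  have PT: "P m (T w) + f0 w / c m = l (\<rho> m) * P m w + f0 (R (\<rho> m) w) / c m" if w: "w \<in> E" for m w
  proof -
    have "g m (T w) + f0 w = f0 (S (\<rho> m) (T w) + w)"
      using pos_functional_add[OF f0(1)] w pos_map_mem[OF S pos_map_mem[OF T w]] by (simp add: g_def)
    also have "\<dots> = l (\<rho> m) * g m w + f0 (R (\<rho> m) w)"
      unfolding shift g_def using f0(1) R_mem[OF w] pos_map_mem[OF S w] l0[of "\<rho> m"]
      by (simp add: pos_functional_add pos_functional_scale scale_mem)
    finally have "(g m (T w) + f0 w) / c m = (l (\<rho> m) * g m w + f0 (R (\<rho> m) w)) / c m" by simp
    then show ?thesis by (simp add: P_def add_divide_distrib)
  qed
  have f0b: "0 \<le> f0 w / c m" "f0 w / c m \<le> \<epsilon> m * q w" if "w \<in> E" for m w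
    using pos_functional_nonneg[OF f0(1) that] M(2)[OF that] c(2)[of m]
    by (auto simp: \<epsilon>_def divide_right_mono)
  have f0R: "f0 (R k w) / c m \<le> \<epsilon> m * q w" if "w \<in> E" for k m w
  proof -
    have "\<epsilon> m * q (R k w) \<le> \<epsilon> m * q w"
      using qR[OF that] M(1) c(2)[of m] by (intro mult_left_mono) (auto simp: \<epsilon>_def)
    then show ?thesis using f0b(2)[OF R_mem[OF that]] by (rule order_trans[rotated])
  qed
  have PT1: "l (\<rho> m) * P m w \<le> P m (T w) + \<epsilon> m * q w" if w: "w \<in> E" for m w
    using PT[OF w, of m] f0b(2)[OF w, of m] f0b(1)[OF R_mem[OF w], of "\<rho> m" m] by linarith
  have PT2: "P m (T w) \<le> l (\<rho> m) * P m w + \<epsilon> m * q w" if w: "w \<in> E" for m w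
    using PT[OF w, of m] f0b(1)[OF w, of m] f0R[OF w, of "\<rho> m" m] by linarith
  obtain \<tau> z w where \<tau>: "strict_mono (\<tau> :: nat \<Rightarrow> nat)" and z: "z \<in> E"
    and w: "\<And>m. w m \<in> E" "\<And>m. T (v (\<tau> m)) \<le> z + w m" and wlim: "(\<lambda>m. q (w m)) \<longlonglongrightarrow> 0"
    using K v(1,2) unfolding compact_map_def by metis
  have \<epsilon>\<tau>: "(\<lambda>m. \<epsilon> (\<tau> m)) \<longlonglongrightarrow> 0" using LIMSEQ_subseq_LIMSEQ[OF \<epsilon> \<tau>] by (simp add: o_def)
  have low: "?r / 2 - \<epsilon> (\<tau> m) - q (w m) \<le> P (\<tau> m) z" for m
  proof -
    let ?k = "\<tau> m"
    have "1 / 2 \<le> P ?k (v ?k)" using v(3)[of ?k] c(2)[of ?k] by (simp add: P_def field_simps)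
    then have "?r / 2 \<le> l (\<rho> ?k) * P ?k (v ?k)"
      using l(1)[of "\<rho> ?k"] r mult_mono[of ?r "l (\<rho> ?k)" "1/2" "P ?k (v ?k)"] l0[of "\<rho> ?k"] by simp
    moreover have "\<epsilon> ?k * q (v ?k) \<le> \<epsilon> ?k"
      using v(2)[of ?k] M(1) c(2)[of ?k] mult_left_mono[OF v(2), of "\<epsilon> ?k" ?k] by (simp add: \<epsilon>_def)
    moreover have "P ?k (T (v ?k)) \<le> P ?k z + P ?k (w m)"
      using pos_functional_mono[OF P add_mem[OF z w(1)] nonneg[OF pos_map_mem[OF T v(1)]] w(2)]
        pos_functional_add[OF P z w(1)] by simp
    ultimately show ?thesis using PT1[OF v(1), of ?k ?k] Pq[OF w(1), of ?k m] by linarith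
  qed
  have "(\<lambda>m. ?r / 2 - \<epsilon> (\<tau> m) - q (w m)) \<longlonglongrightarrow> ?r / 2 - 0 - 0"
    by (intro tendsto_diff tendsto_const \<epsilon>\<tau> wlim)
  then have "\<forall>\<^sub>F m in sequentially. ?r / 4 < ?r / 2 - \<epsilon> (\<tau> m) - q (w m)"
    using r by (intro order_tendstoD(1)) auto
  then obtain m1 where m1: "\<And>m. m1 \<le> m \<Longrightarrow> ?r / 4 < ?r / 2 - \<epsilon> (\<tau> m) - q (w m)"
    by (auto simp: eventually_sequentially)
  define k where "k m = \<tau> (m + m1)" for m
  have k: "strict_mono k" using \<tau> by (auto simp: k_def strict_mono_def)
  show thesis
  proof (rule that[of x f0 "\<lambda>m. P (k m)" "\<lambda>m. l (\<rho> (k m))" "\<lambda>m. \<epsilon> (k m)" z "?r / 4"])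
    show "(\<lambda>m. l (\<rho> (k m))) \<longlonglongrightarrow> ?r"
      using LIMSEQ_subseq_LIMSEQ[OF llim strict_mono_o[OF \<rho> k]] by (simp add: o_def)
    show "(\<lambda>m. \<epsilon> (k m)) \<longlonglongrightarrow> 0" using LIMSEQ_subseq_LIMSEQ[OF \<epsilon> k] by (simp add: o_def)
    show "?r / 4 \<le> P (k m) z" for m
      using low[of "m + m1"] m1[of "m + m1"] by (simp add: k_def)
  qed (use x f0 eig P Pq l(1) PT1 PT2 z r in \<open>auto simp: less_imp_le\<close>)
qed

end

section \<open>Positive commutators on a cone with irreducible action\<close>

context riesz_cone
begin

lemma pos_map_mono_mem:
  "pos_map T \<Longrightarrow> x \<in> E \<Longrightarrow> y \<in> E \<Longrightarrow> x \<le> y \<Longrightarrow> T x \<le> T y"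
  using pos_map_mono nonneg by blast

lemma pos_functional_mono_mem:
  "pos_functional f \<Longrightarrow> x \<in> E \<Longrightarrow> y \<in> E \<Longrightarrow> x \<le> y \<Longrightarrow> f x \<le> f y"
  using pos_functional_mono nonneg by blast

lemma pos_functional_diff:
  assumes f: "pos_functional f" and g: "pos_functional g" and le: "\<And>x. x \<in> E \<Longrightarrow> g x \<le> f x"
  shows "pos_functional (\<lambda>x. f x - g x)"
proof -
  obtain M where M: "1 \<le> M" "\<And>x. x \<in> E \<Longrightarrow> f x \<le> M * q x" using pos_functional_bound[OF f] by metis
  have "f x - g x \<le> M * q x" if "x \<in> E" for x
    using M(2)[OF that] pos_functional_nonneg[OF g that] by linarith
  then show ?thesis using f g le
    by (auto simp: pos_functional_def algebra_simps intro!: exI[of _ M])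
qed

lemma pos_functional_eigen_funpow:
  assumes T: "pos_map T" and eig: "\<And>f. pos_functional f \<Longrightarrow> f (T x) = r * f x"
    and f: "pos_functional f"
  shows "f ((T ^^ n) x) = r ^ n * f x"
proof (induction n)
  case (Suc n)
  have "f ((T ^^ Suc n) x) = f ((T ^^ n) (T x))" by (simp add: funpow_swap1)
  also have "\<dots> = r * f ((T ^^ n) x)"
    by (rule eig[OF pos_functional_comp[OF f pos_map_funpow[OF T]]])
  finally show ?case using Suc by simp
qed simp

text \<open>
  A cycle of \<open>C\<close> through \<open>e\<close> makes the powers of \<open>C\<close> geometrically large on \<open>e\<close>. A map \<open>T\<close> that controls these
  powers, up to a geometric factor of rate \<open>M\<close>, therefore cannot have arbitrarily small growth rates.
\<close>
lemma growth_positive_if_cycle: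
  assumes C: "pos_map C" and e: "e \<in> E" and qe: "0 < q e"
    and n: "0 < n" and \<delta>: "0 < \<delta>" and cycle: "\<delta> *\<^sub>R e \<le> (C ^^ n) e"
    and T: "pos_map T" and M: "1 \<le> M"
    and le: "\<And>H l k. 0 < l \<Longrightarrow> (\<And>n y. y \<in> E \<Longrightarrow> q ((T ^^ n) y) \<le> H * l ^ n * q y) \<Longrightarrow>
       q ((C ^^ k) e) \<le> H * l ^ k * M ^ k * q e"
  shows "0 < growth T"
proof -
  note Cn = pos_map_funpow[OF C]
  have pw: "\<delta> ^ s *\<^sub>R e \<le> (C ^^ (n * s)) e" for s
  proof (induction s)
    case (Suc s)
    have "\<delta> ^ Suc s *\<^sub>R e = \<delta> ^ s *\<^sub>R \<delta> *\<^sub>R e" by (simp add: mult.commute)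
    also have "\<dots> \<le> \<delta> ^ s *\<^sub>R (C ^^ n) e" using cycle \<delta> by (intro scaleR_left_mono) auto
    also have "\<dots> = (C ^^ n) (\<delta> ^ s *\<^sub>R e)" using pos_map_scale[OF Cn e] \<delta> by simp
    also have "\<dots> \<le> (C ^^ n) ((C ^^ (n * s)) e)"
      using Suc e \<delta> by (intro pos_map_mono_mem[OF Cn] funpow_mem[OF C] scale_mem) auto
    finally show ?case by (simp add: funpow_add)
  qed simp
  define \<rho> where "\<rho> = min 1 \<delta> / M"
  have \<rho>: "0 < \<rho>" using \<delta> M by (simp add: \<rho>_def)
  have "\<rho> \<le> l" if l: "l \<in> growth_rates T" for l
  proof (rule ccontr)
    assume "\<not> \<rho> \<le> l"
    obtain H where l0: "0 < l" and H: "\<And>n y. y \<in> E \<Longrightarrow> q ((T ^^ n) y) \<le> H * l ^ n * q y"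
      using l by (auto simp: growth_rates_def)
    have Ml: "0 < M * l" "M * l < min 1 \<delta>"
      using l0 M \<open>\<not> \<rho> \<le> l\<close> by (auto simp: \<rho>_def field_simps)
    have "(M * l) ^ n < min 1 \<delta> ^ n" using Ml n by (intro power_strict_mono) auto
    also have "\<dots> \<le> min 1 \<delta> ^ 1" using n \<delta> by (intro power_decreasing) auto
    finally have lt: "(M * l) ^ n < \<delta>" by simp
    have "(\<delta> / (M * l) ^ n) ^ s \<le> H" for s
    proof -
      have "\<delta> ^ s * q e = q (\<delta> ^ s *\<^sub>R e)" using q_scale[OF e] \<delta> by simp
      also have "\<dots> \<le> q ((C ^^ (n * s)) e)"
        using pw e \<delta> by (intro q_mono funpow_mem[OF C] scaleR_nonneg_nonneg nonneg[OF e]) auto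
      also have "\<dots> \<le> H * l ^ (n * s) * M ^ (n * s) * q e" using le[OF l0 H] .
      finally have "\<delta> ^ s \<le> H * ((M * l) ^ n) ^ s"
        using qe by (simp add: power_mult_distrib power_mult mult_ac)
      moreover have "0 < ((M * l) ^ n) ^ s" using Ml by simp
      ultimately show ?thesis unfolding power_divide by (subst pos_divide_le_eq) auto
    qed
    moreover have "1 < \<delta> / (M * l) ^ n" using lt Ml by simp
    ultimately show False using real_arch_pow[of "\<delta> / (M * l) ^ n" H] by (meson not_less)
  qed
  moreover have "growth_rates T \<noteq> {}"
  proof -
    obtain K where "1 \<le> K" "\<And>x. x \<in> E \<Longrightarrow> q (T x) \<le> K * q x" using pos_map_bound[OF T] by metis
    then have "K \<in> growth_rates T" by (intro growth_ratesI[OF T, of 1]) auto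
    then show ?thesis by blast
  qed
  ultimately have "\<rho> \<le> growth T" unfolding growth_def by (intro cInf_greatest) auto
  then show ?thesis using \<rho> by linarith
qed

end

lemma null_sandwich:
  fixes f g :: "nat \<Rightarrow> real"
  assumes "\<And>m. 0 \<le> f m" "\<And>m. f m \<le> g m" "g \<longlonglongrightarrow> 0"
  shows "f \<longlonglongrightarrow> 0"
  using assms by (intro tendsto_sandwich[of "\<lambda>_. 0" f _ g]) auto

lemma null_sandwich_scaled:
  fixes f g :: "nat \<Rightarrow> real"
  assumes "0 < \<kappa>" "\<And>m. 0 \<le> f m" "\<And>m. \<kappa> * f m \<le> g m" "g \<longlonglongrightarrow> 0"
  shows "f \<longlonglongrightarrow> 0"
proof (rule null_sandwich[of f "\<lambda>m. (1 / \<kappa>) * g m"])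
  show "f m \<le> (1 / \<kappa>) * g m" for m using assms(1,3) by (simp add: field_simps)
  show "(\<lambda>m. (1 / \<kappa>) * g m) \<longlonglongrightarrow> 0" by (rule tendsto_mult_right_zero[OF assms(4)])
qed (rule assms(2))

text \<open>
  Modelled on a unit sequence \<open>e\<close> and the corresponding coordinate \<open>\<phi>\<close>. The commutator is written as a sum
  because cones are not closed under differences.
\<close>
locale positive_commutator = riesz_cone E q
  for E :: "'a::ordered_real_vector set" and q :: "'a \<Rightarrow> real" +
  fixes A B C :: "'a \<Rightarrow> 'a" and e :: 'a and \<phi> :: "'a \<Rightarrow> real"
  assumes A: "pos_map A" and B: "pos_map B" and C: "pos_map C"
    and commutator: "y \<in> E \<Longrightarrow> A (B y) = B (A y) + C y"
    and e: "e \<in> E" and \<phi>: "pos_functional \<phi>" and \<phi>_e: "\<phi> e = 1"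
    and atom: "y \<in> E \<Longrightarrow> \<phi> y *\<^sub>R e \<le> y"
begin

lemma A_mem: "y \<in> E \<Longrightarrow> A y \<in> E" and B_mem: "y \<in> E \<Longrightarrow> B y \<in> E" and C_mem: "y \<in> E \<Longrightarrow> C y \<in> E"
  and An_mem: "y \<in> E \<Longrightarrow> (A ^^ n) y \<in> E" and Bn_mem: "y \<in> E \<Longrightarrow> (B ^^ n) y \<in> E"
  and Cn_mem: "y \<in> E \<Longrightarrow> (C ^^ n) y \<in> E"
  using A B C pos_map_mem funpow_mem by blast+

lemmas mem = A_mem B_mem C_mem An_mem Bn_mem Cn_mem

lemmas An = pos_map_funpow[OF A] and Bn = pos_map_funpow[OF B] and Cn = pos_map_funpow[OF C]

lemma BA_le: "y \<in> E \<Longrightarrow> B (A y) \<le> A (B y)"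
  using commutator nonneg[OF C_mem] by simp

lemma C_le: "y \<in> E \<Longrightarrow> C y \<le> A (B y)"
  using commutator nonneg[OF B_mem[OF A_mem]] by simp

lemma B_An_le: "y \<in> E \<Longrightarrow> B ((A ^^ a) y) \<le> (A ^^ a) (B y)"
proof (induction a)
  case (Suc a)
  have "B (A ((A ^^ a) y)) \<le> A (B ((A ^^ a) y))" using Suc by (intro BA_le mem)
  also have "\<dots> \<le> A ((A ^^ a) (B y))" using Suc by (intro pos_map_mono_mem[OF A] mem) auto
  finally show ?case by simp
qed simp

lemma Bn_An_le: "y \<in> E \<Longrightarrow> (B ^^ b) ((A ^^ a) y) \<le> (A ^^ a) ((B ^^ b) y)"
proof (induction b)
  case (Suc b)
  have "B ((B ^^ b) ((A ^^ a) y)) \<le> B ((A ^^ a) ((B ^^ b) y))"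
    using Suc by (intro pos_map_mono_mem[OF B] mem) auto
  also have "\<dots> \<le> (A ^^ a) (B ((B ^^ b) y))" using Suc by (intro B_An_le mem)
  finally show ?case by simp
qed simp

lemma Bn_A_le: "y \<in> E \<Longrightarrow> (B ^^ b) (A y) \<le> A ((B ^^ b) y)"
  using Bn_An_le[of y b 1] by simp

text \<open>Replace each \<open>C\<close> by the larger \<open>A B\<close>; as \<open>B A \<le> A B\<close>, moving the letters \<open>A\<close> to the left enlarges the word further.\<close>
lemma Cn_le: "y \<in> E \<Longrightarrow> (C ^^ n) y \<le> (A ^^ n) ((B ^^ n) y)"
proof (induction n)
  case (Suc n)
  have "C ((C ^^ n) y) \<le> A (B ((C ^^ n) y))" using Suc by (intro C_le mem)
  also have "\<dots> \<le> A (B ((A ^^ n) ((B ^^ n) y)))"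
    using Suc by (intro pos_map_mono_mem[OF A] pos_map_mono_mem[OF B] mem) auto
  also have "\<dots> \<le> A ((A ^^ n) (B ((B ^^ n) y)))"
    using Suc by (intro pos_map_mono_mem[OF A] B_An_le mem) auto
  finally show ?case by simp
qed simp

end

text \<open>
  Irreducibility, in the two halves that the argument needs: what is not null is visible to \<open>\<phi>\<close> under some
  word, and every element is reached from \<open>e\<close>. Words of the form \<open>A^a B^b\<close> suffice, because all others
  are dominated by them.
\<close>
locale irreducible_commutator = positive_commutator E q A B C e \<phi>
  for E :: "'a::ordered_real_vector set" and q A B C e \<phi> +
  assumes separating: "x \<in> E \<Longrightarrow> 0 < q x \<Longrightarrow> \<exists>a b. 0 < \<phi> ((A ^^ a) ((B ^^ b) x))"
    and generated: "\<And>Q z. \<lbrakk>Q e; \<And>y. y \<in> E \<Longrightarrow> Q y \<Longrightarrow> Q (A y); \<And>y. y \<in> E \<Longrightarrow> Q y \<Longrightarrow> Q (B y);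
        \<And>y y'. y \<in> E \<Longrightarrow> y' \<in> E \<Longrightarrow> Q y \<Longrightarrow> Q y' \<Longrightarrow> Q (y + y');
        \<And>y t. y \<in> E \<Longrightarrow> 0 \<le> t \<Longrightarrow> Q y \<Longrightarrow> Q (t *\<^sub>R y);
        \<And>y. y \<in> E \<Longrightarrow> (\<And>\<eta>. 0 < \<eta> \<Longrightarrow> \<exists>y'\<in>E. \<exists>u\<in>E. Q y' \<and> y \<le> y' + u \<and> q u < \<eta>) \<Longrightarrow> Q y;
        z \<in> E\<rbrakk> \<Longrightarrow> Q z"
begin

lemma separating_functional:
  assumes "x \<in> E" "0 < q x"
  shows "\<exists>f. pos_functional f \<and> 0 < f x"
proof -
  obtain a b where "0 < \<phi> ((A ^^ a) ((B ^^ b) x))" using separating assms by blast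
  then show ?thesis
    using pos_functional_comp[OF pos_functional_comp[OF \<phi> An] Bn, of a b] by blast
qed

lemma q_pos: "pos_functional f \<Longrightarrow> x \<in> E \<Longrightarrow> 0 < f x \<Longrightarrow> 0 < q x"
  using pos_functional_bound[of f] by (metis mult_eq_0_iff not_less order_less_le q_nonneg)

lemma growth_positive:
  assumes n: "0 < n" and \<delta>: "0 < \<delta>" and cycle: "\<delta> *\<^sub>R e \<le> (C ^^ n) e"
    and T: "pos_map T" and M: "1 \<le> M"
    and le: "\<And>H l k. 0 < l \<Longrightarrow> (\<And>n y. y \<in> E \<Longrightarrow> q ((T ^^ n) y) \<le> H * l ^ n * q y) \<Longrightarrow>
       q ((A ^^ k) ((B ^^ k) e)) \<le> H * l ^ k * M ^ k * q e"
  shows "0 < growth T"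
proof (rule growth_positive_if_cycle[OF C e q_pos[OF \<phi> e] n \<delta> cycle T M])
  show "0 < \<phi> e" using \<phi>_e by simp
  show "q ((C ^^ k) e) \<le> H * l ^ k * M ^ k * q e"
    if "0 < l" "\<And>n y. y \<in> E \<Longrightarrow> q ((T ^^ n) y) \<le> H * l ^ n * q y" for H l k
    using order_trans[OF q_mono[OF An_mem[OF Bn_mem[OF e]] nonneg[OF Cn_mem[OF e]] Cn_le[OF e]] le[OF that]] .
qed

lemma growth_B_positive:
  assumes "0 < n" "0 < \<delta>" "\<delta> *\<^sub>R e \<le> (C ^^ n) e"
  shows "0 < growth B"
proof -
  obtain M where M: "1 \<le> M" "\<And>x. x \<in> E \<Longrightarrow> q (A x) \<le> M * q x" using pos_map_bound[OF A] by metis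
  show ?thesis
  proof (rule growth_positive[OF assms B M(1)])
    fix H l :: real and k
    assume l: "0 < l" and H: "\<And>n y. y \<in> E \<Longrightarrow> q ((B ^^ n) y) \<le> H * l ^ n * q y"
    have "q ((A ^^ k) ((B ^^ k) e)) \<le> M ^ k * q ((B ^^ k) e)"
      using M e by (intro q_funpow_le[OF A] mem) auto
    also have "\<dots> \<le> M ^ k * (H * l ^ k * q e)" using H[OF e] M(1) by (intro mult_left_mono) auto
    finally show "q ((A ^^ k) ((B ^^ k) e)) \<le> H * l ^ k * M ^ k * q e" by (simp add: mult_ac)
  qed
qed

lemma growth_A_positive:
  assumes "0 < n" "0 < \<delta>" "\<delta> *\<^sub>R e \<le> (C ^^ n) e"
  shows "0 < growth A"
proof -
  obtain M where M: "1 \<le> M" "\<And>x. x \<in> E \<Longrightarrow> q (B x) \<le> M * q x" using pos_map_bound[OF B] by metis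
  have qe: "0 < q e" using q_pos[OF \<phi> e] \<phi>_e by simp
  show ?thesis
  proof (rule growth_positive[OF assms A M(1)])
    fix H l :: real and k
    assume l: "0 < l" and H: "\<And>n y. y \<in> E \<Longrightarrow> q ((A ^^ n) y) \<le> H * l ^ n * q y"
    have "0 \<le> H" using order_trans[OF q_nonneg[OF e] H[OF e, of 0, simplified]] qe
      by (simp add: zero_le_mult_iff)
    have "q ((A ^^ k) ((B ^^ k) e)) \<le> H * l ^ k * q ((B ^^ k) e)" using e by (intro H mem)
    also have "\<dots> \<le> H * l ^ k * (M ^ k * q e)"
      using M e l \<open>0 \<le> H\<close> by (intro mult_left_mono q_funpow_le[OF B]) auto
    finally show "q ((A ^^ k) ((B ^^ k) e)) \<le> H * l ^ k * M ^ k * q e" by (simp add: mult_ac)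
  qed
qed

text \<open>
  Since \<open>e\<close> generates the cone, it is enough to know the functionals on the orbit of \<open>e\<close>; the bound by \<open>q\<close> makes
  the null property stable under approximation.
\<close>
lemma null_on_cone:
  assumes P: "\<And>m. pos_functional (P m)" and Pq: "\<And>m y. y \<in> E \<Longrightarrow> P m y \<le> q y"
    and e0: "\<And>i j. (\<lambda>m. P m ((A ^^ i) ((B ^^ j) e))) \<longlonglongrightarrow> (0::real)"
    and z: "z \<in> E"
  shows "(\<lambda>m. P m z) \<longlonglongrightarrow> 0"
proof -
  have "\<forall>i j. (\<lambda>m. P m ((A ^^ i) ((B ^^ j) z))) \<longlonglongrightarrow> 0"
  proof (rule generated[of "\<lambda>z. \<forall>i j. (\<lambda>m. P m ((A ^^ i) ((B ^^ j) z))) \<longlonglongrightarrow> 0", OF _ _ _ _ _ _ z])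
    show "\<forall>i j. (\<lambda>m. P m ((A ^^ i) ((B ^^ j) e))) \<longlonglongrightarrow> 0" using e0 by blast
  next
    fix y assume y: "y \<in> E" "\<forall>i j. (\<lambda>m. P m ((A ^^ i) ((B ^^ j) y))) \<longlonglongrightarrow> 0"
    show "\<forall>i j. (\<lambda>m. P m ((A ^^ i) ((B ^^ j) (B y)))) \<longlonglongrightarrow> 0"
    proof (intro allI)
      fix i j
      show "(\<lambda>m. P m ((A ^^ i) ((B ^^ j) (B y)))) \<longlonglongrightarrow> 0"
        using y(2)[rule_format, of i "Suc j"] by (simp add: funpow_swap1)
    qed
    show "\<forall>i j. (\<lambda>m. P m ((A ^^ i) ((B ^^ j) (A y)))) \<longlonglongrightarrow> 0"
    proof (intro allI)
      fix i j
      have "P m ((A ^^ i) ((B ^^ j) (A y))) \<le> P m ((A ^^ i) (A ((B ^^ j) y)))" for m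
        using y(1) by (intro pos_functional_mono_mem[OF P] pos_map_mono_mem[OF An] Bn_A_le mem) auto
      moreover have "(\<lambda>m. P m ((A ^^ i) (A ((B ^^ j) y)))) \<longlonglongrightarrow> 0"
        using y(2)[rule_format, of "Suc i" j] by (simp add: funpow_swap1)
      ultimately show "(\<lambda>m. P m ((A ^^ i) ((B ^^ j) (A y)))) \<longlonglongrightarrow> 0"
        using y(1) by (intro null_sandwich[of "\<lambda>m. P m ((A ^^ i) ((B ^^ j) (A y)))"] pos_functional_nonneg[OF P] mem)
    qed
  next
    fix y y' assume y: "y \<in> E" "y' \<in> E" "\<forall>i j. (\<lambda>m. P m ((A ^^ i) ((B ^^ j) y))) \<longlonglongrightarrow> 0"
      "\<forall>i j. (\<lambda>m. P m ((A ^^ i) ((B ^^ j) y'))) \<longlonglongrightarrow> 0"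
    have "P m ((A ^^ i) ((B ^^ j) (y + y'))) = P m ((A ^^ i) ((B ^^ j) y)) + P m ((A ^^ i) ((B ^^ j) y'))" for m i j
      using y(1,2) by (simp add: pos_map_add[OF Bn] pos_map_add[OF An] pos_functional_add[OF P] mem)
    then show "\<forall>i j. (\<lambda>m. P m ((A ^^ i) ((B ^^ j) (y + y')))) \<longlonglongrightarrow> 0"
      using tendsto_add[OF y(3)[rule_format] y(4)[rule_format]] by simp
  next
    fix y t assume y: "y \<in> E" "(0::real) \<le> t" "\<forall>i j. (\<lambda>m. P m ((A ^^ i) ((B ^^ j) y))) \<longlonglongrightarrow> 0"
    have "P m ((A ^^ i) ((B ^^ j) (t *\<^sub>R y))) = t * P m ((A ^^ i) ((B ^^ j) y))" for m i j
      using y(1,2) by (simp add: pos_map_scale[OF Bn] pos_map_scale[OF An] pos_functional_scale[OF P] mem)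
    then show "\<forall>i j. (\<lambda>m. P m ((A ^^ i) ((B ^^ j) (t *\<^sub>R y)))) \<longlonglongrightarrow> 0"
      using tendsto_mult_right_zero[OF y(3)[rule_format]] by simp
  next
    fix y assume y: "y \<in> E"
      and ap: "\<And>\<eta>. 0 < \<eta> \<Longrightarrow> \<exists>y'\<in>E. \<exists>u\<in>E. (\<forall>i j. (\<lambda>m. P m ((A ^^ i) ((B ^^ j) y'))) \<longlonglongrightarrow> 0) \<and> y \<le> y' + u \<and> q u < \<eta>"
    show "\<forall>i j. (\<lambda>m. P m ((A ^^ i) ((B ^^ j) y))) \<longlonglongrightarrow> 0"
    proof (intro allI)
      fix i j
      let ?W = "\<lambda>y. (A ^^ i) ((B ^^ j) y)"
      have W: "pos_map ?W" by (rule pos_map_comp[OF An Bn])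
      obtain M where M: "1 \<le> M" "\<And>x. x \<in> E \<Longrightarrow> q (?W x) \<le> M * q x" using pos_map_bound[OF W] by metis
      show "(\<lambda>m. P m (?W y)) \<longlonglongrightarrow> 0"
      proof (rule LIMSEQ_I)
        fix \<eta> :: real assume \<eta>: "0 < \<eta>"
        then obtain y' u where y': "y' \<in> E" "(\<lambda>m. P m (?W y')) \<longlonglongrightarrow> 0"
          and u: "u \<in> E" "y \<le> y' + u" "q u < \<eta> / (2 * M)"
          using ap[of "\<eta> / (2 * M)"] M(1) by auto
        obtain m0 where m0: "\<And>m. m0 \<le> m \<Longrightarrow> norm (P m (?W y') - 0) < \<eta> / 2"
          using LIMSEQ_D[OF y'(2), of "\<eta> / 2"] \<eta> by auto
        have "norm (P m (?W y) - 0) < \<eta>" if "m0 \<le> m" for m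
        proof -
          have "P m (?W y) \<le> P m (?W (y' + u))"
            using y y'(1) u(1,2) by (intro pos_functional_mono_mem[OF P] pos_map_mono_mem[OF W] pos_map_mem[OF W] add_mem)
          also have "\<dots> = P m (?W y') + P m (?W u)"
            using y'(1) u(1) pos_map_mem[OF W] by (simp add: pos_map_add[OF W] pos_functional_add[OF P])
          also have "P m (?W u) \<le> M * q u"
            using Pq[OF pos_map_mem[OF W u(1)], of m] M(2)[OF u(1)] by linarith
          also have "M * q u < \<eta> / 2" using u(3) M(1) by (simp add: field_simps)
          finally show ?thesis
            using m0[OF that] pos_functional_nonneg[OF P pos_map_mem[OF W y], of m] by simp
        qed
        then show "\<exists>m0. \<forall>m\<ge>m0. norm (P m (?W y) - 0) < \<eta>" by blast
      qed
    qed
  qed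
  from this[rule_format, of 0 0] show ?thesis by simp
qed

text \<open>
  The heart of the proof. Here \<open>x\<close> and \<open>P m\<close> are the right and approximate left eigenvectors of \<open>B\<close>.
  From \<open>B A \<le> A B\<close> follow \<open>B (A^j x) \<le> r A^j x\<close> and \<open>P m \<circ> A^i \<circ> B \<ge> r P m \<circ> A^i\<close> up to a null
  sequence, and both bounds together leave no room for \<open>C = A B - B A\<close>.
\<close>
lemma no_cycle_if_right_factor_compact:
  assumes K: "compact_map B" and n: "0 < n" and \<delta>: "0 < \<delta>" and cycle: "\<delta> *\<^sub>R e \<le> (C ^^ n) e"
  shows False
proof -
  let ?r = "growth B"
  have r: "0 < ?r" using growth_B_positive[OF n \<delta> cycle] .
  obtain x f0 P \<Lambda> \<epsilon> z c where x: "x \<in> E" and f0: "pos_functional f0" "0 < f0 x"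
    and eig: "\<And>f. pos_functional f \<Longrightarrow> f (B x) = ?r * f x"
    and P: "\<And>m. pos_functional (P m)" and Pq: "\<And>m y. y \<in> E \<Longrightarrow> P m y \<le> q y"
    and \<Lambda>: "\<And>m. ?r \<le> \<Lambda> m" "\<Lambda> \<longlonglongrightarrow> ?r" and \<epsilon>: "(\<epsilon> :: nat \<Rightarrow> real) \<longlonglongrightarrow> 0"
    and PB1: "\<And>m y. y \<in> E \<Longrightarrow> \<Lambda> m * P m y \<le> P m (B y) + \<epsilon> m * q y"
    and PB2: "\<And>m y. y \<in> E \<Longrightarrow> P m (B y) \<le> \<Lambda> m * P m y + \<epsilon> m * q y"
    and z: "z \<in> E" "0 < c" "\<And>m. c \<le> P m z"
    using peripheral_eigenvectors[OF B K r separating_functional] by metis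
  have eigs: "f ((B ^^ k) x) = ?r ^ k * f x" if "pos_functional f" for f k
    by (rule pos_functional_eigen_funpow[OF B _ that]) (rule eig)
  note Pn = pos_functional_nonneg[OF P]
  have \<epsilon>q: "(\<lambda>m. \<epsilon> m * w) \<longlonglongrightarrow> 0" for w by (rule tendsto_mult_left_zero[OF \<epsilon>])
  obtain a b where "0 < \<phi> ((A ^^ a) ((B ^^ b) x))" using separating[OF x q_pos[OF f0(1) x f0(2)]] by blast
  then have ab: "0 < \<phi> ((A ^^ a) x)"
    using eigs[OF pos_functional_comp[OF \<phi> An], of a b] r by (simp add: zero_less_mult_iff)
  \<comment> \<open>Irreducibility and the eigenvalue equation put \<open>e\<close> below a multiple of \<open>A^a x\<close>, so bounds on \<open>x\<close> pass to \<open>e\<close>.\<close>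
  define \<gamma> where "\<gamma> = \<phi> ((A ^^ a) x)"
  have \<gamma>: "0 < \<gamma>" "\<gamma> *\<^sub>R e \<le> (A ^^ a) x" using ab atom[OF An_mem[OF x]] by (auto simp: \<gamma>_def)
  have lim_C: "(\<lambda>m. P m ((A ^^ i) (C ((A ^^ j) x)))) \<longlonglongrightarrow> 0" for i j
  proof (rule null_sandwich[OF _ _ \<epsilon>q])
    fix m
    let ?w = "(A ^^ j) x"
    let ?v = "(A ^^ i) (A ?w)"
    show "0 \<le> P m ((A ^^ i) (C ?w))" using x by (intro Pn mem)
    have "P m ((A ^^ i) (A (B ?w))) = P m ((A ^^ i) (B (A ?w))) + P m ((A ^^ i) (C ?w))"
      using x by (simp add: commutator pos_map_add[OF An] pos_functional_add[OF P] mem)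
    moreover have "P m ((A ^^ i) (A (B ?w))) \<le> P m ((A ^^ i) (A ((A ^^ j) (B x))))"
      using x by (intro pos_functional_mono_mem[OF P] pos_map_mono_mem[OF An] pos_map_mono_mem[OF A] B_An_le mem)
    moreover have "P m ((A ^^ i) (A ((A ^^ j) (B x)))) = ?r * P m ?v"
      by (rule eig[OF pos_functional_comp[OF pos_functional_comp[OF pos_functional_comp[OF P An] A] An]])
    moreover have "P m (B ((A ^^ i) (A ?w))) \<le> P m ((A ^^ i) (B (A ?w)))"
      using x by (intro pos_functional_mono_mem[OF P] B_An_le mem)
    moreover have "\<Lambda> m * P m ?v \<le> P m (B ?v) + \<epsilon> m * q ?v" using x by (intro PB1 mem)
    moreover have "?r * P m ?v \<le> \<Lambda> m * P m ?v" using x \<Lambda>(1) by (intro mult_right_mono Pn mem)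
    ultimately show "P m ((A ^^ i) (C ?w)) \<le> \<epsilon> m * q ?v" by linarith
  qed
  \<comment> \<open>The cycle allows \<open>e\<close> to be replaced by \<open>C^n e\<close>, which contains a factor \<open>C\<close>.\<close>
  have lim_e: "(\<lambda>m. P m ((A ^^ i) e)) \<longlonglongrightarrow> 0" for i
  proof -
    obtain k where k: "n = Suc k" using n by (cases n) auto
    show ?thesis
    proof (rule null_sandwich_scaled[of "\<gamma> * \<delta>" _ "\<lambda>m. ?r ^ k * P m ((A ^^ i) (C ((A ^^ (k + a)) x)))"])
      show "0 < \<gamma> * \<delta>" using \<gamma> \<delta> by simp
      show "0 \<le> P m ((A ^^ i) e)" for m using e by (intro Pn mem)
      show "(\<lambda>m. ?r ^ k * P m ((A ^^ i) (C ((A ^^ (k + a)) x)))) \<longlonglongrightarrow> 0"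
        by (rule tendsto_mult_right_zero[OF lim_C])
      fix m
      define g where "g v = P m ((A ^^ i) (C ((A ^^ k) v)))" for v
      have g: "pos_functional g" unfolding g_def
        by (rule pos_functional_comp[OF pos_functional_comp[OF pos_functional_comp[OF P An] C] An])
      have "\<delta> * P m ((A ^^ i) e) = P m ((A ^^ i) (\<delta> *\<^sub>R e))"
        using \<delta> e by (simp add: pos_map_scale[OF An] pos_functional_scale[OF P] mem)
      also have "\<dots> \<le> P m ((A ^^ i) (C ((C ^^ k) e)))"
        using cycle e \<delta> k by (intro pos_functional_mono_mem[OF P] pos_map_mono_mem[OF An] mem scale_mem) auto
      also have "\<dots> \<le> g ((B ^^ k) e)" unfolding g_def
        using e by (intro pos_functional_mono_mem[OF P] pos_map_mono_mem[OF An] pos_map_mono_mem[OF C] Cn_le mem)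
      finally have "\<gamma> * \<delta> * P m ((A ^^ i) e) \<le> \<gamma> * g ((B ^^ k) e)"
        using \<gamma>(1) by (simp add: mult.assoc)
      also have "\<dots> = g ((B ^^ k) (\<gamma> *\<^sub>R e))"
        using \<gamma>(1) e by (simp add: pos_map_scale[OF Bn] pos_functional_scale[OF g] mem)
      also have "\<dots> \<le> g ((B ^^ k) ((A ^^ a) x))"
        using \<gamma> e x by (intro pos_functional_mono_mem[OF g] pos_map_mono_mem[OF Bn] mem scale_mem) auto
      also have "\<dots> \<le> g ((A ^^ a) ((B ^^ k) x))"
        using x by (intro pos_functional_mono_mem[OF g] Bn_An_le mem)
      also have "\<dots> = ?r ^ k * g ((A ^^ a) x)" by (rule eigs[OF pos_functional_comp[OF g An]])
      finally show "\<gamma> * \<delta> * P m ((A ^^ i) e) \<le> ?r ^ k * P m ((A ^^ i) (C ((A ^^ (k + a)) x)))"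
        by (simp add: g_def funpow_add)
    qed
  qed
  have lim_eB: "(\<lambda>m. P m ((A ^^ i) ((B ^^ j) e))) \<longlonglongrightarrow> 0" for i j
  proof (induction j)
    case 0
    then show ?case using lim_e by simp
  next
    case (Suc j)
    \<comment> \<open>The defect of the left eigenvalue inequality for \<open>P m \<circ> A^i\<close>. It is a positive functional, and it is
      small on \<open>A^a x\<close>, hence on the elements below it.\<close>
    define D where "D m y = P m ((A ^^ i) (B y)) - P m (B ((A ^^ i) y))" for m y
    have D: "pos_functional (D m)" for m unfolding D_def
      by (intro pos_functional_diff pos_functional_comp[OF pos_functional_comp[OF P An] B]
          pos_functional_comp[OF pos_functional_comp[OF P B] An] pos_functional_mono_mem[OF P] B_An_le mem)
    have Dlim: "(\<lambda>m. D m ((B ^^ j) e)) \<longlonglongrightarrow> 0"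
    proof (rule null_sandwich_scaled[of \<gamma> _ "\<lambda>m. ?r ^ j * (\<epsilon> m * q ((A ^^ i) ((A ^^ a) x)))"])
      show "0 < \<gamma>" by (rule \<gamma>(1))
      show "0 \<le> D m ((B ^^ j) e)" for m using e by (intro pos_functional_nonneg[OF D] mem)
      show "(\<lambda>m. ?r ^ j * (\<epsilon> m * q ((A ^^ i) ((A ^^ a) x)))) \<longlonglongrightarrow> 0"
        by (rule tendsto_mult_right_zero[OF \<epsilon>q])
      fix m
      let ?v = "(A ^^ i) ((A ^^ a) x)"
      have "P m ((A ^^ i) (B ((A ^^ a) x))) \<le> P m ((A ^^ i) ((A ^^ a) (B x)))"
        using x by (intro pos_functional_mono_mem[OF P] pos_map_mono_mem[OF An] B_An_le mem)
      moreover have "\<dots> = ?r * P m ?v"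
        by (rule eig[OF pos_functional_comp[OF pos_functional_comp[OF P An] An]])
      moreover have "\<Lambda> m * P m ?v \<le> P m (B ?v) + \<epsilon> m * q ?v" using x by (intro PB1 mem)
      moreover have "?r * P m ?v \<le> \<Lambda> m * P m ?v" using x \<Lambda>(1) by (intro mult_right_mono Pn mem)
      ultimately have Dx: "D m ((A ^^ a) x) \<le> \<epsilon> m * q ?v" unfolding D_def by linarith
      have "\<gamma> * D m ((B ^^ j) e) = D m ((B ^^ j) (\<gamma> *\<^sub>R e))"
        using \<gamma>(1) e by (simp add: pos_map_scale[OF Bn] pos_functional_scale[OF D] mem)
      also have "\<dots> \<le> D m ((B ^^ j) ((A ^^ a) x))"
        using \<gamma> e x by (intro pos_functional_mono_mem[OF D] pos_map_mono_mem[OF Bn] mem scale_mem) auto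
      also have "\<dots> \<le> D m ((A ^^ a) ((B ^^ j) x))"
        using x by (intro pos_functional_mono_mem[OF D] Bn_An_le mem)
      also have "\<dots> = ?r ^ j * D m ((A ^^ a) x)" by (rule eigs[OF pos_functional_comp[OF D An]])
      also have "\<dots> \<le> ?r ^ j * (\<epsilon> m * q ?v)" using Dx r by (intro mult_left_mono) auto
      finally show "\<gamma> * D m ((B ^^ j) e) \<le> ?r ^ j * (\<epsilon> m * q ?v)" .
    qed
    let ?v = "(A ^^ i) ((B ^^ j) e)"
    show ?case
    proof (rule null_sandwich[of _ "\<lambda>m. \<Lambda> m * P m ?v + \<epsilon> m * q ?v + D m ((B ^^ j) e)"])
      show "0 \<le> P m ((A ^^ i) ((B ^^ Suc j) e))" for m using e by (intro Pn mem)
      show "P m ((A ^^ i) ((B ^^ Suc j) e)) \<le> \<Lambda> m * P m ?v + \<epsilon> m * q ?v + D m ((B ^^ j) e)" for m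
        using PB2[OF An_mem[OF Bn_mem[OF e]], of m i j] by (simp add: D_def)
      show "(\<lambda>m. \<Lambda> m * P m ?v + \<epsilon> m * q ?v + D m ((B ^^ j) e)) \<longlonglongrightarrow> 0"
        using tendsto_add[OF tendsto_add[OF tendsto_mult[OF \<Lambda>(2) Suc] \<epsilon>q] Dlim] by simp
    qed
  qed
  have "(\<lambda>m. P m z) \<longlonglongrightarrow> 0" by (rule null_on_cone[OF P Pq lim_eB z(1)])
  then have "c \<le> 0" using z(3) by (intro LIMSEQ_le_const) auto
  then show False using z(2) by simp
qed

text \<open>
  The mirror image. Now \<open>A\<close> has the eigenvector \<open>x\<close>, and the inequalities are reversed: \<open>A (B^j x) \<ge> r B^j x\<close>,
  while \<open>P m \<circ> B^i \<circ> A\<close> is at most \<open>r P m \<circ> B^i\<close> up to a null sequence. Accordingly irreducibility is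
  applied first to the functionals, which are found to charge some \<open>B^b e\<close>, and the conclusion is that no word
  sees \<open>x\<close>.
\<close>
lemma no_cycle_if_left_factor_compact:
  assumes K: "compact_map A" and n: "0 < n" and \<delta>: "0 < \<delta>" and cycle: "\<delta> *\<^sub>R e \<le> (C ^^ n) e"
  shows False
proof -
  let ?r = "growth A"
  have r: "0 < ?r" using growth_A_positive[OF n \<delta> cycle] .
  obtain x f0 P \<Lambda> \<epsilon> z c where x: "x \<in> E" and f0: "pos_functional f0" "0 < f0 x"
    and eig: "\<And>f. pos_functional f \<Longrightarrow> f (A x) = ?r * f x"
    and P: "\<And>m. pos_functional (P m)" and Pq: "\<And>m y. y \<in> E \<Longrightarrow> P m y \<le> q y"
    and \<Lambda>: "\<And>m. ?r \<le> \<Lambda> m" "\<Lambda> \<longlonglongrightarrow> ?r" and \<epsilon>: "(\<epsilon> :: nat \<Rightarrow> real) \<longlonglongrightarrow> 0"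
    and PA: "\<And>m y. y \<in> E \<Longrightarrow> P m (A y) \<le> \<Lambda> m * P m y + \<epsilon> m * q y"
    and z: "z \<in> E" "0 < c" "\<And>m. c \<le> P m z"
    using peripheral_eigenvectors[OF A K r separating_functional] by metis
  note Pn = pos_functional_nonneg[OF P]
  have \<epsilon>q: "(\<lambda>m. \<epsilon> m * w) \<longlonglongrightarrow> 0" for w by (rule tendsto_mult_left_zero[OF \<epsilon>])
  have err: "(\<lambda>m. (\<Lambda> m - ?r) * w + \<epsilon> m * w) \<longlonglongrightarrow> 0" for w
    using tendsto_add[OF tendsto_mult_left_zero[OF LIM_zero[OF \<Lambda>(2)]] \<epsilon>q, of w w] by simp
  have A_null: "(\<lambda>m. P m ((A ^^ a) y)) \<longlonglongrightarrow> 0" if y: "y \<in> E" "(\<lambda>m. P m y) \<longlonglongrightarrow> 0" for a y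
  proof (induction a)
    case 0
    then show ?case using y by simp
  next
    case (Suc a)
    show ?case
    proof (rule null_sandwich[of _ "\<lambda>m. \<Lambda> m * P m ((A ^^ a) y) + \<epsilon> m * q ((A ^^ a) y)"])
      show "0 \<le> P m ((A ^^ Suc a) y)" for m using y by (intro Pn mem)
      show "P m ((A ^^ Suc a) y) \<le> \<Lambda> m * P m ((A ^^ a) y) + \<epsilon> m * q ((A ^^ a) y)" for m
        using PA[OF An_mem[OF y(1)], of m a] by simp
      show "(\<lambda>m. \<Lambda> m * P m ((A ^^ a) y) + \<epsilon> m * q ((A ^^ a) y)) \<longlonglongrightarrow> 0"
        using tendsto_add[OF tendsto_mult[OF \<Lambda>(2) Suc] \<epsilon>q] by simp
    qed
  qed
  have "\<not> (\<lambda>m. P m z) \<longlonglongrightarrow> 0"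
  proof
    assume "(\<lambda>m. P m z) \<longlonglongrightarrow> 0"
    then have "c \<le> 0" using z(3) by (intro LIMSEQ_le_const) auto
    then show False using z(2) by simp
  qed
  then obtain b where b: "\<not> (\<lambda>m. P m ((B ^^ b) e)) \<longlonglongrightarrow> 0"
    using null_on_cone[OF P Pq A_null[OF Bn_mem[OF e]] z(1)] by blast
  \<comment> \<open>On the element \<open>w\<close>, the functionals \<open>P m \<circ> B^b\<close> are at least \<open>\<kappa>\<close> times their values at \<open>e\<close>, which do not tend to 0.\<close>
  have kill: "\<kappa> = 0" if "0 \<le> \<kappa>" "w \<in> E" "\<kappa> *\<^sub>R e \<le> w" "(\<lambda>m. P m ((B ^^ b) w)) \<longlonglongrightarrow> 0" for \<kappa> w
  proof (rule ccontr)
    assume "\<kappa> \<noteq> 0"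
    then have "0 < \<kappa>" using that by simp
    then have "(\<lambda>m. P m ((B ^^ b) e)) \<longlonglongrightarrow> 0"
    proof (rule null_sandwich_scaled[OF _ _ _ that(4)])
      show "0 \<le> P m ((B ^^ b) e)" for m using e by (intro Pn mem)
      have "\<kappa> * P m ((B ^^ b) e) = P m ((B ^^ b) (\<kappa> *\<^sub>R e))" for m
        using that(1) e by (simp add: pos_map_scale[OF Bn] pos_functional_scale[OF P] mem)
      then show "\<kappa> * P m ((B ^^ b) e) \<le> P m ((B ^^ b) w)" for m
        using that e by (auto intro!: pos_functional_mono_mem[OF P] pos_map_mono_mem[OF Bn] mem scale_mem)
    qed
    then show False using b by contradiction
  qed
  have lim_C: "(\<lambda>m. P m ((B ^^ i) (C ((B ^^ j) x)))) \<longlonglongrightarrow> 0" for i j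
  proof (rule null_sandwich[OF _ _ err])
    fix m
    let ?w = "(B ^^ j) x"
    let ?v = "(B ^^ i) (B ?w)"
    show "0 \<le> P m ((B ^^ i) (C ?w))" using x by (intro Pn mem)
    have "P m ((B ^^ i) (A (B ?w))) = P m ((B ^^ i) (B (A ?w))) + P m ((B ^^ i) (C ?w))"
      using x by (simp add: commutator pos_map_add[OF Bn] pos_functional_add[OF P] mem)
    moreover have "P m ((B ^^ i) (A (B ?w))) \<le> P m (A ?v)"
      using x by (intro pos_functional_mono_mem[OF P] Bn_A_le mem)
    moreover have "P m (A ?v) \<le> \<Lambda> m * P m ?v + \<epsilon> m * q ?v" using x by (intro PA mem)
    moreover have "P m ((B ^^ i) (B ((B ^^ j) (A x)))) \<le> P m ((B ^^ i) (B (A ?w)))"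
      using x by (intro pos_functional_mono_mem[OF P] pos_map_mono_mem[OF Bn] pos_map_mono_mem[OF B] Bn_A_le mem)
    moreover have "P m ((B ^^ i) (B ((B ^^ j) (A x)))) = ?r * P m ?v"
      by (rule eig[OF pos_functional_comp[OF pos_functional_comp[OF pos_functional_comp[OF P Bn] B] Bn]])
    moreover have "(\<Lambda> m - ?r) * P m ?v \<le> (\<Lambda> m - ?r) * q ?v"
      using x \<Lambda>(1)[of m] by (intro mult_left_mono Pq mem) auto
    ultimately show "P m ((B ^^ i) (C ?w)) \<le> (\<Lambda> m - ?r) * q ?v + \<epsilon> m * q ?v"
      by (simp add: left_diff_distrib)
  qed
  have \<phi>B: "\<phi> ((B ^^ j) x) = 0" for j
  proof -
    obtain k where k: "n = Suc k" using n by (cases n) auto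
    let ?y = "(B ^^ j) x"
    have y: "?y \<in> E" using x by (intro mem)
    have \<phi>y: "0 \<le> \<phi> ?y" using pos_functional_nonneg[OF \<phi> y] .
    have "(\<phi> ?y * \<delta>) *\<^sub>R e = \<phi> ?y *\<^sub>R \<delta> *\<^sub>R e" by simp
    also have "\<dots> \<le> \<phi> ?y *\<^sub>R (C ^^ n) e" using cycle \<phi>y by (rule scaleR_left_mono)
    also have "\<dots> = (C ^^ n) (\<phi> ?y *\<^sub>R e)" using pos_map_scale[OF Cn e \<phi>y] by simp
    also have "\<dots> \<le> (C ^^ n) ?y" using y e \<phi>y by (intro pos_map_mono_mem[OF Cn] atom scale_mem)
    finally have le: "(\<phi> ?y * \<delta>) *\<^sub>R e \<le> (C ^^ n) ?y" .
    have "(\<lambda>m. P m ((B ^^ b) ((C ^^ n) ?y))) \<longlonglongrightarrow> 0"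
    proof (rule null_sandwich)
      show "0 \<le> P m ((B ^^ b) ((C ^^ n) ?y))" for m using x by (intro Pn mem)
      show "(\<lambda>m. P m ((A ^^ k) ((B ^^ (b + k)) (C ?y)))) \<longlonglongrightarrow> 0"
        using x by (intro A_null lim_C mem)
      fix m
      have "P m ((B ^^ b) ((C ^^ n) ?y)) = P m ((B ^^ b) ((C ^^ k) (C ?y)))"
        by (simp add: k funpow_swap1)
      also have "\<dots> \<le> P m ((B ^^ b) ((A ^^ k) ((B ^^ k) (C ?y))))"
        using x by (intro pos_functional_mono_mem[OF P] pos_map_mono_mem[OF Bn] Cn_le mem)
      also have "\<dots> \<le> P m ((A ^^ k) ((B ^^ b) ((B ^^ k) (C ?y))))"
        using x by (intro pos_functional_mono_mem[OF P] Bn_An_le mem)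
      finally show "P m ((B ^^ b) ((C ^^ n) ?y)) \<le> P m ((A ^^ k) ((B ^^ (b + k)) (C ?y)))"
        by (simp add: funpow_add)
    qed
    then have "\<phi> ?y * \<delta> = 0" using kill[OF _ Cn_mem[OF y] le] \<phi>y \<delta> by simp
    then show ?thesis using \<delta> by simp
  qed
  have \<phi>AB: "\<phi> ((A ^^ a) ((B ^^ j) x)) = 0" for a j
  proof (induction a)
    case 0
    then show ?case using \<phi>B by simp
  next
    case (Suc a)
    define D where "D = A ((B ^^ j) x) - (B ^^ j) (A x)"
    have sum: "A ((B ^^ j) x) = (B ^^ j) (A x) + D" by (simp add: D_def)
    have D: "D \<in> E"
      unfolding D_def using Bn_A_le[OF x, of j] nonneg[OF Bn_mem[OF A_mem[OF x]], of j]
      by (intro solid[OF A_mem[OF Bn_mem[OF x, of j]]]) (auto simp: algebra_simps)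
    have "(\<lambda>m. P m ((B ^^ b) D)) \<longlonglongrightarrow> 0"
    proof (rule null_sandwich[OF _ _ err])
      fix m
      let ?v = "(B ^^ b) ((B ^^ j) x)"
      show "0 \<le> P m ((B ^^ b) D)" using D by (intro Pn mem)
      have "P m ((B ^^ b) (A ((B ^^ j) x))) = P m ((B ^^ b) ((B ^^ j) (A x))) + P m ((B ^^ b) D)"
        unfolding sum using x D by (simp add: pos_map_add[OF Bn] pos_functional_add[OF P] mem)
      moreover have "P m ((B ^^ b) (A ((B ^^ j) x))) \<le> P m (A ?v)"
        using x by (intro pos_functional_mono_mem[OF P] Bn_A_le mem)
      moreover have "P m (A ?v) \<le> \<Lambda> m * P m ?v + \<epsilon> m * q ?v" using x by (intro PA mem)
      moreover have "P m ((B ^^ b) ((B ^^ j) (A x))) = ?r * P m ?v"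
        by (rule eig[OF pos_functional_comp[OF pos_functional_comp[OF P Bn] Bn]])
      moreover have "(\<Lambda> m - ?r) * P m ?v \<le> (\<Lambda> m - ?r) * q ?v"
        using x \<Lambda>(1)[of m] by (intro mult_left_mono Pq mem) auto
      ultimately show "P m ((B ^^ b) D) \<le> (\<Lambda> m - ?r) * q ?v + \<epsilon> m * q ?v"
        by (simp add: left_diff_distrib)
    qed
    then have AD: "(\<lambda>m. P m ((A ^^ a) ((B ^^ b) D))) \<longlonglongrightarrow> 0" using D by (intro A_null mem)
    have "(\<lambda>m. P m ((B ^^ b) ((A ^^ a) D))) \<longlonglongrightarrow> 0"
      using D by (intro null_sandwich[OF _ _ AD] Pn pos_functional_mono_mem[OF P] Bn_An_le mem)
    then have "\<phi> ((A ^^ a) D) = 0"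
      using D by (intro kill[of _ "(A ^^ a) D"] pos_functional_nonneg[OF \<phi>] atom mem)
    moreover have "\<phi> ((A ^^ Suc a) ((B ^^ j) x)) = \<phi> ((A ^^ a) ((B ^^ j) (A x))) + \<phi> ((A ^^ a) D)"
      using x D by (simp add: funpow_swap1 sum pos_map_add[OF An] pos_functional_add[OF \<phi>] mem)
    moreover have "\<phi> ((A ^^ a) ((B ^^ j) (A x))) = ?r * \<phi> ((A ^^ a) ((B ^^ j) x))"
      by (rule eig[OF pos_functional_comp[OF pos_functional_comp[OF \<phi> An] Bn]])
    ultimately show ?case using Suc by simp
  qed
  then show False using separating[OF x q_pos[OF f0(1) x f0(2)]] by simp
qed

end

section \<open>Reduction to an irreducible action\<close>

text \<open>
  A general positive commutator is made irreducible by passing to the closed ideal \<open>J\<close> that \<open>e\<close> generates and by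
  measuring its elements modulo those that \<open>\<phi>\<close> does not see.
\<close>
locale lattice_commutator = positive_commutator X nm A B C e \<phi>
  for X :: "'a::{ordered_real_vector,lattice} set" and nm A B C e \<phi>
begin

text \<open>The last rule combines closure under smaller elements with closure under limits.\<close>
inductive_set J :: "'a set" where
  J_e: "e \<in> J"
| J_A: "y \<in> J \<Longrightarrow> A y \<in> J"
| J_B: "y \<in> J \<Longrightarrow> B y \<in> J"
| J_add: "y \<in> J \<Longrightarrow> y' \<in> J \<Longrightarrow> y + y' \<in> J"
| J_scale: "y \<in> J \<Longrightarrow> 0 \<le> t \<Longrightarrow> t *\<^sub>R y \<in> J"
| J_approx: "y \<in> X \<Longrightarrow> \<forall>\<eta>>0. \<exists>y'. y' \<in> J \<and> (\<exists>u\<in>X. y \<le> y' + u \<and> nm u < \<eta>) \<Longrightarrow> y \<in> J"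

definition vanishing :: "'a \<Rightarrow> bool" where
  "vanishing n \<longleftrightarrow> (\<forall>a b. \<phi> ((A ^^ a) ((B ^^ b) n)) = 0)"

definition reps :: "'a \<Rightarrow> 'a set" where
  "reps y = {y' \<in> X. y' \<le> y \<and> vanishing (y - y')}"

text \<open>
  The norm of the quotient by the ideal of vanishing elements. Nonnegative representatives
  below the given element give the same infimum as all representatives.
\<close>
definition quotient_norm :: "'a \<Rightarrow> real" where
  "quotient_norm y = Inf (nm ` reps y)"

lemma J_subset: "y \<in> J \<Longrightarrow> y \<in> X"
  by (induction rule: J.induct) (auto intro: e mem add_mem scale_mem)

lemma J_solid: "y \<in> J \<Longrightarrow> 0 \<le> x \<Longrightarrow> x \<le> y \<Longrightarrow> x \<in> J"
  using J_subset solid zero_mem q_zero by (intro J_approx) (auto intro!: exI[of _ y] bexI[of _ 0])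

lemma J_zero: "0 \<in> J"
  using J_scale[OF J_e, of 0] by simp

lemma J_C: "y \<in> J \<Longrightarrow> C y \<in> J"
  by (rule J_solid[OF J_A[OF J_B] nonneg[OF C_mem] C_le]) (auto intro: J_subset)

lemma word: "pos_functional (\<lambda>y. \<phi> ((A ^^ a) ((B ^^ b) y)))"
  by (rule pos_functional_comp[OF pos_functional_comp[OF \<phi> An] Bn])

lemma diff_mem: "y \<in> X \<Longrightarrow> 0 \<le> x \<Longrightarrow> x \<le> y \<Longrightarrow> y - x \<in> X"
  by (rule solid) (auto simp: algebra_simps)

lemma vanishing_zero: "vanishing 0"
  using pos_functional_scale[OF word zero_mem, of 0] by (simp add: vanishing_def)

lemma vanishing_add: "x \<in> X \<Longrightarrow> y \<in> X \<Longrightarrow> vanishing x \<Longrightarrow> vanishing y \<Longrightarrow> vanishing (x + y)"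
  using pos_functional_add[OF word] by (simp add: vanishing_def)

lemma vanishing_scale: "x \<in> X \<Longrightarrow> 0 \<le> t \<Longrightarrow> vanishing x \<Longrightarrow> vanishing (t *\<^sub>R x)"
  using pos_functional_scale[OF word] by (simp add: vanishing_def)

lemma vanishing_mono: "y \<in> X \<Longrightarrow> 0 \<le> x \<Longrightarrow> x \<le> y \<Longrightarrow> vanishing y \<Longrightarrow> vanishing x"
  unfolding vanishing_def
  by (metis pos_functional_mono[OF word] pos_functional_nonneg[OF word] solid order_antisym)

lemma vanishing_B: "vanishing n \<Longrightarrow> vanishing (B n)"
  unfolding vanishing_def by (metis funpow.simps(2) funpow_swap1 o_apply)

lemma vanishing_A:
  assumes "n \<in> X" "vanishing n"
  shows "vanishing (A n)"
  unfolding vanishing_def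
proof (intro allI)
  fix a b
  have "\<phi> ((A ^^ a) ((B ^^ b) (A n))) \<le> \<phi> ((A ^^ a) (A ((B ^^ b) n)))"
    using assms(1) by (intro pos_functional_mono_mem[OF \<phi>] pos_map_mono_mem[OF An] Bn_A_le mem)
  also have "\<dots> = \<phi> ((A ^^ Suc a) ((B ^^ b) n))" by (simp add: funpow_swap1)
  also have "\<dots> = 0" using assms(2) unfolding vanishing_def by blast
  finally show "\<phi> ((A ^^ a) ((B ^^ b) (A n))) = 0"
    using pos_functional_nonneg[OF word A_mem[OF assms(1)], of a b] by simp
qed

lemma vanishing_C: "n \<in> X \<Longrightarrow> vanishing n \<Longrightarrow> vanishing (C n)"
  by (rule vanishing_mono[OF A_mem[OF B_mem] nonneg[OF C_mem] C_le])
    (auto intro: vanishing_A vanishing_B B_mem)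

lemma repsD:
  assumes "y' \<in> reps y" "y \<in> X"
  shows "y' \<in> X" "0 \<le> y'" "y' \<le> y" "y - y' \<in> X" "vanishing (y - y')"
  using assms diff_mem nonneg by (auto simp: reps_def)

lemma reps_self: "y \<in> X \<Longrightarrow> y \<in> reps y"
  using vanishing_zero by (simp add: reps_def)

lemma quotient_norm_le: "y' \<in> reps y \<Longrightarrow> quotient_norm y \<le> nm y'"
  unfolding quotient_norm_def by (rule cINF_lower) (auto intro!: bdd_belowI[of _ 0] q_nonneg simp: reps_def)

lemma quotient_norm_le_nm: "y \<in> X \<Longrightarrow> quotient_norm y \<le> nm y"
  by (rule quotient_norm_le[OF reps_self])

lemma quotient_norm_nonneg: "y \<in> X \<Longrightarrow> 0 \<le> quotient_norm y"
  unfolding quotient_norm_def using reps_self by (intro cINF_greatest) (auto simp: reps_def q_nonneg)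

lemma quotient_norm_approx:
  assumes "y \<in> X" "quotient_norm y < K"
  obtains y' where "y' \<in> reps y" "nm y' < K"
  using cInf_lessD[of "nm ` reps y" K] assms reps_self unfolding quotient_norm_def by blast

lemma quotient_norm_bound:
  assumes y: "y \<in> X" and K: "0 \<le> K" and le: "\<And>y'. y' \<in> reps y \<Longrightarrow> a \<le> K * nm y'"
  shows "a \<le> K * quotient_norm y"
proof (rule field_le_epsilon)
  fix \<eta> :: real assume \<eta>: "0 < \<eta>"
  obtain y' where y': "y' \<in> reps y" "nm y' < quotient_norm y + \<eta> / (K + 1)"
    using quotient_norm_approx[OF y, of "quotient_norm y + \<eta> / (K + 1)"] \<eta> K by auto
  have "a \<le> K * nm y'" by (rule le[OF y'(1)])
  also have "\<dots> \<le> K * (quotient_norm y + \<eta> / (K + 1))" using y'(2) K by (intro mult_left_mono) auto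
  also have "\<dots> \<le> K * quotient_norm y + \<eta>" using K \<eta> by (simp add: field_simps)
  finally show "a \<le> K * quotient_norm y + \<eta>" .
qed

lemma quotient_norm_add:
  assumes x: "x \<in> X" and y: "y \<in> X"
  shows "quotient_norm (x + y) \<le> quotient_norm x + quotient_norm y"
proof (rule field_le_epsilon)
  fix \<eta> :: real assume \<eta>: "0 < \<eta>"
  obtain x' where x': "x' \<in> reps x" "nm x' < quotient_norm x + \<eta> / 2"
    using quotient_norm_approx[OF x, of "quotient_norm x + \<eta> / 2"] \<eta> by auto
  obtain y' where y': "y' \<in> reps y" "nm y' < quotient_norm y + \<eta> / 2"
    using quotient_norm_approx[OF y, of "quotient_norm y + \<eta> / 2"] \<eta> by auto
  note X' = repsD[OF x'(1) x] and Y' = repsD[OF y'(1) y]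
  have "x' + y' \<in> reps (x + y)"
    using X' Y' vanishing_add[OF X'(4) Y'(4)]
    by (auto simp: reps_def add_mem add_mono add_diff_add)
  then show "quotient_norm (x + y) \<le> quotient_norm x + quotient_norm y + \<eta>"
    using quotient_norm_le[of "x' + y'" "x + y"] q_add[OF X'(1) Y'(1)] x'(2) y'(2) by linarith
qed

lemma quotient_norm_scale_le:
  assumes x: "x \<in> X" and t: "0 \<le> t"
  shows "quotient_norm (t *\<^sub>R x) \<le> t * quotient_norm x"
proof (rule quotient_norm_bound[OF x t])
  fix x' assume "x' \<in> reps x"
  note X' = repsD[OF this x]
  have "t *\<^sub>R x' \<in> reps (t *\<^sub>R x)"
    using X' vanishing_scale[OF X'(4) t X'(5)] t
    by (auto simp: reps_def scale_mem scaleR_left_mono scaleR_diff_right)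
  then show "quotient_norm (t *\<^sub>R x) \<le> t * nm x'"
    using quotient_norm_le[of "t *\<^sub>R x'"] q_scale[OF X'(1) t] by simp
qed

lemma quotient_norm_scale:
  assumes x: "x \<in> X" and t: "0 \<le> t"
  shows "quotient_norm (t *\<^sub>R x) = t * quotient_norm x"
proof (cases "t = 0")
  case True
  then show ?thesis using quotient_norm_scale_le[OF x t] quotient_norm_nonneg[OF zero_mem] by simp
next
  case False
  have "quotient_norm ((1 / t) *\<^sub>R t *\<^sub>R x) \<le> (1 / t) * quotient_norm (t *\<^sub>R x)"
    using x t by (intro quotient_norm_scale_le scale_mem) auto
  then have "t * quotient_norm x \<le> quotient_norm (t *\<^sub>R x)" using False t by (simp add: field_simps)
  then show ?thesis using quotient_norm_scale_le[OF x t] by simp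
qed

text \<open>
  A representative \<open>y'\<close> of \<open>y\<close> is cut down to the representative \<open>inf y' x\<close> of \<open>x\<close>.
\<close>
lemma quotient_norm_mono:
  assumes y: "y \<in> X" and x: "0 \<le> x" "x \<le> y"
  shows "quotient_norm x \<le> quotient_norm y"
proof -
  have "quotient_norm x \<le> 1 * nm y'" if "y' \<in> reps y" for y'
  proof -
    note Y' = repsD[OF that y]
    have z: "inf y' x \<in> X" using Y' x by (intro solid[OF Y'(1)]) auto
    have "x - (y - y') \<le> y'" "x - (y - y') \<le> x" using x Y'(3) by (auto simp: algebra_simps)
    then have "x - (y - y') \<le> inf y' x" by simp
    then have "x \<le> inf y' x + (y - y')" by (simp only: diff_le_eq)
    then have "x - inf y' x \<le> y - y'" by (simp only: diff_le_eq add.commute)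
    then have "vanishing (x - inf y' x)" by (intro vanishing_mono[OF Y'(4) _ _ Y'(5)]) simp_all
    then have "inf y' x \<in> reps x" using z by (simp add: reps_def)
    then show ?thesis using quotient_norm_le[of "inf y' x" x] q_mono[OF Y'(1) nonneg[OF z]] by simp
  qed
  then show ?thesis using quotient_norm_bound[OF y, of 1] by simp
qed

sublocale J: riesz_cone J quotient_norm
  by unfold_locales
    (auto intro: nonneg J_subset J_zero J_add J_scale J_solid quotient_norm_nonneg quotient_norm_scale quotient_norm_add quotient_norm_mono)

lemma quotient_norm_vanishing: "y \<in> X \<Longrightarrow> vanishing y \<Longrightarrow> quotient_norm y = 0"
  using quotient_norm_le[of 0 y] quotient_norm_nonneg[of y] nonneg[of y] zero_mem q_zero by (simp add: reps_def)

lemma pos_map_J: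
  assumes T: "pos_map T" and TJ: "\<And>y. y \<in> J \<Longrightarrow> T y \<in> J"
    and Tn: "\<And>n. n \<in> X \<Longrightarrow> vanishing n \<Longrightarrow> vanishing (T n)"
  shows "J.pos_map T"
proof -
  obtain M where M: "1 \<le> M" "\<And>x. x \<in> X \<Longrightarrow> nm (T x) \<le> M * nm x" using pos_map_bound[OF T] by metis
  have "quotient_norm (T y) \<le> M * quotient_norm y" if "y \<in> J" for y
  proof (rule quotient_norm_bound)
    show y: "y \<in> X" by (rule J_subset[OF that])
    show "0 \<le> M" using M(1) by simp
    fix y' assume "y' \<in> reps y"
    note Y' = repsD[OF this y]
    have "T y = T y' + T (y - y')" using pos_map_add[OF T Y'(1,4)] by simp
    then have "T y' \<in> reps (T y)"
      using Tn[OF Y'(4,5)] pos_map_mem[OF T Y'(1)] nonneg[OF pos_map_mem[OF T Y'(4)]]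
      by (simp add: reps_def)
    then show "quotient_norm (T y) \<le> M * nm y'" using quotient_norm_le[of "T y'"] M(2)[OF Y'(1)] by (blast intro: order_trans)
  qed
  then show ?thesis
    using TJ pos_map_add[OF T] pos_map_scale[OF T] J_subset unfolding J.pos_map_def by blast
qed

lemma pos_functional_J: "J.pos_functional \<phi>"
proof -
  obtain M where M: "1 \<le> M" "\<And>x. x \<in> X \<Longrightarrow> \<phi> x \<le> M * nm x" using pos_functional_bound[OF \<phi>] by metis
  have "\<phi> y \<le> M * quotient_norm y" if "y \<in> J" for y
  proof (rule quotient_norm_bound)
    show y: "y \<in> X" by (rule J_subset[OF that])
    show "0 \<le> M" using M(1) by simp
    fix y' assume "y' \<in> reps y"
    note Y' = repsD[OF this y]
    have "\<phi> (y - y') = 0" using Y'(5)[unfolded vanishing_def, rule_format, of 0 0] by simp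
    then have "\<phi> y = \<phi> y'" using pos_functional_add[OF \<phi> Y'(1,4)] by simp
    then show "\<phi> y \<le> M * nm y'" using M(2)[OF Y'(1)] by simp
  qed
  then show ?thesis
    using pos_functional_nonneg[OF \<phi>] pos_functional_add[OF \<phi>] pos_functional_scale[OF \<phi>] J_subset
    unfolding J.pos_functional_def by blast
qed

text \<open>Both halves of irreducibility hold by construction, one because of the seminorm and one because of \<open>J\<close>.\<close>
lemma irreducible_J: "irreducible_commutator J quotient_norm A B C e \<phi>"
proof (unfold_locales)
  show "J.pos_map A" by (rule pos_map_J[OF A J_A vanishing_A])
  show "J.pos_map B" by (rule pos_map_J[OF B J_B vanishing_B])
  show "J.pos_map C" by (rule pos_map_J[OF C J_C vanishing_C])
  show "J.pos_functional \<phi>" by (rule pos_functional_J)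
  show "e \<in> J" by (rule J_e)
  show "\<phi> e = 1" by (rule \<phi>_e)
  show "A (B y) = B (A y) + C y" "\<phi> y *\<^sub>R e \<le> y" if "y \<in> J" for y
    using that J_subset commutator atom by auto
  show "\<exists>a b. 0 < \<phi> ((A ^^ a) ((B ^^ b) x))" if x: "x \<in> J" "0 < quotient_norm x" for x
  proof (rule ccontr)
    assume "\<not> ?thesis"
    then have "vanishing x"
      using pos_functional_nonneg[OF word J_subset[OF x(1)]]
      unfolding vanishing_def by (metis order_antisym not_less)
    then show False using quotient_norm_vanishing J_subset x by simp
  qed
  fix Q :: "'a \<Rightarrow> bool" and z
  assume Q: "Q e" "\<And>y. y \<in> J \<Longrightarrow> Q y \<Longrightarrow> Q (A y)" "\<And>y. y \<in> J \<Longrightarrow> Q y \<Longrightarrow> Q (B y)"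
    "\<And>y y'. y \<in> J \<Longrightarrow> y' \<in> J \<Longrightarrow> Q y \<Longrightarrow> Q y' \<Longrightarrow> Q (y + y')"
    "\<And>y t. y \<in> J \<Longrightarrow> 0 \<le> t \<Longrightarrow> Q y \<Longrightarrow> Q (t *\<^sub>R y)"
    and Qap: "\<And>y. y \<in> J \<Longrightarrow> (\<And>\<eta>. 0 < \<eta> \<Longrightarrow> \<exists>y'\<in>J. \<exists>u\<in>J. Q y' \<and> y \<le> y' + u \<and> quotient_norm u < \<eta>) \<Longrightarrow> Q y"
    and "z \<in> J"
  show "Q z" using \<open>z \<in> J\<close>
  proof (induction rule: J.induct)
    case (J_approx y)
    have y: "y \<in> J"
      using J_approx by (intro J.J_approx) blast+
    show ?case
    proof (rule Qap[OF y])
      fix \<eta> :: real assume "0 < \<eta>"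
      then obtain y' u where y': "y' \<in> J" "Q y'" and u: "u \<in> X" "y \<le> y' + u" "nm u < \<eta>"
        using J_approx(2) by blast
      have y0: "0 \<le> y" "0 \<le> u" using nonneg J_approx(1) u(1) by auto
      have i: "inf u y \<in> J" by (rule J_solid[OF y]) (use y0 in auto)
      have "y - y' \<le> inf u y"
        using u(2) nonneg[OF J_subset[OF y'(1)]] by (auto simp: algebra_simps)
      then have "y \<le> y' + inf u y" by (simp only: diff_le_eq add.commute)
      moreover have "quotient_norm (inf u y) \<le> nm u"
        using order_trans[OF quotient_norm_mono[OF u(1)] quotient_norm_le_nm[OF u(1)], of "inf u y"] y0 by simp
      ultimately show "\<exists>y'\<in>J. \<exists>u\<in>J. Q y' \<and> y \<le> y' + u \<and> quotient_norm u < \<eta>"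
        using y' i u(3) by (meson le_less_trans)
    qed
  qed (auto intro: Q)
qed

text \<open>
  A sequence bounded in the quotient norm is replaced by representatives bounded in the original norm. The
  differences vanish, and so do their images; the errors are truncated so as to remain in \<open>J\<close>.
\<close>
lemma compact_map_J:
  assumes K: "compact_map T" and T: "pos_map T" and TJ: "\<And>y. y \<in> J \<Longrightarrow> T y \<in> J"
    and Tn: "\<And>n. n \<in> X \<Longrightarrow> vanishing n \<Longrightarrow> vanishing (T n)"
  shows "J.compact_map T"
  unfolding J.compact_map_def
proof (intro allI impI)
  fix s assume s: "\<forall>m::nat. s m \<in> J \<and> quotient_norm (s m) \<le> 1"
  have sX: "s m \<in> X" for m using s J_subset by blast
  have "\<exists>s'. s' \<in> reps (s m) \<and> nm s' < 2" for m
    by (rule quotient_norm_approx[OF sX, of m 2]) (use s in \<open>auto intro: le_less_trans\<close>)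
  then obtain s' where s': "\<And>m. s' m \<in> reps (s m)" "\<And>m. nm (s' m) < 2" by metis
  note S' = repsD[OF s'(1) sX]
  have s'J: "s' m \<in> J" for m using J_solid[of "s m"] s S'(2,3) by blast
  define h where "h m = (1/2) *\<^sub>R s' m" for m
  have h: "h m \<in> X \<and> nm (h m) \<le> 1" for m
    using q_scale[OF S'(1), of "1/2" m] s'(2)[of m] scale_mem[OF S'(1), of "1/2" m] by (simp add: h_def)
  then obtain \<sigma> y u where \<sigma>: "strict_mono (\<sigma> :: nat \<Rightarrow> nat)" and y: "y \<in> X"
    and u: "\<And>m. u m \<in> X" "\<And>m. T (h (\<sigma> m)) \<le> y + u m" "\<And>m. y \<le> T (h (\<sigma> m)) + u m"
    and ulim: "(\<lambda>m. nm (u m)) \<longlonglongrightarrow> 0"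
    using K unfolding compact_map_def by metis
  have hJ: "h m \<in> J" for m unfolding h_def using s'J by (intro J_scale) auto
  have yJ: "y \<in> J"
  proof (rule J_approx[OF y], intro allI impI)
    fix \<eta> :: real assume "0 < \<eta>"
    then obtain m where "norm (nm (u m) - 0) < \<eta>" using LIMSEQ_D[OF ulim, of \<eta>] by blast
    then show "\<exists>y'. y' \<in> J \<and> (\<exists>u\<in>X. y \<le> y' + u \<and> nm u < \<eta>)"
      using u(1,3) TJ[OF hJ] by (intro exI[of _ "T (h (\<sigma> m))"] conjI bexI[of _ "u m"]) auto
  qed
  define d where "d m = s (\<sigma> m) - s' (\<sigma> m)" for m
  define w where "w m = inf (2 *\<^sub>R u m) (T (s' (\<sigma> m)) + 2 *\<^sub>R y)" for m
  have Th: "T (s' m) = 2 *\<^sub>R T (h m)" for m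
    unfolding h_def using pos_map_scale[OF T S'(1), of "1/2"] by simp
  have dX: "d m \<in> X" and dn: "vanishing (d m)" for m using S'(4,5) by (auto simp: d_def)
  have dJ: "d m \<in> J" for m
    using J_solid[of "s (\<sigma> m)" "d m"] s nonneg[OF dX] S'(2) by (auto simp: d_def)
  have Ts: "T (s (\<sigma> m)) = T (s' (\<sigma> m)) + T (d m)" for m
    using pos_map_add[OF T S'(1) dX, of "\<sigma> m" m] by (simp add: d_def)
  have nn: "0 \<le> T (s' (\<sigma> m))" "0 \<le> y" "0 \<le> u m" "0 \<le> T (d m)" for m
    using nonneg pos_map_mem[OF T] S'(1) y u(1) dX by auto
  have u2: "2 *\<^sub>R u m \<in> X" for m using u(1) by (intro scale_mem) auto
  have y2: "0 \<le> 2 *\<^sub>R y" using nn by (intro scaleR_nonneg_nonneg) auto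
  have u2': "0 \<le> 2 *\<^sub>R u m" for m using nn by (intro scaleR_nonneg_nonneg) auto
  have bJ: "T (s' (\<sigma> m)) + 2 *\<^sub>R y \<in> J" for m
    by (rule J_add[OF TJ[OF s'J] J_scale[OF yJ]]) simp
  have wJ: "w m \<in> J" for m
    unfolding w_def using u2' add_nonneg_nonneg[OF nn(1) y2] by (intro J_solid[OF bJ[of m]]) auto
  have two: "2 *\<^sub>R a \<le> 2 *\<^sub>R b + 2 *\<^sub>R c" if "a \<le> b + c" for a b c :: 'a
    using scaleR_left_mono[OF that, of 2] by (simp add: scaleR_add_right)
  have w1: "T (s' (\<sigma> m)) \<le> 2 *\<^sub>R y + w m" for m
  proof -
    have "T (s' (\<sigma> m)) - 2 *\<^sub>R y \<le> 2 *\<^sub>R u m"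
      using two[OF u(2)[of m]] by (simp add: Th algebra_simps)
    moreover have "T (s' (\<sigma> m)) - 2 *\<^sub>R y \<le> T (s' (\<sigma> m)) + 2 *\<^sub>R y"
      using add_nonneg_nonneg[OF y2 y2] by (simp add: algebra_simps)
    ultimately have "T (s' (\<sigma> m)) - 2 *\<^sub>R y \<le> w m" by (simp add: w_def)
    then show ?thesis by (simp add: algebra_simps)
  qed
  have w2: "2 *\<^sub>R y \<le> T (s' (\<sigma> m)) + w m" for m
  proof -
    have "2 *\<^sub>R y - T (s' (\<sigma> m)) \<le> 2 *\<^sub>R u m"
      using two[OF u(3)[of m]] by (simp add: Th algebra_simps)
    moreover have "2 *\<^sub>R y - T (s' (\<sigma> m)) \<le> T (s' (\<sigma> m)) + 2 *\<^sub>R y"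
      using add_nonneg_nonneg[OF nn(1) nn(1)] by (simp add: algebra_simps)
    ultimately have "2 *\<^sub>R y - T (s' (\<sigma> m)) \<le> w m" by (simp add: w_def)
    then show ?thesis by (simp add: algebra_simps)
  qed
  have q_le: "quotient_norm (w m + T (d m)) \<le> 2 * nm (u m)" for m
  proof -
    have "quotient_norm (w m + T (d m)) \<le> quotient_norm (w m) + quotient_norm (T (d m))"
      using J_subset wJ pos_map_mem[OF T dX] by (intro quotient_norm_add) auto
    moreover have "quotient_norm (w m) \<le> nm (2 *\<^sub>R u m)"
      using order_trans[OF quotient_norm_mono[OF u2] quotient_norm_le_nm[OF u2], of "w m"] J.nonneg[OF wJ]
      by (simp add: w_def)
    moreover have "quotient_norm (T (d m)) = 0"
      using quotient_norm_vanishing[OF pos_map_mem[OF T dX] Tn[OF dX dn]] .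
    ultimately show ?thesis using q_scale[OF u(1), of 2 m] by simp
  qed
  show "\<exists>\<sigma> y u. strict_mono \<sigma> \<and> y \<in> J \<and> (\<forall>m. u m \<in> J \<and> T (s (\<sigma> m)) \<le> y + u m \<and> y \<le> T (s (\<sigma> m)) + u m) \<and>
      (\<lambda>m. quotient_norm (u m)) \<longlonglongrightarrow> 0"
  proof (intro exI conjI allI)
    show "strict_mono \<sigma>" by (rule \<sigma>)
    show "2 *\<^sub>R y \<in> J" using yJ by (intro J_scale) auto
    fix m
    show "w m + T (d m) \<in> J" using wJ TJ[OF dJ] by (rule J_add)
    show "T (s (\<sigma> m)) \<le> 2 *\<^sub>R y + (w m + T (d m))"
      using w1[of m] by (simp add: Ts add.assoc[symmetric])
    show "2 *\<^sub>R y \<le> T (s (\<sigma> m)) + (w m + T (d m))"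
      using add_increasing2[OF add_nonneg_nonneg[OF nn(4) nn(4)] w2[of m]] by (simp add: Ts algebra_simps)
  next
    show "(\<lambda>m. quotient_norm (w m + T (d m))) \<longlonglongrightarrow> 0"
    proof (rule null_sandwich)
      show "0 \<le> quotient_norm (w m + T (d m))" for m
        using J_subset[OF wJ] pos_map_mem[OF T dX] by (intro quotient_norm_nonneg add_mem)
      show "quotient_norm (w m + T (d m)) \<le> 2 * nm (u m)" for m by (rule q_le)
      show "(\<lambda>m. 2 * nm (u m)) \<longlonglongrightarrow> 0" by (rule tendsto_mult_right_zero[OF ulim])
    qed
  qed
qed

theorem no_cycle:
  assumes K: "compact_map A \<or> compact_map B" and n: "0 < n" and \<delta>: "0 < \<delta>"
  shows "\<not> \<delta> *\<^sub>R e \<le> (C ^^ n) e"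
proof
  assume cycle: "\<delta> *\<^sub>R e \<le> (C ^^ n) e"
  note compact_A = compact_map_J[OF _ A J_A vanishing_A]
    and compact_B = compact_map_J[OF _ B J_B vanishing_B]
  interpret irreducible_commutator J quotient_norm A B C e \<phi> by (rule irreducible_J)
  show False
    using K
  proof
    assume "compact_map A"
    then show False
      using no_cycle_if_left_factor_compact[OF compact_A n \<delta> cycle] by blast
  next
    assume "compact_map B"
    then show False
      using no_cycle_if_right_factor_compact[OF compact_B n \<delta> cycle] by blast
  qed
qed

end

section \<open>Sequences as an ordered vector space\<close>

text \<open>Pointwise scaling and order turn the real sequences into an instance of the classes used above.\<close>
instantiation "fun" :: (type, real_vector) real_vector
begin

definition scaleR_fun :: "real \<Rightarrow> ('a \<Rightarrow> 'b) \<Rightarrow> 'a \<Rightarrow> 'b" where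
  "scaleR_fun t f = (\<lambda>i. t *\<^sub>R f i)"

instance by standard (simp_all add: scaleR_fun_def fun_eq_iff algebra_simps)

end

instance "fun" :: (type, ordered_ab_semigroup_add) ordered_ab_semigroup_add
  by standard (auto simp: le_fun_def intro: add_left_mono)

instance "fun" :: (type, ordered_ab_group_add) ordered_ab_group_add ..

instance "fun" :: (type, ordered_real_vector) ordered_real_vector
  by standard (auto simp: le_fun_def scaleR_fun_def intro: scaleR_left_mono scaleR_right_mono)

lemma scaleR_fun_apply [simp]: "(t *\<^sub>R f) i = t *\<^sub>R f i"
  by (simp add: scaleR_fun_def)

section \<open>The sequence spaces and their positive cones\<close>

lemma lp_iff_summable:
  assumes "p \<noteq> \<infinity>"
  shows "x \<in> lp p \<longleftrightarrow> summable (\<lambda>i. cmod (x i) powr enn2real p)"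
  using assms by (simp add: lp_def)

lemma lp_infinity: "x \<in> lp \<infinity> \<longleftrightarrow> bdd_above (range (\<lambda>i. cmod (x i)))"
  by (auto simp: lp_def bounded_iff bdd_above_def)

text \<open>The norm is a lattice norm, and the space is an ideal of the space of all sequences.\<close>
lemma lp_domination:
  assumes p: "1 \<le> p" and y: "y \<in> lp p" and le: "\<And>i. cmod (x i) \<le> cmod (y i)"
  shows "x \<in> lp p" and "lp_norm p x \<le> lp_norm p y"
proof -
  have "x \<in> lp p \<and> lp_norm p x \<le> lp_norm p y"
  proof (cases "p = \<infinity>")
    case True
    have b_y: "bdd_above (range (\<lambda>i. cmod (y i)))" using y unfolding True lp_infinity .
    then obtain M where "\<And>i. cmod (y i) \<le> M" by (auto simp: bdd_above_def)
    then have x: "x \<in> lp p"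
      unfolding True lp_infinity by (intro bdd_aboveI2[of _ _ M] order_trans[OF le])
    have "(SUP i. cmod (x i)) \<le> (SUP i. cmod (y i))"
      using le b_y by (intro cSUP_mono) auto
    then show ?thesis using x y True by (simp add: lp_norm_def)
  next
    case False
    define P where "P = enn2real p"
    have P: "1 \<le> P" using False p enn2real_ge_1 by (simp add: P_def)
    have sy: "summable (\<lambda>i. cmod (y i) powr P)" using y False by (simp add: lp_iff_summable P_def)
    have l: "cmod (x i) powr P \<le> cmod (y i) powr P" for i using le P by (intro powr_mono2) auto
    have sx: "summable (\<lambda>i. cmod (x i) powr P)"
      by (rule summable_comparison_test'[OF sy, of 0]) (use l in auto)
    have "(\<Sum>i. cmod (x i) powr P) powr (1 / P) \<le> (\<Sum>i. cmod (y i) powr P) powr (1 / P)"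
      using P by (intro powr_mono2 suminf_le l sx sy suminf_nonneg) auto
    then show ?thesis using sx sy False by (simp add: lp_norm_def lp_iff_summable P_def)
  qed
  then show "x \<in> lp p" "lp_norm p x \<le> lp_norm p y" by auto
qed

lemma lp_norm_cong:
  assumes "1 \<le> p" "y \<in> lp p" "\<And>i. cmod (x i) = cmod (y i)"
  shows "lp_norm p x = lp_norm p y"
  using lp_domination[OF assms(1,2), of x] lp_domination[OF assms(1), of x y] assms(3)
  by (simp add: order_antisym)

lemma lp_coordinate_le:
  assumes p: "1 \<le> p" and x: "x \<in> lp p"
  shows "cmod (x i) \<le> lp_norm p x"
proof (cases "p = \<infinity>")
  case True
  have "bdd_above (range (\<lambda>i. cmod (x i)))" using x unfolding True lp_infinity .
  then show ?thesis using x True by (auto simp: lp_norm_def intro: cSUP_upper)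
next
  case False
  define P where "P = enn2real p"
  have P: "1 \<le> P" using False p enn2real_ge_1 by (simp add: P_def)
  have sx: "summable (\<lambda>i. cmod (x i) powr P)" using x False by (simp add: lp_iff_summable P_def)
  have "cmod (x i) powr P = (\<Sum>j\<in>{i}. cmod (x j) powr P)" by simp
  also have "\<dots> \<le> (\<Sum>j. cmod (x j) powr P)" using sx by (intro sum_le_suminf) auto
  finally have "(cmod (x i) powr P) powr (1 / P) \<le> (\<Sum>j. cmod (x j) powr P) powr (1 / P)"
    using P by (intro powr_mono2) auto
  then show ?thesis using x False P by (simp add: lp_norm_def P_def powr_powr)
qed

lemma lp_scale:
  assumes p: "1 \<le> p" and x: "x \<in> lp p"
  shows "(\<lambda>i. a * x i) \<in> lp p" and "lp_norm p (\<lambda>i. a * x i) = cmod a * lp_norm p x"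
proof -
  have "(\<lambda>i. a * x i) \<in> lp p \<and> lp_norm p (\<lambda>i. a * x i) = cmod a * lp_norm p x"
  proof (cases "p = \<infinity>")
    case True
    have b: "bdd_above (range (\<lambda>i. cmod (x i)))" using x unfolding True lp_infinity .
    then obtain K where K: "\<And>i. cmod (x i) \<le> K" by (auto simp: bdd_above_def)
    have m: "(\<lambda>i. a * x i) \<in> lp p"
      unfolding True lp_infinity
      by (rule bdd_aboveI[of _ "cmod a * K"]) (auto simp: norm_mult intro!: mult_left_mono K)
    have "(SUP i. cmod a * cmod (x i)) = cmod a * (SUP i. cmod (x i))"
    proof -
      have "continuous (at_left (SUP i. cmod (x i))) (\<lambda>t. cmod a * t)" by (intro continuous_intros)
      then show ?thesis
        using continuous_at_Sup_mono[of "\<lambda>t. cmod a * t" "range (\<lambda>i. cmod (x i))"] b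
        by (simp add: mono_def mult_left_mono image_image)
    qed
    then show ?thesis using m x True by (simp add: lp_norm_def norm_mult)
  next
    case False
    define P where "P = enn2real p"
    have P: "1 \<le> P" using False p enn2real_ge_1 by (simp add: P_def)
    have sx: "summable (\<lambda>i. cmod (x i) powr P)" using x False by (simp add: lp_iff_summable P_def)
    have e: "cmod (a * x i) powr P = cmod a powr P * cmod (x i) powr P" for i
      by (simp add: norm_mult powr_mult)
    have s: "summable (\<lambda>i. cmod (a * x i) powr P)" unfolding e by (rule summable_mult[OF sx])
    have "(\<Sum>i. cmod (a * x i) powr P) powr (1 / P) = (cmod a powr P * (\<Sum>i. cmod (x i) powr P)) powr (1 / P)"
      unfolding e suminf_mult[OF sx] ..
    also have "\<dots> = cmod a * (\<Sum>i. cmod (x i) powr P) powr (1 / P)"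
      using P suminf_nonneg[OF sx] by (simp add: powr_mult powr_powr)
    finally show ?thesis using s sx False by (simp add: lp_norm_def lp_iff_summable P_def)
  qed
  then show "(\<lambda>i. a * x i) \<in> lp p" "lp_norm p (\<lambda>i. a * x i) = cmod a * lp_norm p x" by auto
qed

lemma lp_diff:
  assumes "1 \<le> p" "x \<in> lp p" "y \<in> lp p"
  shows "(\<lambda>i. x i - y i) \<in> lp p"
  using lp_minkowski(1)[OF assms(1,2) lp_scale(1)[OF assms(1,3), of "-1"]] by simp

text \<open>
  The inclusion of the absolutely summable sequences in every \<open>lp p\<close>. It is the reason why a single summability
  hypothesis serves all \<open>p\<close>.
\<close>
lemma absolutely_summable_lp:
  assumes p: "1 \<le> p" and s: "summable (\<lambda>i. cmod (x i))"
  shows "x \<in> lp p" and "lp_norm p x \<le> (\<Sum>i. cmod (x i))"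
proof -
  define w where "w = (\<Sum>i. cmod (x i))"
  have le: "cmod (x i) \<le> w" for i
    using sum_le_suminf[OF s, of "{i}"] by (simp add: w_def)
  have w0: "0 \<le> w" using order_trans[OF norm_ge_zero le] .
  have "x \<in> lp p \<and> lp_norm p x \<le> w"
  proof (cases "p = \<infinity>")
    case True
    have "x \<in> lp p" unfolding True lp_infinity by (rule bdd_aboveI[of _ w]) (use le in auto)
    then show ?thesis using True le by (auto simp: lp_norm_def intro: cSUP_least)
  next
    case False
    define P where "P = enn2real p"
    have P: "1 \<le> P" using False p enn2real_ge_1 by (simp add: P_def)
    have l: "cmod (x i) powr P \<le> w powr (P - 1) * cmod (x i)" for i
    proof (cases "x i = 0")
      case False
      then have "cmod (x i) powr P = cmod (x i) powr (P - 1) * cmod (x i)"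
        using powr_add[of "cmod (x i)" "P - 1" 1] by simp
      also have "\<dots> \<le> w powr (P - 1) * cmod (x i)"
        using P le by (intro mult_right_mono powr_mono2) auto
      finally show ?thesis .
    qed simp
    have sm: "summable (\<lambda>i. w powr (P - 1) * cmod (x i))" by (rule summable_mult[OF s])
    have sx: "summable (\<lambda>i. cmod (x i) powr P)"
      by (rule summable_comparison_test'[OF sm, of 0]) (use l in auto)
    have "(\<Sum>i. cmod (x i) powr P) \<le> w powr (P - 1) * w"
      using suminf_le[OF l sx sm] suminf_mult[OF s] by (simp add: w_def)
    also have "\<dots> = w powr P"
      using w0 powr_add[of w "P - 1" 1] by (cases "w = 0") auto
    finally have "(\<Sum>i. cmod (x i) powr P) powr (1 / P) \<le> (w powr P) powr (1 / P)"
      using P by (intro powr_mono2 suminf_nonneg sx) auto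
    then show ?thesis using sx False P w0 by (simp add: lp_norm_def lp_iff_summable P_def powr_powr)
  qed
  then show "x \<in> lp p" "lp_norm p x \<le> (\<Sum>i. cmod (x i))" by (auto simp: w_def)
qed

lemma zero_in_lp: "1 \<le> p \<Longrightarrow> (\<lambda>i. 0) \<in> lp p"
  using absolutely_summable_lp[of p "\<lambda>i. 0"] by simp

definition cplx :: "(nat \<Rightarrow> real) \<Rightarrow> nat \<Rightarrow> complex" where
  "cplx x = (\<lambda>i. complex_of_real (x i))"

definition lp_cone :: "ennreal \<Rightarrow> (nat \<Rightarrow> real) set" where
  "lp_cone p = {x. 0 \<le> x \<and> cplx x \<in> lp p}"

definition cone_norm :: "ennreal \<Rightarrow> (nat \<Rightarrow> real) \<Rightarrow> real" where
  "cone_norm p x = lp_norm p (cplx x)"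

definition real_part :: "((nat \<Rightarrow> complex) \<Rightarrow> (nat \<Rightarrow> complex)) \<Rightarrow> (nat \<Rightarrow> real) \<Rightarrow> nat \<Rightarrow> real" where
  "real_part T x = (\<lambda>i. Re (T (cplx x) i))"

lemma cplx_apply [simp]: "cplx x i = complex_of_real (x i)"
  by (simp add: cplx_def)

lemma cplx_add: "cplx (x + y) = (\<lambda>i. cplx x i + cplx y i)"
  and cplx_scale: "cplx (t *\<^sub>R x) = (\<lambda>i. complex_of_real t * cplx x i)"
  by (auto simp: cplx_def)

lemma lp_cone_lp: "x \<in> lp_cone p \<Longrightarrow> cplx x \<in> lp p"
  and lp_cone_nonneg: "x \<in> lp_cone p \<Longrightarrow> 0 \<le> x i"
  by (auto simp: lp_cone_def le_fun_def)

lemma lp_coneI: "(\<And>i. 0 \<le> x i) \<Longrightarrow> cplx x \<in> lp p \<Longrightarrow> x \<in> lp_cone p"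
  by (auto simp: lp_cone_def le_fun_def)

lemma riesz_cone_lp:
  assumes p: "1 \<le> p"
  shows "riesz_cone (lp_cone p) (cone_norm p)"
proof
  fix x y :: "nat \<Rightarrow> real" and t :: real
  show "0 \<in> lp_cone p" using zero_in_lp[OF p] by (intro lp_coneI) (auto simp: cplx_def)
  show "x \<in> lp_cone p \<Longrightarrow> 0 \<le> x" by (simp add: lp_cone_def)
  show "x \<in> lp_cone p \<Longrightarrow> y \<in> lp_cone p \<Longrightarrow> x + y \<in> lp_cone p"
    using lp_minkowski(1)[OF p lp_cone_lp lp_cone_lp, of x y] by (auto simp: lp_cone_def cplx_add)
  show "x \<in> lp_cone p \<Longrightarrow> 0 \<le> t \<Longrightarrow> t *\<^sub>R x \<in> lp_cone p"
    using lp_scale(1)[OF p lp_cone_lp, of x] by (auto simp: lp_cone_def cplx_scale scaleR_nonneg_nonneg)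
  show "0 \<le> cone_norm p x" by (simp add: cone_norm_def lp_norm_nonneg)
  show "x \<in> lp_cone p \<Longrightarrow> 0 \<le> t \<Longrightarrow> cone_norm p (t *\<^sub>R x) = t * cone_norm p x"
    using lp_scale(2)[OF p lp_cone_lp, of x t] by (simp add: cone_norm_def cplx_scale)
  show "x \<in> lp_cone p \<Longrightarrow> y \<in> lp_cone p \<Longrightarrow> cone_norm p (x + y) \<le> cone_norm p x + cone_norm p y"
    using lp_minkowski(2)[OF p lp_cone_lp lp_cone_lp, of x y] by (simp add: cone_norm_def cplx_add)
  assume y: "y \<in> lp_cone p" and x: "0 \<le> x" "x \<le> y"
  have le: "cmod (cplx x i) \<le> cmod (cplx y i)" for i
    using x lp_cone_nonneg[OF y, of i] by (auto simp: le_fun_def)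
  show "x \<in> lp_cone p" using lp_domination(1)[OF p lp_cone_lp[OF y] le] x(1) unfolding lp_cone_def by blast
  show "cone_norm p x \<le> cone_norm p y"
    unfolding cone_norm_def by (rule lp_domination(2)[OF p lp_cone_lp[OF y] le])
qed

lemma bounded_operatorD:
  assumes "bounded_operator p T"
  shows "x \<in> lp p \<Longrightarrow> T x \<in> lp p"
    and "x \<in> lp p \<Longrightarrow> y \<in> lp p \<Longrightarrow> T (\<lambda>i. x i + y i) = (\<lambda>i. T x i + T y i)"
    and "x \<in> lp p \<Longrightarrow> T (\<lambda>i. a * x i) = (\<lambda>i. a * T x i)"
  using assms unfolding bounded_operator_def by blast+

lemma bounded_operator_norm:
  assumes "bounded_operator p T"
  obtains K where "1 \<le> K" "\<And>x. x \<in> lp p \<Longrightarrow> lp_norm p (T x) \<le> K * lp_norm p x"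
proof -
  obtain K where K: "\<And>x. x \<in> lp p \<Longrightarrow> lp_norm p (T x) \<le> K * lp_norm p x"
    using assms unfolding bounded_operator_def by blast
  have "lp_norm p (T x) \<le> max 1 K * lp_norm p x" if "x \<in> lp p" for x
    using K[OF that] mult_right_mono[of K "max 1 K" "lp_norm p x"] lp_norm_nonneg[of p x] by linarith
  then show ?thesis using that[of "max 1 K"] by auto
qed

lemma positive_operator_real_part:
  assumes T: "positive_operator p T" and x: "x \<in> lp_cone p"
  shows "T (cplx x) = cplx (real_part T x)" and "real_part T x \<in> lp_cone p"
proof -
  have "\<forall>i. cplx x i \<in> \<real>\<^sub>\<ge>\<^sub>0"
    using lp_cone_nonneg[OF x] by (auto simp: nonneg_Reals_of_real_iff)
  then have nn: "T (cplx x) i \<in> \<real>\<^sub>\<ge>\<^sub>0" for i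
    using T lp_cone_lp[OF x] unfolding positive_operator_def by blast
  show eq: "T (cplx x) = cplx (real_part T x)"
  proof
    fix i
    show "T (cplx x) i = cplx (real_part T x) i"
      using nn[of i] by (auto simp: real_part_def complex_nonneg_Reals_iff complex_eq_iff)
  qed
  have "cplx (real_part T x) \<in> lp p"
    unfolding eq[symmetric] using T x by (auto simp: positive_operator_def intro: bounded_operatorD(1) lp_cone_lp)
  then show "real_part T x \<in> lp_cone p"
    using nn by (intro lp_coneI) (auto simp: real_part_def complex_nonneg_Reals_iff)
qed

lemma pos_map_real_part:
  assumes p: "1 \<le> p" and T: "positive_operator p T"
  shows "riesz_cone.pos_map (lp_cone p) (cone_norm p) (real_part T)"
proof -
  interpret riesz_cone "lp_cone p" "cone_norm p" by (rule riesz_cone_lp[OF p])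
  have b: "bounded_operator p T" using T by (simp add: positive_operator_def)
  obtain K where K: "\<And>x. x \<in> lp p \<Longrightarrow> lp_norm p (T x) \<le> K * lp_norm p x"
    using bounded_operator_norm[OF b] by metis
  show ?thesis
    unfolding pos_map_def
  proof (intro conjI ballI allI impI exI[of _ K])
    fix x assume x: "x \<in> lp_cone p"
    show "real_part T x \<in> lp_cone p" by (rule positive_operator_real_part(2)[OF T x])
    show "cone_norm p (real_part T x) \<le> K * cone_norm p x"
      using K[OF lp_cone_lp[OF x]] positive_operator_real_part(1)[OF T x] by (simp add: cone_norm_def)
    show "real_part T (x + y) = real_part T x + real_part T y" if "y \<in> lp_cone p" for y
      using bounded_operatorD(2)[OF b lp_cone_lp[OF x] lp_cone_lp[OF that]]
      by (simp add: real_part_def cplx_add fun_eq_iff)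
    show "real_part T (t *\<^sub>R x) = t *\<^sub>R real_part T x" for t
      using bounded_operatorD(3)[OF b lp_cone_lp[OF x], of "complex_of_real t"]
      by (simp add: real_part_def cplx_scale fun_eq_iff)
  qed
qed

text \<open>
  Compactness in the metric of \<open>lp p\<close> yields compactness on the cone: norm limits are limits in every
  coordinate, so a limit of nonnegative sequences is nonnegative, and the absolute difference is the error bound.
\<close>
lemma compact_map_real_part:
  assumes p: "1 \<le> p" and T: "positive_operator p T" and K: "compact_operator p T"
  shows "riesz_cone.compact_map (lp_cone p) (cone_norm p) (real_part T)"
proof -
  interpret riesz_cone "lp_cone p" "cone_norm p" by (rule riesz_cone_lp[OF p])
  interpret M: Metric_space "lp p" "lp_dist p" by (rule Metric_space_lp[OF p])
  have b: "bounded_operator p T" using T by (simp add: positive_operator_def)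
  let ?B = "{x \<in> lp p. lp_norm p x \<le> 1}"
  define S where "S = M.mtopology closure_of (T ` ?B)"
  have S: "compactin M.mtopology S" using K by (simp add: compact_operator_def S_def)
  have sub: "T ` ?B \<subseteq> S"
    unfolding S_def using bounded_operatorD(1)[OF b] by (intro closure_of_subset) auto
  show ?thesis
    unfolding compact_map_def
  proof (intro allI impI)
    fix s assume s: "\<forall>m::nat. s m \<in> lp_cone p \<and> cone_norm p (s m) \<le> 1"
    have "range (\<lambda>m. T (cplx (s m))) \<subseteq> S"
      using sub s lp_cone_lp by (fastforce simp: cone_norm_def)
    then obtain l \<sigma> where l: "l \<in> S" and \<sigma>: "strict_mono (\<sigma> :: nat \<Rightarrow> nat)"
      and lim: "limitin M.mtopology ((\<lambda>m. T (cplx (s m))) \<circ> \<sigma>) l sequentially"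
      using S unfolding M.compactin_sequentially by meson
    have lM: "l \<in> lp p" and d: "(\<lambda>m. lp_dist p (T (cplx (s (\<sigma> m)))) l) \<longlonglongrightarrow> 0"
      using lim by (auto simp: M.limitin_metric_dist_null o_def)
    define z where "z m = real_part T (s (\<sigma> m))" for m
    have Tz: "T (cplx (s (\<sigma> m))) = cplx (z m)" and z: "z m \<in> lp_cone p" for m
      using positive_operator_real_part[OF T] s by (auto simp: z_def)
    have dm: "(\<lambda>i. cplx (z m) i - l i) \<in> lp p" for m by (rule lp_diff[OF p lp_cone_lp[OF z] lM])
    have dist: "lp_dist p (T (cplx (s (\<sigma> m)))) l = lp_norm p (\<lambda>i. cplx (z m) i - l i)" for m
      by (simp add: Tz lp_dist_def fun_diff_def)
    have coord: "(\<lambda>m. cplx (z m) i) \<longlonglongrightarrow> l i" for i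
    proof -
      have "norm (cplx (z m) i - l i) \<le> lp_dist p (T (cplx (s (\<sigma> m)))) l" for m
        unfolding dist using lp_coordinate_le[OF p dm, of m i] by simp
      then have "(\<lambda>m. cplx (z m) i - l i) \<longlonglongrightarrow> 0"
        by (intro Lim_null_comparison[OF _ d] always_eventually allI)
      then show ?thesis by (simp add: LIM_zero_iff)
    qed
    define y where "y i = Re (l i)" for i
    have limz: "(\<lambda>m. z m i) \<longlonglongrightarrow> y i" for i
      using tendsto_Re[OF coord[of i]] by (simp add: y_def)
    have "Im (l i) = 0" for i
      using LIMSEQ_unique[OF tendsto_Im[OF coord[of i]], of 0] by simp
    then have ly: "l = cplx y" by (auto simp: y_def complex_eq_iff)
    have y: "y \<in> lp_cone p"
      using lM ly LIMSEQ_le_const[OF limz] lp_cone_nonneg[OF z] by (intro lp_coneI) auto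
    define u where "u m = (\<lambda>i. \<bar>z m i - y i\<bar>)" for m
    have cu: "cmod (cplx (u m) i) = cmod (cplx (z m) i - l i)" for m i
      by (simp add: u_def ly flip: of_real_diff)
    have u: "u m \<in> lp_cone p" for m
      using lp_domination(1)[OF p dm, of "cplx (u m)" m] cu by (intro lp_coneI) (auto simp: u_def)
    have "cone_norm p (u m) = lp_dist p (T (cplx (s (\<sigma> m)))) l" for m
      unfolding dist cone_norm_def by (rule lp_norm_cong[OF p dm cu])
    then have "(\<lambda>m. cone_norm p (u m)) \<longlonglongrightarrow> 0" using d by simp
    moreover have "real_part T (s (\<sigma> m)) \<le> y + u m" "y \<le> real_part T (s (\<sigma> m)) + u m" for m
      by (auto simp: le_fun_def u_def z_def)
    ultimately show "\<exists>\<sigma> y u. strict_mono \<sigma> \<and> y \<in> lp_cone p \<and>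
        (\<forall>m. u m \<in> lp_cone p \<and> real_part T (s (\<sigma> m)) \<le> y + u m \<and> y \<le> real_part T (s (\<sigma> m)) + u m) \<and>
        (\<lambda>m. cone_norm p (u m)) \<longlonglongrightarrow> 0"
      using \<sigma> y u by blast
  qed
qed

section \<open>Cycles of positive matrices\<close>

definition unit_seq :: "nat \<Rightarrow> nat \<Rightarrow> real" where
  "unit_seq k = (\<lambda>i. if i = k then 1 else 0)"

lemma unit_seq_lp_cone:
  assumes "1 \<le> p"
  shows "unit_seq k \<in> lp_cone p"
proof (rule lp_coneI)
  have "summable (\<lambda>i. cmod (cplx (unit_seq k) i))"
    by (rule summable_finite[of "{k}"]) (auto simp: unit_seq_def)
  then show "cplx (unit_seq k) \<in> lp p" by (rule absolutely_summable_lp(1)[OF assms])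
qed (simp add: unit_seq_def)

lemma positive_matrix_positive_operator:
  assumes T: "operator_with_matrix p T (\<lambda>i j. complex_of_real (m i j))"
    and m: "\<And>i j. 0 \<le> m i j"
  shows "positive_operator p T"
  unfolding positive_operator_def
proof (intro conjI ballI impI allI)
  show "bounded_operator p T" using T by (simp add: operator_with_matrix_def)
  fix x i assume x: "x \<in> lp p" "\<forall>i. x i \<in> \<real>\<^sub>\<ge>\<^sub>0"
  have s: "(\<lambda>j. complex_of_real (m i j) * x j) sums T x i"
    using T x(1) by (simp add: operator_with_matrix_def)
  have re: "0 \<le> Re (complex_of_real (m i j) * x j)" and im: "Im (complex_of_real (m i j) * x j) = 0" for j
    using x(2)[rule_format, of j] m[of i j] by (auto simp: complex_nonneg_Reals_iff)
  have "0 \<le> Re (T x i)" using sums_Re[OF s] re by (rule sums_le[OF _ sums_zero, rotated])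
  moreover have "Im (T x i) = 0" using sums_Im[OF s] unfolding im by (rule sums_unique2[OF _ sums_zero])
  ultimately show "T x i \<in> \<real>\<^sub>\<ge>\<^sub>0" by (simp add: complex_nonneg_Reals_iff)
qed

lemma real_part_sums:
  assumes "operator_with_matrix p T (\<lambda>i j. complex_of_real (m i j))" "x \<in> lp_cone p"
  shows "(\<lambda>j. m i j * x j) sums real_part T x i"
proof -
  have "(\<lambda>j. complex_of_real (m i j) * cplx x j) sums T (cplx x) i"
    using assms(1) lp_cone_lp[OF assms(2)] unfolding operator_with_matrix_def by blast
  from sums_Re[OF this] show ?thesis by (simp add: real_part_def)
qed

text \<open>A path of length \<open>n\<close> contributes a positive product of entries to the \<open>n\<close>-th power of the matrix.\<close>
lemma trancl_imp_power_pos: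
  assumes p: "1 \<le> p" and T: "operator_with_matrix p T (\<lambda>i j. complex_of_real (m i j))"
    and m: "\<And>i j. 0 \<le> m i j" and path: "(i, k) \<in> {(i, j). 0 < m i j}\<^sup>+"
  shows "\<exists>n>0. 0 < (real_part T ^^ n) (unit_seq k) i"
proof -
  interpret riesz_cone "lp_cone p" "cone_norm p" by (rule riesz_cone_lp[OF p])
  note R = pos_map_real_part[OF p positive_matrix_positive_operator[OF T m]]
  have step: "0 < real_part T y i" if "y \<in> lp_cone p" "0 < m i j" "0 < y j" for y i j
  proof -
    note s = real_part_sums[OF T that(1), of i]
    have "0 < m i j * y j" using that by simp
    also have "\<dots> = (\<Sum>j\<in>{j}. m i j * y j)" by simp
    also have "\<dots> \<le> (\<Sum>j. m i j * y j)"
      using m lp_cone_nonneg[OF that(1)] sums_summable[OF s] by (intro sum_le_suminf) auto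
    finally show ?thesis using sums_unique[OF s] by simp
  qed
  show ?thesis using path
  proof (induction rule: converse_trancl_induct)
    case (base i)
    then show ?case using step[OF unit_seq_lp_cone[OF p], of i k k] by (intro exI[of _ 1]) (auto simp: unit_seq_def)
  next
    case (step i j)
    then obtain n where "0 < n" "0 < (real_part T ^^ n) (unit_seq k) j" by blast
    then show ?case
      using \<open>\<And>y i j. y \<in> lp_cone p \<Longrightarrow> 0 < m i j \<Longrightarrow> 0 < y j \<Longrightarrow> 0 < real_part T y i\<close>[OF funpow_mem[OF R unit_seq_lp_cone[OF p]], of i j n k] step(1)
      by (intro exI[of _ "Suc n"]) auto
  qed
qed

lemma unit_seq_le: "0 \<le> x \<Longrightarrow> x k *\<^sub>R unit_seq k \<le> x"
  by (auto simp: unit_seq_def le_fun_def)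

lemma cycle_imp_power_ge:
  assumes p: "1 \<le> p" and T: "operator_with_matrix p T (\<lambda>i j. complex_of_real (m i j))"
    and m: "\<And>i j. 0 \<le> m i j" and cycle: "\<not> acyclic {(i, j). 0 < m i j}"
  obtains k n \<delta> where "0 < n" "0 < \<delta>" "\<delta> *\<^sub>R unit_seq k \<le> (real_part T ^^ n) (unit_seq k)"
proof -
  interpret riesz_cone "lp_cone p" "cone_norm p" by (rule riesz_cone_lp[OF p])
  note R = pos_map_real_part[OF p positive_matrix_positive_operator[OF T m]]
  obtain k where "(k, k) \<in> {(i, j). 0 < m i j}\<^sup>+" using cycle by (auto simp: acyclic_def)
  then obtain n where n: "0 < n" "0 < (real_part T ^^ n) (unit_seq k) k"
    using trancl_imp_power_pos[OF p T m] by blast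
  show ?thesis
    using that[OF n unit_seq_le[OF nonneg[OF funpow_mem[OF R unit_seq_lp_cone[OF p]]]]] .
qed

lemma commutator_acyclic:
  assumes p: "1 \<le> p" and C: "operator_with_matrix p C (\<lambda>i j. complex_of_real (c i j))"
    and c: "\<And>i j. 0 \<le> c i j"
    and A: "positive_operator p A" and B: "positive_operator p B"
    and K: "compact_operator p A \<or> compact_operator p B" and comm: "is_commutator p C A B"
  shows "acyclic {(i, j). 0 < c i j}"
proof (rule ccontr)
  assume "\<not> ?thesis"
  then obtain k n \<delta> where n: "0 < n" "0 < \<delta>" and le: "\<delta> *\<^sub>R unit_seq k \<le> (real_part C ^^ n) (unit_seq k)"
    by (rule cycle_imp_power_ge[OF p C c])
  interpret riesz_cone "lp_cone p" "cone_norm p" by (rule riesz_cone_lp[OF p])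
  note Cp = positive_matrix_positive_operator[OF C c]
  note rA = positive_operator_real_part[OF A] and rB = positive_operator_real_part[OF B]
    and rC = positive_operator_real_part[OF Cp]
  have compact: "compact_map (real_part A) \<or> compact_map (real_part B)"
    using K compact_map_real_part[OF p] A B by blast
  interpret lattice_commutator "lp_cone p" "cone_norm p" "real_part A" "real_part B" "real_part C"
    "unit_seq k" "\<lambda>x. x k"
  proof
    show "pos_map (real_part A)" "pos_map (real_part B)" "pos_map (real_part C)"
      using pos_map_real_part[OF p] A B Cp by auto
    show "unit_seq k \<in> lp_cone p" by (rule unit_seq_lp_cone[OF p])
    show "unit_seq k k = 1" by (simp add: unit_seq_def)
    have "x k \<le> 1 * cone_norm p x" if "x \<in> lp_cone p" for x
      using lp_coordinate_le[OF p lp_cone_lp[OF that], of k] lp_cone_nonneg[OF that, of k]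
      by (simp add: cone_norm_def)
    then show "pos_functional (\<lambda>x. x k)"
      unfolding pos_functional_def by (auto intro: lp_cone_nonneg intro!: exI[of _ 1])
    fix y assume y: "y \<in> lp_cone p"
    show "y k *\<^sub>R unit_seq k \<le> y" by (rule unit_seq_le[OF nonneg[OF y]])
    have "C (cplx y) = A (B (cplx y)) - B (A (cplx y))"
      using comm lp_cone_lp[OF y] by (simp add: is_commutator_def)
    then have "cplx (real_part C y) = cplx (real_part A (real_part B y)) - cplx (real_part B (real_part A y))"
      using y by (simp add: rA rB rC)
    then have "cplx (real_part C y) i = cplx (real_part A (real_part B y)) i - cplx (real_part B (real_part A y)) i" for i
      by (simp only: minus_apply)
    then show "real_part A (real_part B y) = real_part B (real_part A y) + real_part C y"
      by (simp add: fun_eq_iff flip: of_real_diff)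
  qed
  show False using no_cycle[OF compact n] le by blast
qed

text \<open>
  At the growth \<open>r\<close> of the powers, the Neumann sums provided by \<open>neumann_blow_up\<close> have large norm \<open>t\<close>, whereas
  \<open>r x - C x\<close> has norm at most \<open>(l - r) t + 2\<close> with \<open>l\<close> as close to \<open>r\<close> as desired. No bounded inverse
  is compatible with this.
\<close>
lemma quasinilpotent_acyclic:
  assumes p: "1 \<le> p" and C: "operator_with_matrix p C (\<lambda>i j. complex_of_real (c i j))"
    and c: "\<And>i j. 0 \<le> c i j" and qn: "quasinilpotent p C"
  shows "acyclic {(i, j). 0 < c i j}"
proof (rule ccontr)
  assume "\<not> ?thesis"
  then obtain k n \<delta> where n: "0 < n" "0 < \<delta>" and le: "\<delta> *\<^sub>R unit_seq k \<le> (real_part C ^^ n) (unit_seq k)"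
    by (rule cycle_imp_power_ge[OF p C c])
  interpret riesz_cone "lp_cone p" "cone_norm p" by (rule riesz_cone_lp[OF p])
  note Cp = positive_matrix_positive_operator[OF C c]
  note rC = positive_operator_real_part[OF Cp]
  let ?T = "real_part C"
  note T = pos_map_real_part[OF p Cp]
  let ?r = "growth ?T"
  note u = unit_seq_lp_cone[OF p, of k]
  have r: "0 < ?r"
  proof (rule growth_positive_if_cycle[OF T u _ n le T order_refl])
    have "1 \<le> cone_norm p (unit_seq k)"
      using lp_coordinate_le[OF p lp_cone_lp[OF u], of k] by (simp add: cone_norm_def unit_seq_def)
    then show "0 < cone_norm p (unit_seq k)" by simp
    show "cone_norm p ((?T ^^ j) (unit_seq k)) \<le> H * l ^ j * 1 ^ j * cone_norm p (unit_seq k)"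
      if "\<And>n y. y \<in> lp_cone p \<Longrightarrow> cone_norm p ((?T ^^ n) y) \<le> H * l ^ n * cone_norm p y" for H l j
      using that[OF u] by simp
  qed
  have "complex_of_real ?r \<notin> spectrum p C"
  proof
    assume "complex_of_real ?r \<in> spectrum p C"
    then have "ennreal (cmod (complex_of_real ?r)) \<le> spectral_radius p C"
      unfolding spectral_radius_def by (rule SUP_upper)
    then show False using qn r by (simp add: quasinilpotent_def)
  qed
  then obtain S where S: "bounded_operator p S"
    and inv: "\<And>x. x \<in> lp p \<Longrightarrow> S (\<lambda>i. complex_of_real ?r * x i - C x i) = x"
    unfolding spectrum_def by blast
  obtain K where K: "1 \<le> K" "\<And>x. x \<in> lp p \<Longrightarrow> lp_norm p (S x) \<le> K * lp_norm p x"
    using bounded_operator_norm[OF S] by metis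
  obtain l N y where l: "?r < l" "l < ?r + 1 / (2 * K)"
    and tail: "\<And>v. v \<in> lp_cone p \<Longrightarrow> cone_norm p ((1 / l ^ N) *\<^sub>R (?T ^^ N) v) \<le> cone_norm p v"
    and y: "y \<in> lp_cone p" "cone_norm p y \<le> 1"
    and big: "4 * K < cone_norm p (neumann ?T l N y)"
    by (rule neumann_blow_up[OF T r, of "1 / (2 * K)" "4 * K"]) (use K(1) in auto)
  have l0: "0 < l" using r l by simp
  define x where "x = neumann ?T l N y"
  define w where "w = (1 / l ^ N) *\<^sub>R (?T ^^ N) y"
  have x: "x \<in> lp_cone p" unfolding x_def by (rule neumann_mem[OF T l0 y(1)])
  have w: "w \<in> lp_cone p" unfolding w_def using l0 y(1) by (intro scale_mem funpow_mem[OF T]) auto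
  have qw: "cone_norm p w \<le> 1" unfolding w_def using tail[OF y(1)] y(2) by linarith
  have eq: "?T x + y = l *\<^sub>R x + w"
    unfolding x_def w_def neumann_commute[OF T l0 y(1)] by (rule neumann_shift[OF l0])
  define v where "v = (l - ?r) *\<^sub>R x + (y + w)"
  have v: "v \<in> lp_cone p" unfolding v_def using x y(1) w l(1) by (intro add_mem scale_mem) auto
  have "cone_norm p v \<le> cone_norm p ((l - ?r) *\<^sub>R x) + (cone_norm p y + cone_norm p w)"
    unfolding v_def using x y(1) w l(1)
    by (intro order_trans[OF q_add] add_left_mono q_add add_mem scale_mem) auto
  also have "cone_norm p ((l - ?r) *\<^sub>R x) = (l - ?r) * cone_norm p x"
    using q_scale[OF x] l(1) by simp
  also have "(l - ?r) * cone_norm p x \<le> (1 / (2 * K)) * cone_norm p x"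
    using l(2) q_nonneg[OF x] by (intro mult_right_mono) auto
  finally have qv: "cone_norm p v \<le> (1 / (2 * K)) * cone_norm p x + 2" using y(2) qw by linarith
  define z where "z = (\<lambda>i. complex_of_real ?r * cplx x i - C (cplx x) i)"
  have zle: "cmod (z i) \<le> cmod (cplx v i)" for i
  proof -
    have "?T x i + y i = l * x i + w i" using fun_cong[OF eq, of i] by simp
    then have "z i = complex_of_real (y i - w i - (l - ?r) * x i)"
      using rC(1)[OF x] by (simp add: z_def algebra_simps flip: of_real_mult of_real_diff of_real_add)
    then have "cmod (z i) = \<bar>y i - w i - (l - ?r) * x i\<bar>" by (simp only: norm_of_real)
    moreover have "0 \<le> (l - ?r) * x i" using l(1) lp_cone_nonneg[OF x] by simp
    moreover have "cmod (cplx v i) = v i" using lp_cone_nonneg[OF v, of i] by simp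
    moreover have "v i = (l - ?r) * x i + (y i + w i)" by (simp add: v_def)
    ultimately show ?thesis
      using lp_cone_nonneg[OF y(1), of i] lp_cone_nonneg[OF w, of i] by linarith
  qed
  note z = lp_domination[OF p lp_cone_lp[OF v] zle]
  have "cone_norm p x = lp_norm p (S z)"
    using inv[OF lp_cone_lp[OF x]] by (simp add: z_def cone_norm_def)
  also have "\<dots> \<le> K * lp_norm p z" by (rule K(2)[OF z(1)])
  also have "\<dots> \<le> K * ((1 / (2 * K)) * cone_norm p x + 2)"
    using order_trans[OF z(2) qv[unfolded cone_norm_def]] K(1)
    by (intro mult_left_mono) (auto simp: cone_norm_def)
  also have "\<dots> = cone_norm p x / 2 + 2 * K" using K(1) by (simp add: field_simps)
  finally show False using big by (simp add: x_def)
qed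

section \<open>Acyclic matrices\<close>

text \<open>
  The graph of \<open>m\<close> is acyclic in a quantitative sense: along each edge out of \<open>i\<close> the bounded potential \<open>a\<close>
  drops by at least \<open>\<rho> i\<close>, a fixed multiple of which dominates the sum of the \<open>i\<close>-th row.
\<close>
locale acyclic_matrix =
  fixes m :: "nat \<Rightarrow> nat \<Rightarrow> real" and a \<rho> :: "nat \<Rightarrow> real" and \<kappa> L :: real
  assumes m_nonneg: "0 \<le> m i j" and row_summable: "summable (m i)"
    and row_sum: "(\<Sum>j. m i j) \<le> \<kappa> * \<rho> i" and \<kappa>: "0 < \<kappa>"
    and \<rho>_nonneg: "0 \<le> \<rho> i" and \<rho>_summable: "summable \<rho>"
    and a_nonneg: "0 \<le> a i" and a_le: "a i \<le> L"
    and drop: "0 < m i j \<Longrightarrow> a j + \<rho> i \<le> a i"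
begin

definition matrix_op :: "(nat \<Rightarrow> complex) \<Rightarrow> nat \<Rightarrow> complex" where
  "matrix_op x i = (\<Sum>j. complex_of_real (m i j) * x j)"

lemma matrix_op_summable_norm:
  assumes "\<And>j. cmod (x j) \<le> R"
  shows "summable (\<lambda>j. cmod (complex_of_real (m i j) * x j))"
proof (rule summable_comparison_test'[OF summable_mult[OF row_summable, of R i], of 0])
  show "norm (cmod (complex_of_real (m i j) * x j)) \<le> R * m i j" for j
    using mult_left_mono[OF assms[of j] m_nonneg[of i j]] m_nonneg[of i j] by (simp add: norm_mult mult.commute)
qed

lemma matrix_op_summable:
  assumes "\<And>j. cmod (x j) \<le> R"
  shows "summable (\<lambda>j. complex_of_real (m i j) * x j)"
  by (rule summable_norm_cancel[OF matrix_op_summable_norm[OF assms]])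

lemma matrix_op_bound:
  assumes x: "\<And>j. cmod (x j) \<le> R"
  shows "cmod (matrix_op x i) \<le> R * \<kappa> * \<rho> i"
proof -
  have R: "0 \<le> R" using order_trans[OF norm_ge_zero x[of 0]] .
  have "cmod (matrix_op x i) \<le> (\<Sum>j. cmod (complex_of_real (m i j) * x j))"
    unfolding matrix_op_def by (rule summable_norm[OF matrix_op_summable_norm[OF x]])
  also have "\<dots> \<le> (\<Sum>j. R * m i j)"
    using mult_left_mono[OF x m_nonneg[of i]] m_nonneg[of i]
    by (intro suminf_le matrix_op_summable_norm[OF x] summable_mult row_summable) (auto simp: norm_mult mult.commute)
  also have "\<dots> = R * (\<Sum>j. m i j)" by (rule suminf_mult[OF row_summable])
  also have "\<dots> \<le> R * (\<kappa> * \<rho> i)" by (rule mult_left_mono[OF row_sum R])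
  finally show ?thesis by (simp add: mult.assoc)
qed

text \<open>
  In the supremum norm with weight \<open>exp (t * a i)\<close> the matrix has norm at most \<open>\<kappa> / t\<close>: passing from \<open>j\<close> to \<open>i\<close>
  gains the factor \<open>exp (- t * \<rho> i)\<close>, and \<open>\<rho> i * exp (- t * \<rho> i) \<le> 1 / t\<close>.
\<close>
lemma matrix_op_weighted_bound:
  assumes t: "0 < t" and bd: "\<And>j. cmod (x j) \<le> R0" and x: "\<And>j. cmod (x j) \<le> R * exp (t * a j)" and R: "0 \<le> R"
  shows "cmod (matrix_op x i) \<le> (\<kappa> / t) * R * exp (t * a i)"
proof -
  let ?E = "R * exp (t * (a i - \<rho> i))"
  have entry: "cmod (complex_of_real (m i j) * x j) \<le> ?E * m i j" for j
  proof (cases "m i j = 0")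
    case False
    then have "0 < m i j" using m_nonneg[of i j] by linarith
    then have "exp (t * a j) \<le> exp (t * (a i - \<rho> i))" using drop[of i j] t by simp
    then have "cmod (x j) \<le> ?E" using x[of j] mult_left_mono[of "exp (t * a j)" _ R] R by fastforce
    then have "m i j * cmod (x j) \<le> m i j * ?E" using m_nonneg by (rule mult_left_mono)
    then show ?thesis using m_nonneg[of i j] by (simp add: norm_mult mult.commute)
  qed simp
  have "cmod (matrix_op x i) \<le> (\<Sum>j. cmod (complex_of_real (m i j) * x j))"
    unfolding matrix_op_def by (rule summable_norm[OF matrix_op_summable_norm[OF bd]])
  also have "\<dots> \<le> (\<Sum>j. ?E * m i j)"
    by (intro suminf_le entry matrix_op_summable_norm[OF bd] summable_mult row_summable)
  also have "\<dots> = ?E * (\<Sum>j. m i j)" by (rule suminf_mult[OF row_summable])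
  also have "\<dots> \<le> ?E * (\<kappa> * \<rho> i)" using row_sum R by (intro mult_left_mono) auto
  also have "\<dots> = (\<kappa> * R * exp (t * a i)) * (\<rho> i / exp (t * \<rho> i))"
    by (simp add: right_diff_distrib exp_diff)
  also have "\<dots> \<le> (\<kappa> * R * exp (t * a i)) * (1 / t)"
  proof (rule mult_left_mono)
    have "t * \<rho> i \<le> exp (t * \<rho> i)" using exp_ge_add_one_self[of "t * \<rho> i"] by linarith
    then show "\<rho> i / exp (t * \<rho> i) \<le> 1 / t" using t by (simp add: field_simps)
  qed (use \<kappa> R in auto)
  finally show ?thesis by simp
qed

lemma matrix_op_add:
  assumes "\<And>j. cmod (x j) \<le> R" "\<And>j. cmod (y j) \<le> R'"
  shows "matrix_op (\<lambda>j. x j + y j) i = matrix_op x i + matrix_op y i"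
  unfolding matrix_op_def using suminf_add[OF matrix_op_summable[OF assms(1)] matrix_op_summable[OF assms(2)]]
  by (simp add: distrib_left)

lemma matrix_op_scale:
  assumes "\<And>j. cmod (x j) \<le> R"
  shows "matrix_op (\<lambda>j. s * x j) i = s * matrix_op x i"
  unfolding matrix_op_def using suminf_mult[OF matrix_op_summable[OF assms], of s i] by (simp add: mult_ac)

lemma matrix_op_diff:
  assumes "\<And>j. cmod (x j) \<le> R" "\<And>j. cmod (y j) \<le> R'"
  shows "matrix_op (\<lambda>j. x j - y j) i = matrix_op x i - matrix_op y i"
  unfolding matrix_op_def using suminf_diff[OF matrix_op_summable[OF assms(1)] matrix_op_summable[OF assms(2)]]
  by (simp add: right_diff_distrib)

text \<open>
  The choice \<open>t = 2 * \<kappa> / cmod l\<close> makes \<open>matrix_op\<close> divided by \<open>l\<close> a contraction with constant \<open>1 / 2\<close> in the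
  weighted norm, which is equivalent to the supremum norm because \<open>a\<close> is bounded.
\<close>
lemma resolvent_estimate:
  assumes l: "l \<noteq> 0" and x: "\<And>j. cmod (x j) \<le> R0" and y: "\<And>i. cmod (y i) \<le> Y"
    and eq: "\<And>i. l * x i = y i + matrix_op x i"
  shows "cmod (x i) \<le> (2 * Y / cmod l) * exp (2 * \<kappa> / cmod l * L)"
proof -
  define t where "t = 2 * \<kappa> / cmod l"
  have t: "0 < t" "\<kappa> / t = cmod l / 2" using l \<kappa> by (auto simp: t_def)
  define R where "R = (SUP i. cmod (x i) / exp (t * a i))"
  have e1: "1 \<le> exp (t * a i)" for i using t a_nonneg by simp
  have "cmod (x i) / exp (t * a i) \<le> R0" for i
    using x[of i] e1[of i] by (smt (verit) divide_le_eq mult_left_mono norm_ge_zero mult_cancel_left1 zero_less_mult_iff exp_gt_zero mult.right_neutral)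
  then have "bdd_above (range (\<lambda>i. cmod (x i) / exp (t * a i)))" by (intro bdd_aboveI2)
  then have up: "cmod (x i) / exp (t * a i) \<le> R" for i unfolding R_def by (rule cSUP_upper[rotated]) simp
  then have xR: "cmod (x i) \<le> R * exp (t * a i)" for i by (simp add: divide_le_eq)
  have R: "0 \<le> R" using order_trans[OF _ up[of 0]] by simp
  have Y: "0 \<le> Y" using order_trans[OF norm_ge_zero y[of 0]] .
  have "R \<le> Y / cmod l + R / 2"
    unfolding R_def
  proof (rule cSUP_least)
    fix i
    have "cmod l * cmod (x i) = cmod (y i + matrix_op x i)" using eq[of i] by (simp flip: norm_mult)
    also have "\<dots> \<le> Y + (cmod l / 2) * R * exp (t * a i)"
      using norm_triangle_ineq[of "y i" "matrix_op x i"] y[of i] matrix_op_weighted_bound[OF t(1) x xR R, of i] t(2) by simp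
    also have "\<dots> \<le> Y * exp (t * a i) + (cmod l / 2) * R * exp (t * a i)"
      using e1[of i] Y mult_left_mono[of 1 "exp (t * a i)" Y] by simp
    finally have "cmod l * (cmod (x i) / exp (t * a i)) \<le> Y + (cmod l / 2) * R"
      by (simp add: divide_le_eq distrib_right)
    then show "cmod (x i) / exp (t * a i) \<le> Y / cmod l + (SUP i. cmod (x i) / exp (t * a i)) / 2"
      using l unfolding R_def[symmetric] by (simp add: field_simps)
  qed simp
  then have R2: "R \<le> 2 * Y / cmod l" by simp
  have "cmod (x i) \<le> R * exp (t * a i)" by (rule xR)
  also have "\<dots> \<le> (2 * Y / cmod l) * exp (t * L)"
    using R2 R t a_le[of i] by (intro mult_mono) auto
  finally show ?thesis by (simp add: t_def)
qed

text \<open>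
  The Neumann series converges geometrically in the weighted norm of \<open>matrix_op_weighted_bound\<close>; the limit is
  taken coordinatewise, with Tannery's theorem for the infinite rows.
\<close>
lemma resolvent_exists:
  assumes l: "l \<noteq> 0" and y: "\<And>i. cmod (y i) \<le> Y"
  shows "\<exists>x R0. (\<forall>j. cmod (x j) \<le> R0) \<and> (\<forall>i. l * x i = y i + matrix_op x i)"
proof -
  define t where "t = 2 * \<kappa> / cmod l"
  have t: "0 < t" "\<kappa> / t = cmod l / 2" using l \<kappa> by (auto simp: t_def)
  define Z where "Z = Y / cmod l"
  have Z: "0 \<le> Z" using order_trans[OF norm_ge_zero y[of 0]] by (simp add: Z_def)
  define v where "v n = ((\<lambda>u i. matrix_op u i / l) ^^ n) (\<lambda>i. y i / l)" for n
  have v_Suc: "v (Suc n) i = matrix_op (v n) i / l" for n i by (simp add: v_def)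
  have v_le: "cmod (v n i) \<le> Z * (1/2) ^ n * exp (t * a i) \<and> cmod (v n i) \<le> Z * (1/2) ^ n * exp (t * L)" for n i
  proof (induction n arbitrary: i)
    case 0
    have "cmod (v 0 i) \<le> Z" using y[of i] l by (simp add: v_def Z_def norm_divide divide_right_mono)
    also have "Z \<le> Z * exp (t * a i)" using Z t a_nonneg[of i] mult_left_mono[of 1 "exp (t * a i)" Z] by simp
    finally have le: "cmod (v 0 i) \<le> Z * exp (t * a i)" .
    also have "\<dots> \<le> Z * exp (t * L)" using Z t a_le[of i] by (intro mult_left_mono) auto
    finally show ?case using le by simp
  next
    case (Suc n)
    have "cmod (matrix_op (v n) i) \<le> (\<kappa> / t) * (Z * (1/2) ^ n) * exp (t * a i)"
      using Suc Z by (intro matrix_op_weighted_bound[OF t(1), of "v n" "Z * (1/2) ^ n * exp (t * L)"]) auto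
    then have le: "cmod (v (Suc n) i) \<le> Z * (1/2) ^ Suc n * exp (t * a i)"
      using l unfolding t(2) by (simp add: v_Suc norm_divide divide_le_eq mult_ac)
    also have "\<dots> \<le> Z * (1/2) ^ Suc n * exp (t * L)"
      using Z t a_le[of i] by (intro mult_left_mono) auto
    finally show ?case using le by blast
  qed
  define Q where "Q = Z * 2 * exp (t * L)"
  have geo: "(\<lambda>n. Z * (1/2) ^ n * exp (t * L)) sums Q"
    using sums_mult2[OF sums_mult[OF geometric_sums[of "1/2::real"], of Z], of "exp (t * L)"] by (simp add: Q_def)
  have v_s: "summable (\<lambda>n. cmod (v n i))" for i
    by (rule summable_comparison_test'[OF sums_summable[OF geo], of 0]) (use v_le in auto)
  define x where "x i = (\<Sum>n. v n i)" for i
  define X where "X N i = (\<Sum>n<N. v n i)" for N i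
  have X_Suc: "X (Suc N) i = X N i + v N i" for N i by (simp add: X_def)
  have X_lim: "(\<lambda>N. X N i) \<longlonglongrightarrow> x i" for i
    unfolding X_def x_def using summable_LIMSEQ[OF summable_norm_cancel[OF v_s]] .
  have X_le: "cmod (X N i) \<le> Q" for N i
  proof -
    have "cmod (X N i) \<le> (\<Sum>n<N. Z * (1/2) ^ n * exp (t * L))"
      unfolding X_def by (rule sum_norm_le) (use v_le in blast)
    also have "\<dots> \<le> (\<Sum>n. Z * (1/2) ^ n * exp (t * L))"
      using Z by (intro sum_le_suminf sums_summable[OF geo]) auto
    finally show ?thesis using sums_unique[OF geo] by simp
  qed
  have x_le: "cmod (x i) \<le> Q" for i
    by (rule LIMSEQ_le_const2[OF tendsto_norm[OF X_lim]]) (use X_le in blast)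
  have iter: "l * X (Suc N) i = y i + matrix_op (X N) i" for N i
  proof (induction N)
    case 0
    then show ?case using l by (simp add: X_def v_def matrix_op_def)
  next
    case (Suc N)
    have "X (Suc N) = (\<lambda>j. X N j + v N j)" by (simp add: X_Suc fun_eq_iff)
    then have "matrix_op (X (Suc N)) i = matrix_op (\<lambda>j. X N j + v N j) i" by simp
    also have "\<dots> = matrix_op (X N) i + matrix_op (v N) i"
      by (rule matrix_op_add[of _ Q _ "Z * (1/2) ^ N * exp (t * L)"]) (use X_le v_le in auto)
    finally have "y i + matrix_op (X (Suc N)) i = l * X (Suc N) i + l * v (Suc N) i"
      using Suc l by (simp add: v_Suc)
    then show ?case unfolding X_Suc[of "Suc N"] by (simp add: distrib_left)
  qed
  have "l * x i = y i + matrix_op x i" for i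
  proof (rule LIMSEQ_unique)
    show "(\<lambda>N. l * X (Suc N) i) \<longlonglongrightarrow> l * x i"
      by (intro tendsto_mult tendsto_const LIMSEQ_Suc X_lim)
    have "(\<lambda>N. \<Sum>j. complex_of_real (m i j) * X N j) \<longlonglongrightarrow> (\<Sum>j. complex_of_real (m i j) * x j)"
    proof (rule tannerys_theorem[THEN conjunct2, THEN conjunct2])
      show "(\<lambda>N. complex_of_real (m i j) * X N j) \<longlonglongrightarrow> complex_of_real (m i j) * x j" for j
        by (intro tendsto_mult tendsto_const X_lim)
      show "\<forall>\<^sub>F (j, N) in sequentially \<times>\<^sub>F sequentially. norm (complex_of_real (m i j) * X N j) \<le> m i j * Q"
        using m_nonneg X_le by (intro always_eventually) (auto simp: norm_mult intro!: mult_left_mono)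
      show "summable (\<lambda>j. m i j * Q)" by (rule summable_mult2[OF row_summable])
    qed simp
    then show "(\<lambda>N. l * X (Suc N) i) \<longlonglongrightarrow> y i + matrix_op x i"
      unfolding iter by (intro tendsto_add tendsto_const) (simp add: matrix_op_def)
  qed
  then show ?thesis using x_le by blast
qed

lemma operator_eq_matrix_op:
  assumes "operator_with_matrix p T (\<lambda>i j. complex_of_real (m i j))" "x \<in> lp p"
  shows "T x = matrix_op x"
proof
  show "T x i = matrix_op x i" for i
    unfolding matrix_op_def using assms sums_unique[of _ "T x i"] by (simp add: operator_with_matrix_def)
qed

text \<open>
  The matrix maps bounded sequences to absolutely summable ones. So a bounded solution \<open>x\<close> of
  \<open>l x = y + matrix_op x\<close> lies in \<open>lp p\<close> whenever \<open>y\<close> does, and all spectral questions can be decided among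
  bounded sequences.
\<close>
lemma matrix_op_lp:
  assumes p: "1 \<le> p" and x: "\<And>j. cmod (x j) \<le> R"
  shows "matrix_op x \<in> lp p" and "lp_norm p (matrix_op x) \<le> R * \<kappa> * (\<Sum>i. \<rho> i)"
proof -
  have s: "summable (\<lambda>i. R * \<kappa> * \<rho> i)" by (rule summable_mult[OF \<rho>_summable])
  have sx: "summable (\<lambda>i. cmod (matrix_op x i))"
    by (rule summable_comparison_test'[OF s, of 0]) (use matrix_op_bound[OF x] in auto)
  show "matrix_op x \<in> lp p" by (rule absolutely_summable_lp(1)[OF p sx])
  have "lp_norm p (matrix_op x) \<le> (\<Sum>i. cmod (matrix_op x i))" by (rule absolutely_summable_lp(2)[OF p sx])
  also have "\<dots> \<le> (\<Sum>i. R * \<kappa> * \<rho> i)" by (rule suminf_le[OF matrix_op_bound[OF x] sx s])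
  also have "\<dots> = R * \<kappa> * (\<Sum>i. \<rho> i)" by (rule suminf_mult[OF \<rho>_summable])
  finally show "lp_norm p (matrix_op x) \<le> R * \<kappa> * (\<Sum>i. \<rho> i)" .
qed

lemma matrix_op_operator:
  assumes p: "1 \<le> p"
  shows "operator_with_matrix p matrix_op (\<lambda>i j. complex_of_real (m i j))"
  unfolding operator_with_matrix_def bounded_operator_def
proof (intro conjI ballI allI exI)
  fix x assume x: "x \<in> lp p"
  note bx = lp_coordinate_le[OF p x]
  show "matrix_op x \<in> lp p" by (rule matrix_op_lp(1)[OF p bx])
  show "lp_norm p (matrix_op x) \<le> (\<kappa> * (\<Sum>i. \<rho> i)) * lp_norm p x"
    using matrix_op_lp(2)[OF p bx] by (simp add: mult_ac)
  show "matrix_op (\<lambda>i. x i + y i) = (\<lambda>i. matrix_op x i + matrix_op y i)" if "y \<in> lp p" for y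
    by (rule ext, rule matrix_op_add) (rule bx, rule lp_coordinate_le[OF p that])
  show "matrix_op (\<lambda>i. s * x i) = (\<lambda>i. s * matrix_op x i)" for s
    by (rule ext, rule matrix_op_scale) (rule bx)
  show "(\<lambda>j. complex_of_real (m i j) * x j) sums matrix_op x i" for i
    unfolding matrix_op_def by (rule summable_sums[OF matrix_op_summable[OF bx]])
qed

lemma resolvent_unique:
  assumes l: "l \<noteq> 0" and x: "\<And>j. cmod (x j) \<le> R" and x': "\<And>j. cmod (x' j) \<le> R'"
    and eq: "\<And>i. l * x i = y i + matrix_op x i" and eq': "\<And>i. l * x' i = y i + matrix_op x' i"
  shows "x = x'"
proof
  fix i
  have "cmod (x i - x' i) \<le> (2 * 0 / cmod l) * exp (2 * \<kappa> / cmod l * L)"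
  proof (rule resolvent_estimate[OF l, of "\<lambda>i. x i - x' i" "R + R'" "\<lambda>i. 0"])
    show "cmod (x j - x' j) \<le> R + R'" for j
      using norm_triangle_ineq4[of "x j" "x' j"] x[of j] x'[of j] by linarith
    show "l * (x i - x' i) = 0 + matrix_op (\<lambda>i. x i - x' i) i" for i
      unfolding matrix_op_diff[of x, OF x, of x', OF x'] using eq[of i] eq'[of i]
      by (simp add: right_diff_distrib)
  qed simp
  then show "x i = x' i" by simp
qed

lemma quasinilpotent:
  assumes p: "1 \<le> p" and T: "operator_with_matrix p T (\<lambda>i j. complex_of_real (m i j))"
  shows "quasinilpotent p T"
proof -
  have "l \<notin> spectrum p T" if l: "l \<noteq> 0" for l
  proof -
    define sol where "sol y x \<longleftrightarrow> (\<exists>R0. \<forall>j. cmod (x j) \<le> R0) \<and> (\<forall>i. l * x i = y i + matrix_op x i)" for y x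
    define S where "S y = (SOME x. sol y x)" for y
    have S: "sol y (S y)" if y: "y \<in> lp p" for y
    proof -
      have "\<exists>x. sol y x"
        using resolvent_exists[of l y "lp_norm p y", OF l lp_coordinate_le[OF p y]]
        unfolding sol_def by blast
      then show ?thesis unfolding S_def by (rule someI_ex)
    qed
    have uniq: "x = x'" if "sol y x" "sol y x'" for x x' y
      using that unfolding sol_def by (elim conjE exE) (rule resolvent_unique[OF l]; blast)
    have S_lp: "S y \<in> lp p" and S_norm: "lp_norm p (S y) \<le>
        (1 / cmod l + (2 / cmod l) * exp (2 * \<kappa> / cmod l * L) * \<kappa> * (\<Sum>i. \<rho> i) / cmod l) * lp_norm p y"
      if y: "y \<in> lp p" for y
    proof -
      let ?R = "(2 * lp_norm p y / cmod l) * exp (2 * \<kappa> / cmod l * L)"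
      obtain R0 where R0: "\<And>j. cmod (S y j) \<le> R0" and eq: "\<And>i. l * S y i = y i + matrix_op (S y) i"
        using S[OF y] unfolding sol_def by blast
      have bd: "cmod (S y j) \<le> ?R" for j
        by (rule resolvent_estimate[OF l R0 lp_coordinate_le[OF p y] eq])
      have form: "S y = (\<lambda>i. (1 / l) * (y i + matrix_op (S y) i))"
        using eq l by (auto simp: fun_eq_iff field_simps)
      have image_lp: "matrix_op (S y) \<in> lp p" "lp_norm p (matrix_op (S y)) \<le> ?R * \<kappa> * (\<Sum>i. \<rho> i)"
        by (rule matrix_op_lp[OF p], rule bd)+
      note sum = lp_minkowski[OF p y image_lp(1)]
      show "S y \<in> lp p" by (subst form) (rule lp_scale(1)[OF p sum(1)])
      have "lp_norm p (S y) = lp_norm p (\<lambda>i. (1 / l) * (y i + matrix_op (S y) i))"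
        by (subst form) (rule refl)
      also have "\<dots> = (1 / cmod l) * lp_norm p (\<lambda>i. y i + matrix_op (S y) i)"
        using lp_scale(2)[OF p sum(1), of "1 / l"] by (simp only: norm_divide norm_one)
      also have "\<dots> \<le> (1 / cmod l) * (lp_norm p y + ?R * \<kappa> * (\<Sum>i. \<rho> i))"
        using order_trans[OF sum(2) add_left_mono[OF image_lp(2)]] by (intro mult_left_mono) auto
      finally show "lp_norm p (S y) \<le>
          (1 / cmod l + (2 / cmod l) * exp (2 * \<kappa> / cmod l * L) * \<kappa> * (\<Sum>i. \<rho> i) / cmod l) * lp_norm p y"
        by (simp add: algebra_simps)
    qed
    have "bounded_operator p S"
      unfolding bounded_operator_def
    proof (intro conjI ballI allI exI)
      fix x assume x: "x \<in> lp p"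
      show "S x \<in> lp p" by (rule S_lp[OF x])
      show "lp_norm p (S x) \<le>
        (1 / cmod l + (2 / cmod l) * exp (2 * \<kappa> / cmod l * L) * \<kappa> * (\<Sum>i. \<rho> i) / cmod l) * lp_norm p x"
        by (rule S_norm[OF x])
      note bx = lp_coordinate_le[OF p S_lp[OF x]]
      show "S (\<lambda>i. x i + y i) = (\<lambda>i. S x i + S y i)" if y: "y \<in> lp p" for y
      proof (rule uniq[OF S[OF lp_minkowski(1)[OF p x y]]])
        note b_y = lp_coordinate_le[OF p S_lp[OF y]]
        have "cmod (S x j + S y j) \<le> lp_norm p (S x) + lp_norm p (S y)" for j
          using norm_triangle_ineq[of "S x j" "S y j"] bx[of j] b_y[of j] by linarith
        then show "sol (\<lambda>i. x i + y i) (\<lambda>i. S x i + S y i)"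
          using S[OF x] S[OF y] unfolding sol_def matrix_op_add[of "S x", OF bx, of "S y", OF b_y]
          by (auto simp: distrib_left)
      qed
      show "S (\<lambda>i. s * x i) = (\<lambda>i. s * S x i)" for s
      proof (rule uniq[OF S[OF lp_scale(1)[OF p x]]])
        have "cmod (s * S x j) \<le> cmod s * lp_norm p (S x)" for j
          using bx[of j] by (simp add: norm_mult mult_left_mono)
        moreover have "l * (s * S x i) = s * x i + s * matrix_op (S x) i" for i
          using S[OF x] by (simp add: sol_def mult.left_commute[of l] distrib_left)
        ultimately show "sol (\<lambda>i. s * x i) (\<lambda>i. s * S x i)"
          unfolding sol_def matrix_op_scale[of "S x", OF bx] by blast
      qed
    qed
    moreover have "S (\<lambda>i. l * x i - T x i) = x \<and> (\<lambda>i. l * S x i - T (S x) i) = x" if x: "x \<in> lp p" for x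
    proof
      have "T x \<in> lp p" using T x by (auto simp: operator_with_matrix_def intro: bounded_operatorD(1))
      then have "(\<lambda>i. l * x i - T x i) \<in> lp p" by (rule lp_diff[OF p lp_scale(1)[OF p x]])
      then show "S (\<lambda>i. l * x i - T x i) = x"
      proof (rule uniq[OF S])
        show "sol (\<lambda>i. l * x i - T x i) x"
          using lp_coordinate_le[OF p x] by (auto simp: sol_def operator_eq_matrix_op[OF T x])
      qed
      show "(\<lambda>i. l * S x i - T (S x) i) = x"
        using S[OF x] by (simp add: sol_def operator_eq_matrix_op[OF T S_lp[OF x]])
    qed
    ultimately show ?thesis unfolding spectrum_def by blast
  qed
  then have "\<forall>l\<in>spectrum p T. ennreal (cmod l) = 0" by (metis ennreal_0 norm_zero)
  then have "spectral_radius p T \<le> 0"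
    unfolding spectral_radius_def by (intro SUP_least) simp
  then show ?thesis using T by (simp add: quasinilpotent_def operator_with_matrix_def)
qed

text \<open>
  The unit ball is mapped into a box whose side lengths are summable. Such a box is compact for coordinatewise
  convergence, and by dominated convergence this is norm convergence there.
\<close>
lemma compact:
  assumes p: "1 \<le> p"
  shows "compact_operator p matrix_op"
proof -
  interpret M: Metric_space "lp p" "lp_dist p" by (rule Metric_space_lp[OF p])
  define r where "r i = \<kappa> * \<rho> i" for i
  have r: "0 \<le> r i" "summable r" for i
    using \<kappa> \<rho>_nonneg[of i] \<rho>_summable by (auto simp: r_def[abs_def] intro: summable_mult)
  define B where "B = {y :: nat \<Rightarrow> complex. \<forall>i. cmod (y i) \<le> r i}"
  have B_lp: "y \<in> lp p" if "y \<in> B" for y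
    by (rule absolutely_summable_lp(1)[OF p], rule summable_comparison_test'[OF r(2), of 0])
      (use that in \<open>auto simp: B_def\<close>)
  have "compactin (product_topology (\<lambda>i. euclidean) UNIV) (PiE UNIV (\<lambda>i. cball (0::complex) (r i)))"
    unfolding compactin_PiE compactin_euclidean_iff by simp
  moreover have "B = PiE UNIV (\<lambda>i. cball 0 (r i))" by (auto simp: B_def PiE_def Pi_def)
  ultimately have "compact B" by (simp only: euclidean_product_topology compactin_euclidean_iff)
  then have seq: "seq_compact B" by (simp add: compact_eq_seq_compact_metric)
  have B: "compactin M.mtopology B"
    unfolding M.compactin_sequentially
  proof (intro conjI allI impI)
    show "B \<subseteq> lp p" using B_lp by blast
    fix s :: "nat \<Rightarrow> nat \<Rightarrow> complex" assume s: "range s \<subseteq> B"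
    then obtain l \<sigma> where l: "l \<in> B" and \<sigma>: "strict_mono (\<sigma> :: nat \<Rightarrow> nat)" and lim: "(s \<circ> \<sigma>) \<longlonglongrightarrow> l"
      using seq unfolding seq_compact_def by (meson range_subsetD)
    have coord: "(\<lambda>n. s (\<sigma> n) i) \<longlonglongrightarrow> l i" for i
      using continuous_on_tendsto_compose[OF continuous_on_product_coordinates lim, of i] by (simp add: o_def)
    have sB: "cmod (s (\<sigma> n) i) \<le> r i" for n i using s by (auto simp: B_def)
    have diff_le: "cmod (s (\<sigma> n) i - l i) \<le> 2 * r i" for n i
      using norm_triangle_ineq4[of "s (\<sigma> n) i" "l i"] sB[of n i] l by (auto simp: B_def dest: spec[of _ i])
    have diff_s: "summable (\<lambda>i. cmod (s (\<sigma> n) i - l i))" for n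
      by (rule summable_comparison_test'[OF summable_mult[OF r(2), of 2], of 0]) (use diff_le in auto)
    have "(\<lambda>n. \<Sum>i. cmod (s (\<sigma> n) i - l i)) \<longlonglongrightarrow> (\<Sum>i::nat. 0)"
    proof (rule tannerys_theorem[THEN conjunct2, THEN conjunct2])
      show "(\<lambda>n. cmod (s (\<sigma> n) i - l i)) \<longlonglongrightarrow> 0" for i
        using coord[of i] by (simp add: LIM_zero_iff tendsto_norm_zero)
      show "\<forall>\<^sub>F (i, n) in sequentially \<times>\<^sub>F sequentially. norm (cmod (s (\<sigma> n) i - l i)) \<le> 2 * r i"
        using diff_le by (intro always_eventually) auto
      show "summable (\<lambda>i. 2 * r i)" by (rule summable_mult[OF r(2)])
    qed simp
    then have lim0: "(\<lambda>n. \<Sum>i. cmod (s (\<sigma> n) i - l i)) \<longlonglongrightarrow> 0" by simp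
    have "(\<lambda>n. lp_dist p (s (\<sigma> n)) l) \<longlonglongrightarrow> 0"
    proof (rule null_sandwich[OF _ _ lim0])
      show "lp_dist p (s (\<sigma> n)) l \<le> (\<Sum>i. cmod (s (\<sigma> n) i - l i))" for n
        unfolding lp_dist_def using absolutely_summable_lp(2)[OF p diff_s] by (simp add: fun_diff_def)
    qed simp
    moreover have "s (\<sigma> n) \<in> lp p" for n using s B_lp by blast
    ultimately have "limitin M.mtopology (s \<circ> \<sigma>) l sequentially"
      using B_lp[OF l] by (simp add: M.limitin_metric_dist_null o_def)
    then show "\<exists>l \<sigma>. l \<in> B \<and> strict_mono \<sigma> \<and> limitin M.mtopology (s \<circ> \<sigma>) l sequentially"
      using l \<sigma> by blast
  qed
  have "matrix_op x \<in> B" if "x \<in> lp p" "lp_norm p x \<le> 1" for x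
    unfolding B_def r_def using matrix_op_bound[of x 1, OF order_trans[OF lp_coordinate_le[OF p that(1)] that(2)]] by simp
  then have "matrix_op ` {x \<in> lp p. lp_norm p x \<le> 1} \<subseteq> B" by blast
  then have "M.mtopology closure_of (matrix_op ` {x \<in> lp p. lp_norm p x \<le> 1}) \<subseteq> B"
    using compactin_imp_closedin[OF M.Hausdorff_space_mtopology B] by (rule closure_of_minimal)
  then have "compactin M.mtopology (M.mtopology closure_of (matrix_op ` {x \<in> lp p. lp_norm p x \<le> 1}))"
    by (rule closed_compactin[OF B]) simp
  then show ?thesis
    using matrix_op_operator[OF p] by (simp add: compact_operator_def operator_with_matrix_def)
qed

end

section \<open>Potentials of acyclic graphs and the equivalence\<close>

text \<open>
  The potential of \<open>i\<close> is the total weight of the vertices reachable from \<open>i\<close>. From the target \<open>j\<close> of an edge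
  out of \<open>i\<close> one reaches no new vertices and, in the absence of cycles, not \<open>i\<close> itself.
\<close>
lemma acyclic_potential:
  fixes G :: "(nat \<times> nat) set" and \<rho> :: "nat \<Rightarrow> real"
  assumes G: "acyclic G" and \<rho>: "\<And>i. 0 \<le> \<rho> i" "summable \<rho>"
  obtains a where "\<And>i. 0 \<le> a i" "\<And>i. a i \<le> suminf \<rho>" "\<And>i j. (i, j) \<in> G \<Longrightarrow> a j + \<rho> i \<le> a i"
proof
  define f where "f i u = (if (i, u) \<in> G\<^sup>* then \<rho> u else 0)" for i u
  define a where "a i = (\<Sum>u. f i u)" for i
  have f: "0 \<le> f i u" "f i u \<le> \<rho> u" for i u using \<rho>(1) by (auto simp: f_def)
  have fs: "summable (f i)" for i
    by (rule summable_comparison_test'[OF \<rho>(2), of 0]) (use f in auto)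
  show "0 \<le> a i" for i unfolding a_def by (rule suminf_nonneg[OF fs f(1)])
  show "a i \<le> suminf \<rho>" for i unfolding a_def by (rule suminf_le[OF f(2) fs \<rho>(2)])
  fix i j assume ij: "(i, j) \<in> G"
  have single: "(\<lambda>u. if u = i then \<rho> u else 0) sums \<rho> i"
    using sums_single[of i \<rho>] by simp
  have "a j + \<rho> i = (\<Sum>u. f j u + (if u = i then \<rho> u else 0))"
    unfolding a_def using suminf_add[OF fs sums_summable[OF single]] sums_unique[OF single] by simp
  also have "\<dots> \<le> a i"
    unfolding a_def
  proof (rule suminf_le)
    fix u
    have "(j, i) \<notin> G\<^sup>*" using G ij by (meson acyclic_def rtrancl_into_trancl2)
    then show "f j u + (if u = i then \<rho> u else 0) \<le> f i u"
      using ij \<rho>(1)[of u] by (auto simp: f_def intro: converse_rtrancl_into_rtrancl)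
  qed (intro summable_add fs sums_summable[OF single], rule fs)
  finally show "a j + \<rho> i \<le> a i" .
qed

lemma diagonal_operator_bounded:
  fixes a :: "nat \<Rightarrow> real"
  assumes p: "1 \<le> p" and a: "\<And>i. 0 \<le> a i" "\<And>i. a i \<le> L"
  defines "A \<equiv> \<lambda>x i. complex_of_real (a i) * x i"
  shows "diagonal_operator p A" and "positive_operator p A"
proof -
  let ?t = "\<lambda>i j. complex_of_real (if i = j then a i else 0)"
  have L: "0 \<le> L" using a[of 0] by linarith
  have A: "operator_with_matrix p A ?t"
    unfolding operator_with_matrix_def bounded_operator_def
  proof (intro conjI ballI allI exI)
    fix x assume x: "x \<in> lp p"
    have le: "cmod (A x i) \<le> cmod (complex_of_real L * x i)" for i
      using a[of i] L by (simp add: A_def norm_mult mult_right_mono)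
    note dom = lp_domination[OF p lp_scale(1)[OF p x, of "complex_of_real L"] le]
    show "A x \<in> lp p" by (rule dom(1))
    show "lp_norm p (A x) \<le> L * lp_norm p x"
      using dom(2) lp_scale(2)[OF p x, of "complex_of_real L"] L by simp
    show "(\<lambda>j. ?t i j * x j) sums A x i" for i
    proof -
      have "(\<lambda>j. ?t i j * x j) = (\<lambda>j. if j = i then complex_of_real (a j) * x j else 0)" by auto
      then show ?thesis using sums_single[of i "\<lambda>j. complex_of_real (a j) * x j"] by (simp add: A_def)
    qed
  qed (simp_all add: A_def distrib_left mult_ac)
  then show "diagonal_operator p A" by (auto simp: diagonal_operator_def intro!: exI[of _ ?t])
  show "positive_operator p A" by (rule positive_matrix_positive_operator[OF A]) (use a in auto)
qed

theorem theorem4p1: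
  fixes p :: ennreal
    and C :: "(nat \<Rightarrow> complex) \<Rightarrow> (nat \<Rightarrow> complex)"
    and c :: "nat \<Rightarrow> nat \<Rightarrow> real"
  assumes "1 \<le> p"
    and "operator_with_matrix p C (\<lambda>i j. complex_of_real (c i j))"
    and "\<forall>i j. 0 \<le> c i j"
    and "(\<Sum>i. \<Sum>j. ennreal (sqrt (c i j))) < \<infinity>"
  shows "((\<exists>A B. diagonal_operator p A \<and> positive_operator p A \<and>
             quasinilpotent p B \<and> compact_operator p B \<and> positive_operator p B \<and>
             is_commutator p C A B)
          \<longleftrightarrow> quasinilpotent p C) \<and>
         ((\<exists>A B. positive_operator p A \<and> positive_operator p B \<and>
             (compact_operator p A \<or> compact_operator p B) \<and>
             is_commutator p C A B)
          \<longleftrightarrow> quasinilpotent p C)"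
    (is "(?a \<longleftrightarrow> ?c) \<and> (?b \<longleftrightarrow> ?c)")
proof -
  note p = assms(1) and C = assms(2)
  have c: "0 \<le> c i j" for i j using assms(3) by blast
  let ?G = "{(i, j). 0 < c i j}"
  define w where "w i j = sqrt (c i j)" for i j
  define \<rho> where "\<rho> i = (\<Sum>j. w i j)" for i
  have w: "0 \<le> w i j" "w i j * w i j = c i j" for i j using c by (auto simp: w_def)
  have ws: "summable (w i)" for i
  proof (rule summable_suminf_not_top[OF w(1)])
    have "(\<Sum>j. ennreal (w i j)) \<le> (\<Sum>i. \<Sum>j. ennreal (w i j))"
      using sum_le_suminf[OF summableI, of "{i}" "\<lambda>i. \<Sum>j. ennreal (w i j)"] by simp
    then show "(\<Sum>j. ennreal (w i j)) \<noteq> top" using assms(4) by (auto simp: w_def top_unique)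
  qed
  have \<rho>: "0 \<le> \<rho> i" for i unfolding \<rho>_def by (rule suminf_nonneg[OF ws w(1)])
  have "ennreal (\<rho> i) = (\<Sum>j. ennreal (w i j))" for i
    unfolding \<rho>_def by (rule suminf_ennreal2[OF w(1) ws, symmetric])
  then have \<rho>s: "summable \<rho>"
    using assms(4) by (intro summable_suminf_not_top[OF \<rho>]) (simp add: w_def less_top)
  have w\<rho>: "w i j \<le> \<rho> i" for i j
    using sum_le_suminf[OF ws, of "{j}" i] w(1) by (simp add: \<rho>_def)
  have \<rho>_le: "\<rho> i \<le> suminf \<rho>" for i
    using sum_le_suminf[OF \<rho>s, of "{i}"] \<rho> by simp
  have ab: ?b if ?a using that by blast
  have b_acyclic: "acyclic ?G" if ?b using that commutator_acyclic[OF p C c] by blast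
  have c_acyclic: "acyclic ?G" if ?c by (rule quasinilpotent_acyclic[OF p C c that])
  have acyclic_ac: "?a \<and> ?c" if G: "acyclic ?G"
  proof
    obtain a where a: "\<And>i. 0 \<le> a i" "\<And>i. a i \<le> suminf \<rho>" and drop: "\<And>i j. (i, j) \<in> ?G \<Longrightarrow> a j + \<rho> i \<le> a i"
      using acyclic_potential[OF G \<rho> \<rho>s] by metis
    \<comment> \<open>Each \<open>w i j\<close> is at most the total weight; adding 1 keeps the bound positive.\<close>
    define \<kappa> where "\<kappa> = suminf \<rho> + 1"
    have \<kappa>: "0 < \<kappa>" using \<rho>_le[of 0] \<rho>[of 0] by (simp add: \<kappa>_def)
    have c_le: "c i j \<le> \<kappa> * w i j" for i j
    proof -
      have "w i j \<le> \<kappa>" using w\<rho>[of i j] \<rho>_le[of i] by (simp add: \<kappa>_def)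
      then show ?thesis using mult_right_mono[OF _ w(1)[of i j]] w(2)[of i j] by metis
    qed
    have cs: "summable (c i)" for i
      by (rule summable_comparison_test'[OF summable_mult[OF ws, of \<kappa>], of 0]) (use c c_le in auto)
    interpret Cm: acyclic_matrix c a \<rho> \<kappa> "suminf \<rho>"
    proof
      show "(\<Sum>j. c i j) \<le> \<kappa> * \<rho> i" for i
        using suminf_le[OF c_le cs summable_mult[OF ws]] suminf_mult[OF ws] by (simp add: \<rho>_def)
    qed (use c cs \<kappa> \<rho> \<rho>s a drop in auto)
    show ?c by (rule Cm.quasinilpotent[OF p C])
    \<comment> \<open>The solution of \<open>(a i - a j) * b i j = c i j\<close>. Where \<open>a i = a j\<close>, there is no edge and division by 0 gives
      the value 0 that is needed.\<close>
    define b where "b i j = c i j / (a i - a j)" for i j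
    have gap: "w i j \<le> a i - a j" "0 < a i - a j" if "0 < c i j" for i j
    proof -
      show "w i j \<le> a i - a j" using drop[of i j] that w\<rho>[of i j] by simp
      moreover have "0 < w i j" using that by (simp add: w_def)
      ultimately show "0 < a i - a j" by linarith
    qed
    have b: "0 \<le> b i j \<and> b i j \<le> w i j \<and> (a i - a j) * b i j = c i j \<and> (0 < b i j \<longrightarrow> 0 < c i j)" for i j
    proof (cases "0 < c i j")
      case True
      have "c i j \<le> w i j * (a i - a j)"
        using mult_left_mono[OF gap(1)[OF True] w(1)[of i j]] w(2)[of i j] by simp
      then show ?thesis using gap(2)[OF True] True by (simp add: b_def divide_le_eq)
    next
      case False
      then have "c i j = 0" using c[of i j] by linarith
      then show ?thesis using w(1) by (simp add: b_def)
    qed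
    have bs: "summable (b i)" for i
      by (rule summable_comparison_test'[OF ws[of i], of 0]) (use b in auto)
    interpret Bm: acyclic_matrix b a \<rho> 1 "suminf \<rho>"
    proof
      show "(\<Sum>j. b i j) \<le> 1 * \<rho> i" for i
        using suminf_le[OF _ bs ws, of i] b by (simp add: \<rho>_def)
    qed (use b bs \<rho> \<rho>s a drop in auto)
    define A where "A = (\<lambda>x i. complex_of_real (a i) * x i)"
    have A: "diagonal_operator p A" "positive_operator p A"
      unfolding A_def using diagonal_operator_bounded[OF p a] by auto
    note Bop = Bm.matrix_op_operator[OF p]
    have "is_commutator p C A Bm.matrix_op"
      unfolding is_commutator_def
    proof (intro ballI ext)
      fix x i assume x: "x \<in> lp p"
      have Ax: "A x \<in> lp p" using A(2) x by (auto simp: positive_operator_def intro: bounded_operatorD(1))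
      have s1: "(\<lambda>j. complex_of_real (b i j) * x j) sums Bm.matrix_op x i"
        and s2: "(\<lambda>j. complex_of_real (b i j) * A x j) sums Bm.matrix_op (A x) i"
        using Bop x Ax by (auto simp: operator_with_matrix_def)
      have "(\<lambda>j. complex_of_real (a i) * (complex_of_real (b i j) * x j) - complex_of_real (b i j) * A x j)
          sums (A (Bm.matrix_op x) i - Bm.matrix_op (A x) i)"
        using sums_diff[OF sums_mult[OF s1, of "complex_of_real (a i)"] s2] by (simp add: A_def)
      moreover have "complex_of_real (a i) * (complex_of_real (b i j) * x j) - complex_of_real (b i j) * A x j
          = complex_of_real (c i j) * x j" for j
      proof -
        have "complex_of_real (a i) * (complex_of_real (b i j) * x j) - complex_of_real (b i j) * A x j
            = complex_of_real ((a i - a j) * b i j) * x j"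
          by (simp add: A_def algebra_simps)
        then show ?thesis using b[of i j] by simp
      qed
      ultimately have "(\<lambda>j. complex_of_real (c i j) * x j) sums (A (Bm.matrix_op x) i - Bm.matrix_op (A x) i)" by simp
      moreover have "(\<lambda>j. complex_of_real (c i j) * x j) sums C x i"
        using C x by (simp add: operator_with_matrix_def)
      ultimately show "C x i = (A (Bm.matrix_op x) - Bm.matrix_op (A x)) i"
        using sums_unique2 by (fastforce simp: fun_diff_def)
    qed
    then show ?a
      using A Bm.quasinilpotent[OF p Bop] Bm.compact[OF p]
        positive_matrix_positive_operator[OF Bop] b by blast
  qed
  show ?thesis using ab b_acyclic c_acyclic acyclic_ac by blast
qed

end
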